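(* Let $(\hat\chi_1,\hat\chi_2)$ be an admissible pair of extended characters and $(\hat\chi_{2'},\hat\chi_{1'})=B(\hat\chi_1,\hat\chi_2)$. Then $\mathcal R^{\mathcal W}$ induces an algebra isomorphism $\mathcal W_\xi/I_{\hat\chi_1}\otimes\mathcal W_\xi/I_{\hat\chi_2}\to\mathcal W_\xi/I_{\hat\chi_{1'}}\otimes\mathcal W_\xi/I_{\hat\chi_{2'}}$, and there exists an invertible matrix $R:V(\hat\chi_1)\otimes V(\hat\chi_2)\to V(\hat\chi_{1'})\otimes V(\hat\chi_{2'})$ with $R\,(\pi_{\hat\chi_1}\otimes\pi_{\hat\chi_2})(u)\,R^{-1}=(\pi_{\hat\chi_{1'}}\otimes\pi_{\hat\chi_{2'}})(\mathcal R^{\mathcal W}(u))$ for all $u$ (in the quotient algebra); such an $R$ is unique up to an overall nonzero scalar.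
   Context: $N\ge2$, $\xi=e^{\pi i/N}$, $\omega=\xi^2$, $\omega^x=e^{2\pi i x/N}$. $\mathcal W_\xi$ is generated by invertible $x,y$ and central invertible $z$ with $xy=\xi^2 yx$. $\mathcal R^{\mathcal W}$ is the automorphism of $\operatorname{Div}(\mathcal W_\xi^{\otimes2})$ with $\mathcal R^{\mathcal W}(z_i)=z_i$, $\mathcal R^{\mathcal W}(x_1)=x_1g$, $\mathcal R^{\mathcal W}(x_2)=g^{-1}x_2$, $\mathcal R^{\mathcal W}(y_1^{-1})=y_2^{-1}+(y_1^{-1}-z_2^{-1}y_2^{-1})x_2^{-1}$, $\mathcal R^{\mathcal W}(y_2)=\frac{z_1}{z_2}y_1+(y_2-z_2^{-1}y_1)x_1$, $g=1-x_1^{-1}y_1(z_1-x_1)y_2^{-1}(x_2-z_2^{-1})$ (notation $x_1=x\otimes1$ etc.). An extended character $\hat\chi$ is an algebra map from the center $\mathbb C[x^{\pm N},y^{\pm N},z^{\pm1}]$ of $\mathcal W_\xi$ to $\mathbb C$; write $a=\hat\chi(x^N)$, $b=\hat\chi(y^N)$, $m=\hat\chi(z)^N$. $I_{\hat\chi}$ is the two-sided ideal of $\mathcal W_\xi$ generated by the kernel of $\hat\chi$, and $V(\hat\chi)$ is $\mathbb C^N$ with $x\hat v_n=\omega^\alpha\hat v_{n-1}$, $y\hat v_n=\omega^{\beta+n}\hat v_n$, $z\hat v_n=\omega^\mu\hat v_n$ where $\omega^{N\alpha}=a$, $\omega^{N\beta}=b$, $\omega^\mu=\hat\chi(z)$;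 $\pi_{\hat\chi}$ is its structure map (it factors through $\mathcal W_\xi/I_{\hat\chi}$). The pair $(\hat\chi_1,\hat\chi_2)$ is admissible if the numbers $a_{1'}=a_1A^{-1}$, $a_{2'}=a_2A$ with $A=1-\frac{m_1b_1}{b_2}(1-\frac{a_1}{m_1})(1-\frac1{m_2a_2})$, $b_{1'}=\frac{m_2b_2}{m_1}\big(1-m_2a_2(1-\frac{b_2}{m_1b_1})\big)^{-1}$, $b_{2'}=b_1\big(1-\frac{m_1}{a_1}(1-\frac{b_2}{m_1b_1})\big)$ are neither $0$ nor $\infty$; then $B(\hat\chi_1,\hat\chi_2)=(\hat\chi_{2'},\hat\chi_{1'})$ where $\hat\chi_{j'}$ has parameters $a_{j'},b_{j'}$ and $\hat\chi_{j'}(z)=\hat\chi_j(z)$. *)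

theory Defs
  imports "HOL-Library.Poly_Mapping" "HOL-Algebra.QuotRing" "Jordan_Normal_Form.Matrix"
begin

definition xi :: "nat \<Rightarrow> complex" where
  "xi N = exp (pi * \<i> / of_nat N)"

definition omega :: "nat \<Rightarrow> complex" where
  "omega N = (xi N)^2"

definition omega_pow :: "nat \<Rightarrow> complex \<Rightarrow> complex" where
  "omega_pow N x = exp (2 * pi * \<i> * x / of_nat N)"

text \<open>A monomial of \<open>W_\<xi>\<close> is \<open>x^a y^b z^c\<close>, encoded as \<open>(a,b,c)\<close>; elements of
  \<open>W_\<xi>\<close> are finitely supported coefficient functions on monomials. Using
  \<open>x y = \<xi>^2 y x\<close> one has \<open>y^b x^{a'} = \<omega>^{-b a'} x^{a'} y^b\<close>.\<close>

type_synonym wmon = "int \<times> int \<times> int"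
type_synonym welem = "wmon \<Rightarrow>\<^sub>0 complex"

text \<open>A monomial of \<open>W_\<xi> \<otimes> W_\<xi>\<close>: \<open>(m1, m2)\<close> stands for \<open>m1 \<otimes> m2\<close>.\<close>
type_synonym tmon = "wmon \<times> wmon"
type_synonym telem = "tmon \<Rightarrow>\<^sub>0 complex"

definition wmon_add :: "wmon \<Rightarrow> wmon \<Rightarrow> wmon" where
  "wmon_add m n = (fst m + fst n, fst (snd m) + fst (snd n), snd (snd m) + snd (snd n))"

text \<open>Twist factor: \<open>(x^a y^b z^c)(x^{a'} y^{b'} z^{c'}) = \<omega>^{-b a'} x^{a+a'} y^{b+b'} z^{c+c'}\<close>.\<close>
definition wtwist :: "nat \<Rightarrow> wmon \<Rightarrow> wmon \<Rightarrow> complex" where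
  "wtwist N m n = omega N powi (- (fst (snd m) * fst n))"

definition tmon_add :: "tmon \<Rightarrow> tmon \<Rightarrow> tmon" where
  "tmon_add m n = (wmon_add (fst m) (fst n), wmon_add (snd m) (snd n))"

definition ttwist :: "nat \<Rightarrow> tmon \<Rightarrow> tmon \<Rightarrow> complex" where
  "ttwist N m n = wtwist N (fst m) (fst n) * wtwist N (snd m) (snd n)"

definition tmult :: "nat \<Rightarrow> telem \<Rightarrow> telem \<Rightarrow> telem" where
  "tmult N p q = (\<Sum>m\<in>Poly_Mapping.keys p. \<Sum>n\<in>Poly_Mapping.keys q.
      Poly_Mapping.single (tmon_add m n) (ttwist N m n * Poly_Mapping.lookup p m * Poly_Mapping.lookup q n))"

definition Wtensor :: "nat \<Rightarrow> telem ring" where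
  "Wtensor N = \<lparr>carrier = UNIV, monoid.mult = tmult N, one = Poly_Mapping.single ((0,0,0),(0,0,0)) 1,
               zero = 0, add = (+)\<rparr>"

definition tm :: "int \<Rightarrow> int \<Rightarrow> int \<Rightarrow> int \<Rightarrow> int \<Rightarrow> int \<Rightarrow> telem" where
  "tm a1 b1 c1 a2 b2 c2 = Poly_Mapping.single ((a1,b1,c1),(a2,b2,c2)) 1"

definition emb1 :: "welem \<Rightarrow> telem" where
  "emb1 u = (\<Sum>m\<in>Poly_Mapping.keys u. Poly_Mapping.single (m, (0,0,0)) (Poly_Mapping.lookup u m))"

definition emb2 :: "welem \<Rightarrow> telem" where
  "emb2 u = (\<Sum>m\<in>Poly_Mapping.keys u. Poly_Mapping.single ((0,0,0), m) (Poly_Mapping.lookup u m))"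

text \<open>An extended character is an algebra map from the center
  \<open>\<complex>[x^{\<plusminus>N}, y^{\<plusminus>N}, z^{\<plusminus>1}]\<close> to \<open>\<complex>\<close>; it is determined by the (nonzero) values
  \<open>(a, b, \<zeta>) = (\<chi>(x^N), \<chi>(y^N), \<chi>(z))\<close>.\<close>
type_synonym echar = "complex \<times> complex \<times> complex"

definition is_echar :: "echar \<Rightarrow> bool" where
  "is_echar \<chi> \<longleftrightarrow> fst \<chi> \<noteq> 0 \<and> fst (snd \<chi>) \<noteq> 0 \<and> snd (snd \<chi>) \<noteq> 0"

definition ch_a :: "echar \<Rightarrow> complex" where "ch_a \<chi> = fst \<chi>"
definition ch_b :: "echar \<Rightarrow> complex" where "ch_b \<chi> = fst (snd \<chi>)"
definition ch_z :: "echar \<Rightarrow> complex" where "ch_z \<chi> = snd (snd \<chi>)"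
definition ch_m :: "nat \<Rightarrow> echar \<Rightarrow> complex" where "ch_m N \<chi> = (ch_z \<chi>) ^ N"

definition in_center :: "nat \<Rightarrow> welem \<Rightarrow> bool" where
  "in_center N u \<longleftrightarrow> (\<forall>m\<in>Poly_Mapping.keys u. int N dvd fst m \<and> int N dvd fst (snd m))"

definition chi_hat :: "nat \<Rightarrow> echar \<Rightarrow> welem \<Rightarrow> complex" where
  "chi_hat N \<chi> u = (\<Sum>m\<in>Poly_Mapping.keys u. Poly_Mapping.lookup u m * ch_a \<chi> powi (fst m div int N)
        * ch_b \<chi> powi (fst (snd m) div int N) * ch_z \<chi> powi (snd (snd m)))"

definition chi_kernel :: "nat \<Rightarrow> echar \<Rightarrow> welem set" where
  "chi_kernel N \<chi> = {u. in_center N u \<and> chi_hat N \<chi> u = 0}"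

text \<open>The ideal \<open>I_{\<chi>1} \<otimes> W_\<xi> + W_\<xi> \<otimes> I_{\<chi>2}\<close> of \<open>W_\<xi> \<otimes> W_\<xi>\<close>, i.e. the two-sided ideal
  generated by \<open>ker \<chi>1 \<otimes> 1\<close> and \<open>1 \<otimes> ker \<chi>2\<close>; the quotient by it is
  \<open>W_\<xi>/I_{\<chi>1} \<otimes> W_\<xi>/I_{\<chi>2}\<close>.\<close>
definition Jideal :: "nat \<Rightarrow> echar \<Rightarrow> echar \<Rightarrow> telem set" where
  "Jideal N \<chi>1 \<chi>2 = genideal (Wtensor N) (emb1 ` chi_kernel N \<chi>1 \<union> emb2 ` chi_kernel N \<chi>2)"

definition Qalg :: "nat \<Rightarrow> echar \<Rightarrow> echar \<Rightarrow> telem set ring" where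
  "Qalg N \<chi>1 \<chi>2 = Wtensor N Quot Jideal N \<chi>1 \<chi>2"

definition cls :: "nat \<Rightarrow> echar \<Rightarrow> echar \<Rightarrow> telem \<Rightarrow> telem set" where
  "cls N \<chi>1 \<chi>2 u = Jideal N \<chi>1 \<chi>2 +>\<^bsub>Wtensor N\<^esub> u"

definition bigA :: "nat \<Rightarrow> echar \<Rightarrow> echar \<Rightarrow> complex" where
  "bigA N \<chi>1 \<chi>2 = 1 - ch_m N \<chi>1 * ch_b \<chi>1 / ch_b \<chi>2 * (1 - ch_a \<chi>1 / ch_m N \<chi>1)
                     * (1 - 1 / (ch_m N \<chi>2 * ch_a \<chi>2))"

definition a1' :: "nat \<Rightarrow> echar \<Rightarrow> echar \<Rightarrow> complex" where
  "a1' N \<chi>1 \<chi>2 = ch_a \<chi>1 / bigA N \<chi>1 \<chi>2"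

definition a2' :: "nat \<Rightarrow> echar \<Rightarrow> echar \<Rightarrow> complex" where
  "a2' N \<chi>1 \<chi>2 = ch_a \<chi>2 * bigA N \<chi>1 \<chi>2"

definition denB1 :: "nat \<Rightarrow> echar \<Rightarrow> echar \<Rightarrow> complex" where
  "denB1 N \<chi>1 \<chi>2 = 1 - ch_m N \<chi>2 * ch_a \<chi>2 * (1 - ch_b \<chi>2 / (ch_m N \<chi>1 * ch_b \<chi>1))"

definition b1' :: "nat \<Rightarrow> echar \<Rightarrow> echar \<Rightarrow> complex" where
  "b1' N \<chi>1 \<chi>2 = ch_m N \<chi>2 * ch_b \<chi>2 / ch_m N \<chi>1 / denB1 N \<chi>1 \<chi>2"

definition b2' :: "nat \<Rightarrow> echar \<Rightarrow> echar \<Rightarrow> complex" where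
  "b2' N \<chi>1 \<chi>2 = ch_b \<chi>1 * (1 - ch_m N \<chi>1 / ch_a \<chi>1 * (1 - ch_b \<chi>2 / (ch_m N \<chi>1 * ch_b \<chi>1)))"

text \<open>Admissible: the four numbers are neither \<open>0\<close> nor \<open>\<infinity>\<close>. For nonzero \<open>a_i, b_i, m_i\<close>
  the only ways to get \<open>\<infinity>\<close> are a vanishing denominator \<open>A\<close> (in \<open>a_{1'}\<close>) or \<open>denB1\<close>
  (in \<open>b_{1'}\<close>); since \<open>x/0 = 0\<close> in Isabelle, these are excluded explicitly.\<close>
definition admissible :: "nat \<Rightarrow> echar \<Rightarrow> echar \<Rightarrow> bool" where
  "admissible N \<chi>1 \<chi>2 \<longleftrightarrow>
     bigA N \<chi>1 \<chi>2 \<noteq> 0 \<and> denB1 N \<chi>1 \<chi>2 \<noteq> 0 \<and>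
     a1' N \<chi>1 \<chi>2 \<noteq> 0 \<and> a2' N \<chi>1 \<chi>2 \<noteq> 0 \<and> b1' N \<chi>1 \<chi>2 \<noteq> 0 \<and> b2' N \<chi>1 \<chi>2 \<noteq> 0"

definition chi1' :: "nat \<Rightarrow> echar \<Rightarrow> echar \<Rightarrow> echar" where
  "chi1' N \<chi>1 \<chi>2 = (a1' N \<chi>1 \<chi>2, b1' N \<chi>1 \<chi>2, ch_z \<chi>1)"

definition chi2' :: "nat \<Rightarrow> echar \<Rightarrow> echar \<Rightarrow> echar" where
  "chi2' N \<chi>1 \<chi>2 = (a2' N \<chi>1 \<chi>2, b2' N \<chi>1 \<chi>2, ch_z \<chi>2)"

definition Bmap :: "nat \<Rightarrow> echar \<Rightarrow> echar \<Rightarrow> echar \<times> echar" where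
  "Bmap N \<chi>1 \<chi>2 = (chi2' N \<chi>1 \<chi>2, chi1' N \<chi>1 \<chi>2)"

definition RW_g :: "nat \<Rightarrow> telem" where
  "RW_g N = (let T = Wtensor N in
     \<one>\<^bsub>T\<^esub> \<ominus>\<^bsub>T\<^esub> (tm (-1) 0 0 0 0 0 \<otimes>\<^bsub>T\<^esub> tm 0 1 0 0 0 0
        \<otimes>\<^bsub>T\<^esub> (tm 0 0 1 0 0 0 \<ominus>\<^bsub>T\<^esub> tm 1 0 0 0 0 0) \<otimes>\<^bsub>T\<^esub> tm 0 0 0 0 (-1) 0
        \<otimes>\<^bsub>T\<^esub> (tm 0 0 0 1 0 0 \<ominus>\<^bsub>T\<^esub> tm 0 0 0 0 0 (-1))))"

definition RW_x1 :: "nat \<Rightarrow> telem" where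
  "RW_x1 N = tm 1 0 0 0 0 0 \<otimes>\<^bsub>Wtensor N\<^esub> RW_g N"

definition RW_y1inv :: "nat \<Rightarrow> telem" where
  "RW_y1inv N = (let T = Wtensor N in
     tm 0 0 0 0 (-1) 0 \<oplus>\<^bsub>T\<^esub>
       ((tm 0 (-1) 0 0 0 0 \<ominus>\<^bsub>T\<^esub> tm 0 0 0 0 0 (-1) \<otimes>\<^bsub>T\<^esub> tm 0 0 0 0 (-1) 0) \<otimes>\<^bsub>T\<^esub> tm 0 0 0 (-1) 0 0))"

definition RW_y2 :: "nat \<Rightarrow> telem" where
  "RW_y2 N = (let T = Wtensor N in
     tm 0 0 1 0 0 0 \<otimes>\<^bsub>T\<^esub> tm 0 0 0 0 0 (-1) \<otimes>\<^bsub>T\<^esub> tm 0 1 0 0 0 0 \<oplus>\<^bsub>T\<^esub>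
       ((tm 0 0 0 0 1 0 \<ominus>\<^bsub>T\<^esub> tm 0 0 0 0 0 (-1) \<otimes>\<^bsub>T\<^esub> tm 0 1 0 0 0 0) \<otimes>\<^bsub>T\<^esub> tm 1 0 0 0 0 0))"

text \<open>A map \<open>\<Phi>\<close> of the quotient algebras is induced by \<open>R^W\<close>: it sends the class of each
  generator to the class of its image under \<open>R^W\<close> (denominators becoming units in the
  target quotient). This determines \<open>\<Phi>\<close> on the classes of \<open>x_i^{\<plusminus>1}, y_i^{\<plusminus>1}, z_i^{\<plusminus>1}\<close>.\<close>
definition induced_by_RW ::
  "nat \<Rightarrow> echar \<Rightarrow> echar \<Rightarrow> echar \<Rightarrow> echar \<Rightarrow> (telem set \<Rightarrow> telem set) \<Rightarrow> bool" where
  "induced_by_RW N \<chi>1 \<chi>2 \<chi>1p \<chi>2p \<Phi> \<longleftrightarrow>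
     (let c = cls N \<chi>1 \<chi>2; c' = cls N \<chi>1p \<chi>2p; Q' = Qalg N \<chi>1p \<chi>2p in
       c' (RW_g N) \<in> Units Q' \<and>
       \<Phi> (c (tm 1 0 0 0 0 0)) = c' (RW_x1 N) \<and>
       \<Phi> (c (tm 0 0 0 1 0 0)) = inv\<^bsub>Q'\<^esub> (c' (RW_g N)) \<otimes>\<^bsub>Q'\<^esub> c' (tm 0 0 0 1 0 0) \<and>
       \<Phi> (c (tm 0 (-1) 0 0 0 0)) = c' (RW_y1inv N) \<and>
       \<Phi> (c (tm 0 0 0 0 1 0)) = c' (RW_y2 N) \<and>
       \<Phi> (c (tm 0 0 1 0 0 0)) = c' (tm 0 0 1 0 0 0) \<and>
       \<Phi> (c (tm 0 0 0 0 0 1)) = c' (tm 0 0 0 0 0 1))"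

definition rep_params :: "nat \<Rightarrow> echar \<Rightarrow> complex \<times> complex \<times> complex \<Rightarrow> bool" where
  "rep_params N \<chi> p \<longleftrightarrow>
     omega_pow N (of_nat N * fst p) = ch_a \<chi> \<and>
     omega_pow N (of_nat N * fst (snd p)) = ch_b \<chi> \<and>
     omega_pow N (snd (snd p)) = ch_z \<chi>"

text \<open>Matrices (w.r.t. the basis \<open>v_0, \<dots>, v_{N-1}\<close>, indices mod \<open>N\<close>) of
  \<open>x, x^{-1}, y, y^{-1}, z, z^{-1}\<close>: \<open>x v_n = \<omega>^\<alpha> v_{n-1}\<close>, \<open>y v_n = \<omega>^{\<beta>+n} v_n\<close>, \<open>z v_n = \<omega>^\<mu> v_n\<close>.\<close>
definition Xmat :: "nat \<Rightarrow> complex \<times> complex \<times> complex \<Rightarrow> complex mat" where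
  "Xmat N p = mat N N (\<lambda>(i,j). if i = (j + N - 1) mod N then omega_pow N (fst p) else 0)"

definition Xinvmat :: "nat \<Rightarrow> complex \<times> complex \<times> complex \<Rightarrow> complex mat" where
  "Xinvmat N p = mat N N (\<lambda>(i,j). if i = (j + 1) mod N then omega_pow N (- fst p) else 0)"

definition Ymat :: "nat \<Rightarrow> complex \<times> complex \<times> complex \<Rightarrow> complex mat" where
  "Ymat N p = mat N N (\<lambda>(i,j). if i = j then omega_pow N (fst (snd p) + of_nat j) else 0)"

definition Yinvmat :: "nat \<Rightarrow> complex \<times> complex \<times> complex \<Rightarrow> complex mat" where
  "Yinvmat N p = mat N N (\<lambda>(i,j). if i = j then omega_pow N (- (fst (snd p) + of_nat j)) else 0)"

definition Zmat :: "nat \<Rightarrow> complex \<times> complex \<times> complex \<Rightarrow> complex mat" where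
  "Zmat N p = omega_pow N (snd (snd p)) \<cdot>\<^sub>m 1\<^sub>m N"

definition Zinvmat :: "nat \<Rightarrow> complex \<times> complex \<times> complex \<Rightarrow> complex mat" where
  "Zinvmat N p = omega_pow N (- snd (snd p)) \<cdot>\<^sub>m 1\<^sub>m N"

definition zpow_mat :: "complex mat \<Rightarrow> complex mat \<Rightarrow> int \<Rightarrow> complex mat" where
  "zpow_mat M Minv k = (if k \<ge> 0 then M ^\<^sub>m nat k else Minv ^\<^sub>m nat (- k))"

definition pi_mon :: "nat \<Rightarrow> complex \<times> complex \<times> complex \<Rightarrow> wmon \<Rightarrow> complex mat" where
  "pi_mon N p m = zpow_mat (Xmat N p) (Xinvmat N p) (fst m) * zpow_mat (Ymat N p) (Yinvmat N p) (fst (snd m))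
                  * zpow_mat (Zmat N p) (Zinvmat N p) (snd (snd m))"

text \<open>Kronecker product; \<open>v_i \<otimes> w_k\<close> is the basis vector with index \<open>i * dim + k\<close>.\<close>
definition kron :: "complex mat \<Rightarrow> complex mat \<Rightarrow> complex mat" where
  "kron A B = mat (dim_row A * dim_row B) (dim_col A * dim_col B)
     (\<lambda>(i,j). A $$ (i div dim_row B, j div dim_col B) * B $$ (i mod dim_row B, j mod dim_col B))"

definition pi_tensor :: "nat \<Rightarrow> complex \<times> complex \<times> complex \<Rightarrow> complex \<times> complex \<times> complex \<Rightarrow> telem \<Rightarrow> complex mat" where
  "pi_tensor N p1 p2 u = mat (N * N) (N * N)
     (\<lambda>ij. \<Sum>m\<in>Poly_Mapping.keys u. Poly_Mapping.lookup u m * kron (pi_mon N p1 (fst m)) (pi_mon N p2 (snd m)) $$ ij)"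

text \<open>Induced map on the quotient (it factors through the quotient; evaluate at a representative).\<close>
definition pi_quot :: "nat \<Rightarrow> complex \<times> complex \<times> complex \<Rightarrow> complex \<times> complex \<times> complex \<Rightarrow> telem set \<Rightarrow> complex mat" where
  "pi_quot N p1 p2 c = pi_tensor N p1 p2 (SOME u. u \<in> c)"

end

(*
  C^N is realised as the space of N-periodic functions on the integers, so that x and y act by
  difference operators, and W tensor W acts on N-periodic functions of two integer variables.
  Two facts give the theorem.

  (1) For N-periodic functions this action identifies W/I1 tensor W/I2 with the full algebra of
      N^2 x N^2 matrices: the kernel is the ideal by reduction modulo the central elements and
      discrete Fourier inversion, which also yields every matrix unit.

  (2) The images X, U, V of x1, y1^-1, y2 under the braiding, together with S = x1 x2 (which is
      fixed by it), act on the target functions and satisfy the Weyl relations.  Each of X, U, V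
      is a sum of q-commuting monomials, and (P + Q)^N = P^N + Q^N whenever P Q = q Q P with q a
      primitive N-th root of unity; so X^N, U^N, V^N are scalars, and the definition of B says
      that they are those prescribed by the original characters.  As in the Stone-von Neumann
      theorem, a joint eigenvector of U and V generates under X and S a basis of joint
      eigenvectors, and the change to this basis is R.  The isomorphism is conjugation by R,
      transported through (1), and R is unique because the commutant of all matrices is scalar.

  Using S instead of the image g^-1 x2 of x2 avoids inverting g; that g is a unit is read off
  from x1 g = R x1 R^-1 afterwards.
*)
theory Submission
  imports Defs "HOL-Library.Function_Algebras" "Jordan_Normal_Form.Determinant"
begin

section \<open>Roots of unity and Gaussian binomials\<close>

text \<open>The braiding lives on a division algebra, where an automorphism would have to be built
  and shown to carry one ideal into the other. Both are bypassed: only the images of generators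
  occur, and a conjugation of full matrix algebras is automatically well defined on the quotients
  and bijective. The images act on the target space, so the formulas of B enter inverted: the N-th
  powers of \<open>X\<close>, \<open>U\<close>, \<open>V\<close> come out as rational functions of
  the primed parameters and have to be turned back into the unprimed ones
  (\<open>braiding_identities\<close>). The commutation relations are shift identities valid for all
  functions of two integers. Periodicity matters only where N-th powers become scalars and operators
  become matrices; hence operators act on all functions and \<open>periodic\<close> is merely an
  invariant subset. Eigenvectors are labelled so that \<open>X\<close>, \<open>S\<close>,
  \<open>U\<close>, \<open>V\<close> move and scale them exactly as x1, x1 x2, y1^-1, y2 do with the
  point masses of the source space. Sending point masses to eigenvectors then intertwines by
  inspection.\<close>

definition primitive_root :: "'a::field \<Rightarrow> nat \<Rightarrow> bool" where
  "primitive_root q N \<longleftrightarrow> N > 0 \<and> (\<forall>k::int. q powi k = 1 \<longleftrightarrow> int N dvd k)"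

lemma primitive_root_powi_eq_1: "primitive_root q N \<Longrightarrow> q powi k = 1 \<longleftrightarrow> int N dvd k"
  by (simp add: primitive_root_def)

lemma primitive_root_pow: "primitive_root q N \<Longrightarrow> q ^ N = 1"
  using primitive_root_powi_eq_1[of q N "int N"] by simp

lemma primitive_root_nonzero: "primitive_root q N \<Longrightarrow> q \<noteq> 0"
  using primitive_root_pow[of q N] by (auto simp: primitive_root_def power_0_left)

lemma primitive_root_inverse: "primitive_root q N \<Longrightarrow> primitive_root (inverse q) N"
  by (simp add: primitive_root_def power_int_inverse)

lemma primitive_root_powi_cong:
  assumes q: "primitive_root q N" and "i mod int N = j mod int N"
  shows "q powi i = q powi j"
proof -
  have "int N dvd i - j" using assms(2) by (simp add: mod_eq_dvd_iff)
  hence "q powi (i - j) = 1" using primitive_root_powi_eq_1[OF q] by simp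
  thus ?thesis using primitive_root_nonzero[OF q] by (simp add: power_int_diff)
qed

lemma sum_primitive_root:
  fixes q :: "'a::field_char_0"
  assumes q: "primitive_root q N"
  shows "(\<Sum>j<N. q powi (int j * k)) = (if int N dvd k then of_nat N else 0)"
proof -
  have *: "q powi (int j * k) = (q powi k) ^ j" for j
    by (simp add: power_int_mult mult.commute[of "int j"])
  have "(q powi k) ^ N = 1"
    using primitive_root_powi_eq_1[OF q, of "int N * k"] by (simp flip: *)
  hence "(\<Sum>j<N. (q powi k) ^ j) = 0" if "q powi k \<noteq> 1"
    using that one_diff_power_eq[of "q powi k" N] by simp
  thus ?thesis unfolding * using primitive_root_powi_eq_1[OF q, of k] by auto
qed

text \<open>The Pascal recursion makes sense for every q in a commutative ring, with no q-factorials
  to divide by, and so also at roots of unity.\<close>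

fun gauss_binomial :: "'a::comm_ring_1 \<Rightarrow> nat \<Rightarrow> nat \<Rightarrow> 'a" where
  "gauss_binomial q n 0 = 1"
| "gauss_binomial q 0 (Suc k) = 0"
| "gauss_binomial q (Suc n) (Suc k) = gauss_binomial q n k + q ^ Suc k * gauss_binomial q n (Suc k)"

lemma gauss_binomial_eq_0: "n < k \<Longrightarrow> gauss_binomial q n k = 0"
  by (induction q n k rule: gauss_binomial.induct) auto

lemma gauss_binomial_self: "gauss_binomial q n n = 1"
  by (induction n) (simp_all add: gauss_binomial_eq_0)

text \<open>Division-free form of the quotient formula. If q is a primitive N-th root of unity and
  \<open>Suc n\<close> is N, the right side vanishes while \<open>1 - q ^ Suc k\<close> does not for
  \<open>Suc k < N\<close>; this kills the inner coefficients.\<close>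

lemma gauss_binomial_absorb:
  "(1 - q ^ Suc k) * gauss_binomial q (Suc n) (Suc k) = (1 - q ^ Suc n) * gauss_binomial q n k"
proof (induction n arbitrary: k)
  case 0
  then show ?case by (cases k) auto
next
  case (Suc n)
  let ?G = "gauss_binomial q (Suc n) k"
  have step: "(1 - q ^ Suc k) * gauss_binomial q (Suc (Suc n)) (Suc k)
      = (1 - q ^ Suc k) * ?G + q ^ Suc k * ((1 - q ^ Suc n) * gauss_binomial q n k)"
    unfolding Suc.IH[of k, symmetric] gauss_binomial.simps(3)[of q "Suc n" k]
    by (simp only: algebra_simps)
  show ?case
  proof (cases k)
    case 0
    then show ?thesis unfolding step by (simp add: algebra_simps)
  next
    case (Suc k')
    have G: "?G = gauss_binomial q n k' + q ^ k * gauss_binomial q n k"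
      by (simp add: Suc)
    have IH: "(1 - q ^ k) * ?G = (1 - q ^ Suc n) * gauss_binomial q n k'"
      using Suc.IH[of k'] by (simp only: Suc)
    \<comment> \<open>The Pascal rule is solved for \<open>q ^ k * gauss_binomial q n k\<close>; the
      induction hypothesis one index lower then turns everything into multiples of
      \<open>?G\<close>.\<close>
    have "q ^ Suc k * ((1 - q ^ Suc n) * gauss_binomial q n k)
        = q * ((1 - q ^ Suc n) * ?G - (1 - q ^ Suc n) * gauss_binomial q n k')"
      unfolding G by (simp add: algebra_simps)
    also have "\<dots> = q * ((1 - q ^ Suc n) * ?G - (1 - q ^ k) * ?G)"
      by (simp only: IH)
    finally show ?thesis unfolding step by (simp add: algebra_simps)
  qed
qed

lemma gauss_binomial_primitive_root:
  assumes q: "primitive_root q N" and k: "0 < k" "k < N"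
  shows "gauss_binomial q N k = 0"
proof -
  obtain k' n where k': "k = Suc k'" and n: "N = Suc n" using k by (cases k; cases N) auto
  have "(1 - q ^ k) * gauss_binomial q N k = 0"
    unfolding k' n gauss_binomial_absorb using primitive_root_pow[OF q] n by simp
  moreover have "q ^ k \<noteq> 1"
    using primitive_root_powi_eq_1[OF q, of "int k"] k by (auto dest: zdvd_imp_le)
  ultimately show ?thesis by simp
qed

section \<open>q-commuting linear operators and their joint eigenvectors\<close>

locale operator_space = vector_space scale
  for scale :: "'a::field_char_0 \<Rightarrow> 'b::ab_group_add \<Rightarrow> 'b" (infixr \<open>*s\<close> 75)
begin

abbreviation lin :: "('b \<Rightarrow> 'b) \<Rightarrow> bool" where
  "lin T \<equiv> module_hom scale scale T"

lemma linI:
  assumes "\<And>u v. T (u + v) = T u + T v" and "\<And>c v. T (c *s v) = c *s T v"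
  shows "lin T"
  using assms by unfold_locales auto

lemma lin_add: "lin T \<Longrightarrow> T (u + v) = T u + T v"
  by (rule module_hom.add)

lemma lin_scale: "lin T \<Longrightarrow> T (c *s v) = c *s T v"
  by (rule module_hom.scale)

lemma lin_sum: "lin T \<Longrightarrow> T (sum f A) = (\<Sum>a\<in>A. T (f a))"
  by (rule module_hom.sum)

lemma lin_zero: "lin T \<Longrightarrow> T 0 = 0"
  by (rule module_hom.zero)

lemma lin_funpow: "lin T \<Longrightarrow> lin (T ^^ n)"
  by (induction n) (auto intro!: linI simp: lin_add lin_scale)

text \<open>The relation is required only on an invariant set \<open>W\<close>, which later is the
  set of periodic functions; relations valid everywhere use \<open>UNIV\<close>.\<close>

lemma q_commute_funpow:
  assumes "lin S" "lin T" and "\<And>v. v \<in> W \<Longrightarrow> S (T v) = q *s T (S v)"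
    and "\<And>v. v \<in> W \<Longrightarrow> T v \<in> W" and "v \<in> W"
  shows "S ((T ^^ n) v) = q ^ n *s (T ^^ n) (S v)"
proof -
  have "(T ^^ n) v \<in> W \<and> S ((T ^^ n) v) = q ^ n *s (T ^^ n) (S v)"
    by (induction n) (use assms in \<open>auto simp: lin_scale mult.commute\<close>)
  thus ?thesis ..
qed

text \<open>Moving \<open>S\<close> past \<open>T ^^ k\<close> costs \<open>q ^ k\<close>;
  collecting the two contributions to a given power of \<open>T\<close> is then the Pascal rule of
  \<open>gauss_binomial\<close>.\<close>

lemma q_binomial:
  assumes S: "lin S" and T: "lin T" and comm: "\<And>v. S (T v) = q *s T (S v)"
  shows "((\<lambda>v. S v + T v) ^^ n) v
       = (\<Sum>k\<le>n. gauss_binomial q n k *s (T ^^ k) ((S ^^ (n - k)) v))"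
proof (induction n)
  case 0
  then show ?case by simp
next
  case (Suc n)
  let ?t = "\<lambda>n k. (T ^^ k) ((S ^^ (n - k)) v)"
  have S': "S (?t n k) = q ^ k *s ?t (Suc n) k" if "k \<le> n" for k
    using q_commute_funpow[OF S T, of UNIV q "(S ^^ (n - k)) v" k] comm that
    by (simp add: Suc_diff_le)
  have "((\<lambda>v. S v + T v) ^^ Suc n) v
      = (\<Sum>k\<le>n. (gauss_binomial q n k * q ^ k) *s ?t (Suc n) k)
        + (\<Sum>k\<le>n. gauss_binomial q n k *s ?t (Suc n) (Suc k))"
    by (simp add: Suc lin_sum[OF S] lin_sum[OF T] lin_scale[OF S] lin_scale[OF T] S')
  also have "(\<Sum>k\<le>n. (gauss_binomial q n k * q ^ k) *s ?t (Suc n) k)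
      = (\<Sum>k\<le>Suc n. (gauss_binomial q n k * q ^ k) *s ?t (Suc n) k)"
    by (simp add: gauss_binomial_eq_0)
  also have "\<dots> = ?t (Suc n) 0
      + (\<Sum>k\<le>n. (gauss_binomial q n (Suc k) * q ^ Suc k) *s ?t (Suc n) (Suc k))"
    by (subst sum.atMost_Suc_shift) simp
  also have "\<dots> + (\<Sum>k\<le>n. gauss_binomial q n k *s ?t (Suc n) (Suc k))
      = ?t (Suc n) 0 + (\<Sum>k\<le>n. gauss_binomial q (Suc n) (Suc k) *s ?t (Suc n) (Suc k))"
    by (simp add: scale_left_distrib add.assoc mult.commute add.commute flip: sum.distrib)
  also have "\<dots> = (\<Sum>k\<le>Suc n. gauss_binomial q (Suc n) k *s ?t (Suc n) k)"
    by (subst sum.atMost_Suc_shift[of _ n]) simp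
  finally show ?case .
qed

lemma q_binomial_primitive_root:
  assumes q: "primitive_root q N" and S: "lin S" and T: "lin T"
    and comm: "\<And>v. S (T v) = q *s T (S v)"
  shows "((\<lambda>v. S v + T v) ^^ N) v = (S ^^ N) v + (T ^^ N) v"
proof -
  obtain n where n: "N = Suc n" using q by (cases N) (auto simp: primitive_root_def)
  have z: "(\<Sum>k<n. gauss_binomial q N (Suc k) *s (T ^^ Suc k) ((S ^^ (N - Suc k)) v)) = 0"
    by (intro sum.neutral) (auto simp: n gauss_binomial_primitive_root[OF q[unfolded n]] simp del: gauss_binomial.simps)
  have "((\<lambda>v. S v + T v) ^^ N) v
      = (S ^^ N) v + (\<Sum>k\<le>n. gauss_binomial q N (Suc k) *s (T ^^ Suc k) ((S ^^ (N - Suc k)) v))"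
    unfolding q_binomial[OF S T comm] unfolding n by (subst sum.atMost_Suc_shift) simp
  also have "{..n} = insert n {..<n}" by auto
  finally show ?thesis using z by (simp add: n gauss_binomial_self del: gauss_binomial.simps)
qed

text \<open>\<open>S\<close> is a ladder operator for \<open>T\<close>: each application shifts the
  exponent of the eigenvalue by \<open>e\<close>.\<close>

lemma q_commute_funpow_powi:
  assumes q: "q \<noteq> 0" and "lin S" "lin T" and "\<And>v. v \<in> W \<Longrightarrow> T (S v) = q powi e *s S (T v)"
    and "\<And>v. v \<in> W \<Longrightarrow> S v \<in> W" and "v \<in> W" and "T v = q powi a *s v"
  shows "T ((S ^^ n) v) = q powi (a + e * int n) *s (S ^^ n) v"
proof -
  have "T ((S ^^ n) v) = (q powi e) ^ n *s (S ^^ n) (T v)"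
    by (rule q_commute_funpow[where W = W]) (use assms in auto)
  also have "(q powi e) ^ n = q powi (e * int n)"
    by (simp add: power_int_mult)
  finally show ?thesis
    using assms(7) q by (simp add: lin_scale[OF lin_funpow[OF assms(2)]] power_int_add mult.commute)
qed

lemma funpow_closed: "(\<And>v. v \<in> W \<Longrightarrow> T v \<in> W) \<Longrightarrow> v \<in> W \<Longrightarrow> (T ^^ n) v \<in> W"
  by (induction n) auto

lemma funpow_fixed_mod:
  assumes "\<And>v. v \<in> W \<Longrightarrow> T v \<in> W" and TN: "\<And>v. v \<in> W \<Longrightarrow> (T ^^ N) v = v" and v: "v \<in> W"
  shows "(T ^^ n) v = (T ^^ (n mod N)) v"
proof -
  have "(T ^^ (N * k)) v = v" for k
    by (induction k) (use TN v in \<open>auto simp: funpow_add\<close>)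
  hence "(T ^^ (n mod N + N * (n div N))) v = (T ^^ (n mod N)) v"
    unfolding funpow_add by simp
  thus ?thesis by simp
qed

text \<open>Since n \<le> N n, a power of \<open>T\<close> killing \<open>v\<close> would force
  \<open>T ^^ (N * n)\<close> to kill it as well, although that power fixes
  \<open>v\<close>.\<close>

lemma funpow_nonzero:
  assumes T: "lin T" "\<And>v. v \<in> W \<Longrightarrow> T v \<in> W" and TN: "\<And>v. v \<in> W \<Longrightarrow> (T ^^ N) v = v"
    and N: "N > 0" and v: "v \<in> W" "v \<noteq> 0"
  shows "(T ^^ n) v \<noteq> 0"
proof
  assume *: "(T ^^ n) v = 0"
  have "n \<le> N * n" using N by simp
  hence "(T ^^ (N * n)) v = (T ^^ (N * n - n)) ((T ^^ n) v)"
    by (simp flip: funpow_add[THEN fun_cong, unfolded comp_apply])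
  also have "\<dots> = 0" using * lin_zero[OF lin_funpow[OF T(1)]] by simp
  finally show False
    using funpow_fixed_mod[OF T(2) TN v(1), of "N * n"] v(2) by simp
qed

text \<open>The sums are N times the projections of \<open>v\<close> onto the eigenspaces of
  \<open>T\<close>. By orthogonality of roots of unity they add up to N v, so one of them is
  nonzero. The vector stays explicit because its membership in an invariant subspace, and the effect
  on it of an operator commuting with \<open>T\<close>, are read off from the formula.\<close>

lemma eigenvector_exists:
  assumes q: "primitive_root q N" and T: "lin T" and TN: "(T ^^ N) v = v" and v: "v \<noteq> 0"
  obtains j where "(\<Sum>k<N. q powi (int j * int k) *s (T ^^ k) v) \<noteq> 0"
    and "T (\<Sum>k<N. q powi (int j * int k) *s (T ^^ k) v)
       = q powi (- int j) *s (\<Sum>k<N. q powi (int j * int k) *s (T ^^ k) v)"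
proof -
  let ?w = "\<lambda>j. \<Sum>k<N. q powi (int j * int k) *s (T ^^ k) v"
  have N: "N > 0" using q by (simp add: primitive_root_def)
  have q0: "q \<noteq> 0" using primitive_root_nonzero[OF q] .
  have eig: "T (?w j) = q powi (- int j) *s ?w j" for j
  proof -
    obtain n where n: "N = Suc n" using N by (cases N) auto
    have qN: "q powi (int j * int N) = 1" using primitive_root_powi_eq_1[OF q] by simp
    have pw: "q powi (int j * int (Suc k)) = q powi int j * q powi (int j * int k)" for k
      using q0 by (simp add: power_int_add distrib_left)
    \<comment> \<open>Applying \<open>T\<close> and multiplying by q^j advances the summation index
      by one; the last term wraps round to index 0 because q^(jN) = 1 and \<open>T ^^ N\<close>
      fixes \<open>v\<close>.\<close>
    have "q powi int j *s T (?w j) = (\<Sum>k<N. q powi (int j * int (Suc k)) *s (T ^^ Suc k) v)"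
      by (simp only: pw lin_sum[OF T] lin_scale[OF T] scale_sum_right scale_scale funpow.simps comp_apply)
    also have "\<dots> = (\<Sum>k<n. q powi (int j * int (Suc k)) *s (T ^^ Suc k) v) + v"
      unfolding n sum.lessThan_Suc using qN TN by (simp add: n del: funpow.simps)
    also have "\<dots> = ?w j"
      unfolding n sum.lessThan_Suc_shift by simp
    finally have "q powi (- int j) *s ?w j = q powi (- int j) *s q powi int j *s T (?w j)" by (simp only:)
    also have "\<dots> = (q powi (- int j) * q powi int j) *s T (?w j)" by (rule scale_scale)
    also have "q powi (- int j) * q powi int j = 1" using q0 by (simp add: power_int_minus)
    finally have "q powi (- int j) *s ?w j = T (?w j)" by (simp only: scale_one)
    thus ?thesis ..
  qed
  have "(\<Sum>j<N. ?w j) = (\<Sum>k<N. (\<Sum>j<N. q powi (int j * int k)) *s (T ^^ k) v)"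
    by (subst sum.swap) (simp add: scale_sum_left)
  also have "\<dots> = (\<Sum>k<N. (if k = 0 then of_nat N *s v else 0))"
    by (intro sum.cong refl) (simp add: sum_primitive_root[OF q] nat_dvd_not_less)
  also have "\<dots> = of_nat N *s v" using N by simp
  finally have "(\<Sum>j<N. ?w j) \<noteq> 0" using N v by simp
  then obtain j where "?w j \<noteq> 0" by (rule sum.not_neutral_contains_not_neutral)
  with eig that show thesis by blast
qed

text \<open>The hypotheses are the relations of x1, x1 x2, y1^-1, y2 after normalising all N-th
  powers to 1. \<open>U\<close> and \<open>V\<close> commute, which gives a joint eigenvector;
  \<open>X\<close> and \<open>S\<close> are ladder operators that reach all labels from it. The
  eigenvalue exponents -j and l are those of y1^-1 and y2 on a point mass at (j, l). Independence of
  the family is a separate matter, settled by the distinct eigenvalues.\<close>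

lemma stone_von_neumann:
  fixes X S U V :: "'b \<Rightarrow> 'b" and q :: 'a
  assumes q: "primitive_root q N"
    and lin: "lin X" "lin S" "lin U" "lin V"
    and cl: "\<And>v. v \<in> W \<Longrightarrow> X v \<in> W" "\<And>v. v \<in> W \<Longrightarrow> S v \<in> W"
            "\<And>v. v \<in> W \<Longrightarrow> U v \<in> W" "\<And>v. v \<in> W \<Longrightarrow> V v \<in> W"
    and W: "\<And>u v. u \<in> W \<Longrightarrow> v \<in> W \<Longrightarrow> u + v \<in> W" "\<And>c v. v \<in> W \<Longrightarrow> c *s v \<in> W"
    and pow: "\<And>v. v \<in> W \<Longrightarrow> (X ^^ N) v = v" "\<And>v. v \<in> W \<Longrightarrow> (S ^^ N) v = v"
             "\<And>v. v \<in> W \<Longrightarrow> (U ^^ N) v = v" "\<And>v. v \<in> W \<Longrightarrow> (V ^^ N) v = v"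
    and UX: "\<And>v. v \<in> W \<Longrightarrow> U (X v) = q *s X (U v)" and VX: "\<And>v. v \<in> W \<Longrightarrow> V (X v) = X (V v)"
    and US: "\<And>v. v \<in> W \<Longrightarrow> U (S v) = q *s S (U v)"
    and VS: "\<And>v. v \<in> W \<Longrightarrow> V (S v) = inverse q *s S (V v)"
    and XS: "\<And>v. v \<in> W \<Longrightarrow> X (S v) = S (X v)" and UV: "\<And>v. v \<in> W \<Longrightarrow> U (V v) = V (U v)"
    and v0: "v0 \<in> W" "v0 \<noteq> 0"
  obtains F where "\<And>j l :: int. F j l \<in> W" "\<And>j l. F j l \<noteq> 0"
    "\<And>j l. F (j mod int N) (l mod int N) = F j l"
    "\<And>j l. X (F j l) = F (j - 1) l" "\<And>j l. S (F j l) = F (j - 1) (l - 1)"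
    "\<And>j l. U (F j l) = q powi (- j) *s F j l" "\<And>j l. V (F j l) = q powi l *s F j l"
proof -
  have N: "N > 0" using q by (simp add: primitive_root_def)
  have q0: "q \<noteq> 0" using primitive_root_nonzero[OF q] .
  have zW: "0 \<in> W" using W(2)[OF v0(1), of 0] by simp
  have Wsum: "(\<And>a. a \<in> A \<Longrightarrow> f a \<in> W) \<Longrightarrow> sum f A \<in> W" for A :: "nat set" and f
    by (induction A rule: infinite_finite_induct) (auto simp: zW W(1))
  obtain j where j: "(\<Sum>k<N. q powi (int j * int k) *s (U ^^ k) v0) \<noteq> 0"
      "U (\<Sum>k<N. q powi (int j * int k) *s (U ^^ k) v0)
       = q powi (- int j) *s (\<Sum>k<N. q powi (int j * int k) *s (U ^^ k) v0)"
    using eigenvector_exists[OF q lin(3) pow(3)[OF v0(1)] v0(2)] by blast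
  define v1 where "v1 = (\<Sum>k<N. q powi (int j * int k) *s (U ^^ k) v0)"
  have v1: "v1 \<in> W" "v1 \<noteq> 0" "U v1 = q powi (- int j) *s v1"
    using j W(2) Wsum funpow_closed[of W U, OF cl(3)] v0(1) unfolding v1_def by auto
  obtain l where l: "(\<Sum>k<N. q powi (int l * int k) *s (V ^^ k) v1) \<noteq> 0"
      "V (\<Sum>k<N. q powi (int l * int k) *s (V ^^ k) v1)
       = q powi (- int l) *s (\<Sum>k<N. q powi (int l * int k) *s (V ^^ k) v1)"
    using eigenvector_exists[OF q lin(4) pow(4)[OF v1(1)] v1(2)] by blast
  define v2 where "v2 = (\<Sum>k<N. q powi (int l * int k) *s (V ^^ k) v1)"
  \<comment> \<open>\<open>V\<close> commutes with \<open>U\<close>, so projecting \<open>v1\<close>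
    onto an eigenspace of \<open>V\<close> does not change its eigenvalue under
    \<open>U\<close>.\<close>
  have Uk: "U ((V ^^ k) v1) = q powi (- int j) *s (V ^^ k) v1" for k
    using q_commute_funpow_powi[OF q0 lin(4,3), of W 0 v1 "- int j" k] UV cl(4) v1 by simp
  have v2: "v2 \<in> W" "v2 \<noteq> 0" "V v2 = q powi (- int l) *s v2" "U v2 = q powi (- int j) *s v2"
    using l W(2) Wsum funpow_closed[of W V, OF cl(4)] v1(1) unfolding v2_def
    by (auto simp: lin_sum[OF lin(3)] lin_scale[OF lin(3)] Uk scale_sum_right mult.commute)
  define F0 where "F0 s t = (X ^^ s) ((S ^^ t) v2)" for s t
  have SW: "(S ^^ t) v2 \<in> W" for t using funpow_closed[of W S, OF cl(2)] v2(1) by simp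
  have F0W: "F0 s t \<in> W" for s t using funpow_closed[of W X, OF cl(1)] SW by (simp add: F0_def)
  have F0nz: "F0 s t \<noteq> 0" for s t
    unfolding F0_def by (intro funpow_nonzero[OF lin(1) cl(1) pow(1) N] SW
        funpow_nonzero[OF lin(2) cl(2) pow(2) N] v2)
  have XF0: "X (F0 s t) = F0 (Suc s) t" for s t by (simp add: F0_def)
  have SF0: "S (F0 s t) = F0 s (Suc t)" for s t
    using q_commute_funpow[OF lin(2,1), of W 1 "(S ^^ t) v2" s] XS cl(1) SW by (simp add: F0_def)
  have F0mod: "F0 s t = F0 (s mod N) (t mod N)" for s t
    using funpow_fixed_mod[OF cl(1) pow(1) SW, of s t] funpow_fixed_mod[OF cl(2) pow(2) v2(1), of t]
    by (simp add: F0_def)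
  have "U ((S ^^ t) v2) = q powi (- int j + 1 * int t) *s (S ^^ t) v2" for t
    by (rule q_commute_funpow_powi[OF q0 lin(2,3), of W]) (use US cl(2) v2 in auto)
  hence UF0: "U (F0 s t) = q powi (- int j + int t + 1 * int s) *s F0 s t" for s t
    unfolding F0_def by (intro q_commute_funpow_powi[OF q0 lin(1,3), of W]) (use UX cl(1) SW in auto)
  have "V ((S ^^ t) v2) = q powi (- int l + (- 1) * int t) *s (S ^^ t) v2" for t
    by (rule q_commute_funpow_powi[OF q0 lin(2,4), of W]) (use VS cl(2) v2 in \<open>auto simp: power_int_minus\<close>)
  hence VF0: "V (F0 s t) = q powi (- int l - int t + 0 * int s) *s F0 s t" for s t
    unfolding F0_def by (intro q_commute_funpow_powi[OF q0 lin(1,4), of W]) (use VX cl(1) SW in auto)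
  \<comment> \<open>\<open>F0 s t\<close> has \<open>U\<close>-exponent -j + s + t and
    \<open>V\<close>-exponent -l - t. Setting these equal to -a and b gives t = -b - l and s = b - a
    + j + l; reduction modulo N makes both usable as iteration counts.\<close>
  define F where "F a b = F0 (nat ((b - a + int j + int l) mod int N)) (nat ((- b - int l) mod int N))" for a b
  have F: "F a b = F0 s t" if "int s mod int N = (b - a + int j + int l) mod int N"
      "int t mod int N = (- b - int l) mod int N" for a b s t
    unfolding F_def that[symmetric] zmod_int[symmetric] nat_int F0mod[of s t] ..
  have Fex: "\<exists>s t. F a b = F0 s t \<and> int s mod int N = (b - a + int j + int l) mod int N \<and>
      int t mod int N = (- b - int l) mod int N" for a b
    by (rule exI[of _ "nat ((b - a + int j + int l) mod int N)"],
        rule exI[of _ "nat ((- b - int l) mod int N)"]) (use N in \<open>simp add: F_def\<close>)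
  have m1: "(1 + x) mod int N = (1 + y) mod int N" if "x mod int N = y mod int N" for x y
    using that by (metis mod_add_right_eq)
  show thesis
  proof (rule that[of F])
    fix a b
    from Fex obtain s t where st: "F a b = F0 s t"
      "int s mod int N = (b - a + int j + int l) mod int N" "int t mod int N = (- b - int l) mod int N"
      by blast
    show "F a b \<in> W" "F a b \<noteq> 0" using F0W F0nz st(1) by auto
    show "F (a mod int N) (b mod int N) = F a b" 
    proof -
      have "(b mod int N - a mod int N + int j + int l) mod int N = (b - a + int j + int l) mod int N"
        by (intro mod_add_cong mod_diff_cong mod_mod_trivial refl)
      moreover have "(- (b mod int N) - int l) mod int N = (- b - int l) mod int N"
        by (intro mod_diff_cong mod_minus_cong mod_mod_trivial refl)
      ultimately show ?thesis by (simp only: F_def)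
    qed
    have "F (a - 1) b = F0 (Suc s) t"
      using m1[OF st(2)] st(3) by (intro F) (auto simp: algebra_simps)
    thus "X (F a b) = F (a - 1) b" using XF0 st(1) by simp
    have "F (a - 1) (b - 1) = F0 s (Suc t)"
      using st(2) m1[OF st(3)] by (intro F) (auto simp: algebra_simps)
    thus "S (F a b) = F (a - 1) (b - 1)" using SF0 st(1) by simp
    have "(- int j + int t + int s) mod int N = (- int j + (- b - int l) + (b - a + int j + int l)) mod int N"
      using st(2,3) by (metis mod_add_cong)
    hence "q powi (- int j + int t + int s) = q powi (- a)"
      by (intro primitive_root_powi_cong[OF q]) simp
    thus "U (F a b) = q powi (- a) *s F a b" using UF0 st(1) by simp
    have "(- int l - int t) mod int N = (- int l - (- b - int l)) mod int N"
      using st(3) by (metis mod_diff_cong)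
    hence "q powi (- int l - int t) = q powi b"
      by (intro primitive_root_powi_cong[OF q]) simp
    thus "V (F a b) = q powi b *s F a b" using VF0 st(1) by simp
  qed
qed

end

section \<open>The twisted tensor algebra\<close>

text \<open>Common shape of the sums over supports in \<open>tmult\<close>, \<open>emb1\<close>,
  \<open>emb2\<close>, \<open>chi_hat\<close> and \<open>rep_op\<close>, so that additivity under
  changing supports is settled once.\<close>

definition pm_sum :: "('m \<Rightarrow> 'c::zero \<Rightarrow> 'd::comm_monoid_add) \<Rightarrow> ('m \<Rightarrow>\<^sub>0 'c) \<Rightarrow> 'd" where
  "pm_sum F u = (\<Sum>m\<in>Poly_Mapping.keys u. F m (Poly_Mapping.lookup u m))"

lemma pm_sum_superset:
  assumes "\<And>m. F m 0 = 0" "finite A" "Poly_Mapping.keys u \<subseteq> A"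
  shows "pm_sum F u = (\<Sum>m\<in>A. F m (Poly_Mapping.lookup u m))"
  unfolding pm_sum_def by (rule sum.mono_neutral_left) (use assms in \<open>auto simp: in_keys_iff\<close>)

lemma pm_sum_add:
  assumes "\<And>m. F m 0 = 0" "\<And>m a b. F m (a + b) = F m a + F m b"
  shows "pm_sum F (u + v) = pm_sum F u + pm_sum F v"
proof -
  let ?A = "Poly_Mapping.keys u \<union> Poly_Mapping.keys v"
  have "Poly_Mapping.keys (u + v) \<subseteq> ?A" by (rule Poly_Mapping.keys_add)
  thus ?thesis
    by (simp add: pm_sum_superset[of F ?A] assms lookup_add sum.distrib)
qed

lemma pm_sum_single: "F m 0 = 0 \<Longrightarrow> pm_sum F (Poly_Mapping.single m c) = F m c"
  by (simp add: pm_sum_def)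

lemma pm_sum_plus:
  "pm_sum (\<lambda>m c. F m c + G m c) u = pm_sum F u + pm_sum G u"
  by (simp add: pm_sum_def sum.distrib)

text \<open>Reduces multilinear identities to monomials. The zero element is covered as a single
  monomial with coefficient 0.\<close>

lemma poly_mapping_single_add_induct [case_names single add]:
  assumes "\<And>m c. P (Poly_Mapping.single m c)" and "\<And>u v. P u \<Longrightarrow> P v \<Longrightarrow> P (u + v)"
  shows "P (u :: 'm \<Rightarrow>\<^sub>0 'c::comm_monoid_add)"
proof -
  have "finite A \<Longrightarrow> Poly_Mapping.keys u = A \<Longrightarrow> P u" for A
  proof (induction A arbitrary: u rule: finite_induct)
    case empty
    then show ?case using assms(1)[of undefined 0] by simp
  next
    case (insert m A)
    let ?v = "Poly_Mapping.update m 0 u"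
    have "x \<in> Poly_Mapping.keys ?v \<longleftrightarrow> x \<noteq> m \<and> x \<in> Poly_Mapping.keys u" for x
      by (simp add: in_keys_iff lookup_update)
    hence "Poly_Mapping.keys ?v = A" using insert by auto
    moreover have "u = Poly_Mapping.single m (Poly_Mapping.lookup u m) + ?v"
      by (rule poly_mapping_eqI) (simp add: lookup_add lookup_single lookup_update when_def)
    ultimately show ?case using insert.IH assms by metis
  qed
  thus ?thesis using finite_keys by blast
qed

lemma omega_nonzero: "omega N \<noteq> 0"
  by (simp add: omega_def xi_def)

lemma tmult_pm_sum:
  "tmult N p q = pm_sum (\<lambda>m c. pm_sum (\<lambda>n d. Poly_Mapping.single (tmon_add m n) (ttwist N m n * c * d)) q) p"
  by (simp add: tmult_def pm_sum_def)

lemma tmult_add_right: "tmult N p (q + r) = tmult N p q + tmult N p r"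
  unfolding tmult_pm_sum
  by (simp add: pm_sum_add single_add distrib_left pm_sum_plus)

lemma tmult_add_left: "tmult N (p + q) r = tmult N p r + tmult N q r"
  unfolding tmult_pm_sum
  by (subst pm_sum_add) (simp_all add: pm_sum_def single_add distrib_left distrib_right sum.distrib)

lemma tmult_single:
  "tmult N (Poly_Mapping.single m c) (Poly_Mapping.single n d)
   = Poly_Mapping.single (tmon_add m n) (ttwist N m n * c * d)"
  unfolding tmult_pm_sum by (simp add: pm_sum_single pm_sum_def)

lemma tmon_add_assoc: "tmon_add (tmon_add m n) k = tmon_add m (tmon_add n k)"
  by (simp add: tmon_add_def wmon_add_def)

text \<open>The 2-cocycle condition, which is exactly associativity of the twisted product on
  monomials. It holds because the exponents of omega are biadditive in the two monomials.\<close>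

lemma ttwist_cocycle:
  "ttwist N m n * ttwist N (tmon_add m n) k = ttwist N m (tmon_add n k) * ttwist N n k"
proof -
  have *: "omega N powi a * omega N powi b * (omega N powi c * omega N powi d)
         = omega N powi a' * omega N powi b' * (omega N powi c' * omega N powi d')"
    if "a + b + (c + d) = a' + b' + (c' + d')" for a b c d a' b' c' d'
    using that omega_nonzero[of N] by (simp flip: power_int_add)
  show ?thesis
    unfolding ttwist_def wtwist_def
    by (rule *) (simp add: tmon_add_def wmon_add_def algebra_simps)
qed

lemma tmult_assoc: "tmult N (tmult N p q) r = tmult N p (tmult N q r)"
proof (induction p rule: poly_mapping_single_add_induct)
  case (single m c)
  show ?case
  proof (induction q rule: poly_mapping_single_add_induct)
    case (single n d)
    show ?case
    proof (induction r rule: poly_mapping_single_add_induct)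
      case (single k e)
      show ?case using ttwist_cocycle[of N m n k]
        by (simp add: tmult_single tmon_add_assoc mult_ac)
    qed (simp add: tmult_add_right)
  qed (simp add: tmult_add_right tmult_add_left)
qed (simp add: tmult_add_left)

abbreviation tone :: telem where "tone \<equiv> tm 0 0 0 0 0 0"

lemma tmult_one_left: "tmult N tone p = p"
  by (induction p rule: poly_mapping_single_add_induct)
    (simp_all add: tmult_add_right tmult_single tm_def tmon_add_def wmon_add_def ttwist_def wtwist_def)

lemma tmult_one_right: "tmult N p tone = p"
  by (induction p rule: poly_mapping_single_add_induct)
    (simp_all add: tmult_add_left tmult_single tm_def tmon_add_def wmon_add_def ttwist_def wtwist_def)

lemma Wtensor_simps [simp]:
  "carrier (Wtensor N) = UNIV" "p \<otimes>\<^bsub>Wtensor N\<^esub> q = tmult N p q" "p \<oplus>\<^bsub>Wtensor N\<^esub> q = p + q"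
  "\<one>\<^bsub>Wtensor N\<^esub> = tone" "\<zero>\<^bsub>Wtensor N\<^esub> = 0"
  by (simp_all add: Wtensor_def tm_def)

lemma ring_Wtensor: "ring (Wtensor N)"
proof (rule ringI)
  show "abelian_group (Wtensor N)"
  proof (rule abelian_groupI)
    fix x assume "x \<in> carrier (Wtensor N)"
    show "\<exists>y\<in>carrier (Wtensor N). y \<oplus>\<^bsub>Wtensor N\<^esub> x = \<zero>\<^bsub>Wtensor N\<^esub>"
      by (auto intro: exI[of _ "- x"])
  qed (auto simp: add_ac)
  show "monoid (Wtensor N)"
    by (rule monoidI) (auto simp: tmult_assoc tmult_one_left tmult_one_right)
qed (auto simp: tmult_add_left tmult_add_right)

lemma Wtensor_minus [simp]: "p \<ominus>\<^bsub>Wtensor N\<^esub> q = p - q"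
proof -
  interpret ring "Wtensor N" by (rule ring_Wtensor)
  have "\<ominus>\<^bsub>Wtensor N\<^esub> q = - q" by (rule minus_equality) auto
  thus ?thesis by (simp add: a_minus_def)
qed

section \<open>Difference operators\<close>

text \<open>Let (x f)(i) = A f(i+1) and (y f)(i) = B omega^i f(i), with z a scalar. Then x^a y^b z^c
  sends f to this factor times f(i+a); the power of y acts first, hence its phase is taken at i + a.
  The basis vector v_n corresponds to the indicator of n modulo N.\<close>

definition mon_coeff :: "nat \<Rightarrow> complex \<times> complex \<times> complex \<Rightarrow> wmon \<Rightarrow> int \<Rightarrow> complex" where
  "mon_coeff N p m i = omega_pow N (fst p) powi fst m * omega_pow N (fst (snd p)) powi fst (snd m)
     * omega_pow N (snd (snd p)) powi snd (snd m) * omega N powi ((i + fst m) * fst (snd m))"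

lemma omega_pow_nonzero [simp]: "omega_pow N x \<noteq> 0"
  by (simp add: omega_pow_def)

lemma omega_pow_add: "omega_pow N (x + y) = omega_pow N x * omega_pow N y"
  by (simp add: omega_pow_def exp_add distrib_left add_divide_distrib)

lemma omega_pow_minus: "omega_pow N (- x) = inverse (omega_pow N x)"
  by (simp add: omega_pow_def exp_minus)

lemma omega_pow_of_nat_mult: "omega_pow N (of_nat n * x) = omega_pow N x ^ n"
  unfolding omega_pow_def by (subst exp_of_nat_mult[symmetric]) (simp add: mult_ac)

lemma omega_eq: "omega N = omega_pow N 1"
  unfolding omega_def xi_def omega_pow_def exp_double[symmetric] by (simp add: mult_ac)

lemma omega_pow_of_nat: "omega_pow N (of_nat n) = omega N ^ n"
  using omega_pow_of_nat_mult[of N n 1] by (simp add: omega_eq)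

lemma primitive_root_omega: "N > 0 \<Longrightarrow> primitive_root (omega N) N"
  unfolding primitive_root_def
proof (intro conjI allI)
  fix k :: int assume N: "N > 0"
  have "omega N powi k = exp (\<i> * of_real (2 * pi * (of_int k / real N)))"
    unfolding omega_eq omega_pow_def exp_power_int by (simp add: mult_ac)
  also have "\<dots> = 1 \<longleftrightarrow> cos (2 * pi * (of_int k / real N)) = 1"
    unfolding cis_conv_exp[symmetric] complex_eq_iff by (auto dest: cos_one_sin_zero)
  also have "\<dots> \<longleftrightarrow> (\<exists>m::int. 2 * pi * (of_int k / real N) = of_int m * 2 * pi)"
    by (rule cos_one_2pi_int)
  also have "\<dots> \<longleftrightarrow> (\<exists>m::int. (of_int k :: real) = of_int (int N * m))"
    using N by (intro iff_exI) (auto simp: field_simps)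
  also have "\<dots> \<longleftrightarrow> int N dvd k" unfolding of_int_eq_iff dvd_def by blast
  finally show "omega N powi k = 1 \<longleftrightarrow> int N dvd k" .
qed simp

lemma powi_mult_eq:
  fixes q :: "'a::field"
  assumes "q \<noteq> 0" "a + b = c + d"
  shows "q powi a * q powi b = q powi c * q powi d"
  using assms by (simp flip: power_int_add)

lemma mon_coeff_mult:
  "mon_coeff N p m i * mon_coeff N p n (i + fst m) = wtwist N m n * mon_coeff N p (wmon_add m n) i"
proof -
  obtain a b c where m: "m = (a, b, c)" by (cases m)
  obtain a' b' c' where n: "n = (a', b', c')" by (cases n)
  have e: "omega N powi ((i + a) * b) * omega N powi ((i + a + a') * b')
      = omega N powi (- (b * a')) * omega N powi ((i + (a + a')) * (b + b'))"
    by (rule powi_mult_eq[OF omega_nonzero]) (simp add: algebra_simps)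
  have g: "x powi (k + l) = x powi k * x powi l" if "x \<noteq> 0" for x :: complex and k l
    using that by (simp add: power_int_add)
  have "mon_coeff N p m i * mon_coeff N p n (i + fst m)
      = omega_pow N (fst p) powi (a + a') * omega_pow N (fst (snd p)) powi (b + b')
        * omega_pow N (snd (snd p)) powi (c + c')
        * (omega N powi ((i + a) * b) * omega N powi ((i + a + a') * b'))"
    unfolding g[OF omega_pow_nonzero] by (simp add: mon_coeff_def m n)
  thus ?thesis unfolding e by (simp add: mon_coeff_def m n wtwist_def wmon_add_def)
qed

lemma mon_coeff_periodic:
  assumes N: "N > 0" and "i mod int N = j mod int N"
  shows "mon_coeff N p m i = mon_coeff N p m j"
proof -
  have "((i + fst m) * fst (snd m)) mod int N = ((j + fst m) * fst (snd m)) mod int N"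
    by (intro mod_mult_cong mod_add_cong assms(2) refl)
  from primitive_root_powi_cong[OF primitive_root_omega[OF N] this] show ?thesis
    by (simp add: mon_coeff_def)
qed

section \<open>Both tensor factors acting on functions of two integer variables\<close>

type_synonym func = "int \<times> int \<Rightarrow> complex"

definition fscale :: "complex \<Rightarrow> func \<Rightarrow> func" where "fscale c f = (\<lambda>x. c * f x)"

lemma fscale_apply [simp]: "fscale c f x = c * f x" by (simp add: fscale_def)

interpretation fs: operator_space fscale
  by unfold_locales (simp_all add: fun_eq_iff algebra_simps)

definition mon_op :: "nat \<Rightarrow> complex \<times> complex \<times> complex \<Rightarrow> complex \<times> complex \<times> complex \<Rightarrow> tmon \<Rightarrow> func \<Rightarrow> func" where
  "mon_op N p1 p2 m f = (\<lambda>(i,k). mon_coeff N p1 (fst m) i * mon_coeff N p2 (snd m) k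
     * f (i + fst (fst m), k + fst (snd m)))"

definition rep_op :: "nat \<Rightarrow> complex \<times> complex \<times> complex \<Rightarrow> complex \<times> complex \<times> complex \<Rightarrow> telem \<Rightarrow> func \<Rightarrow> func" where
  "rep_op N p1 p2 u f = (\<lambda>x. pm_sum (\<lambda>m c. c * mon_op N p1 p2 m f x) u)"

lemma rep_op_add: "rep_op N p1 p2 (u + v) f = rep_op N p1 p2 u f + rep_op N p1 p2 v f"
  by (simp add: rep_op_def fun_eq_iff pm_sum_add distrib_right)

lemma rep_op_single: "rep_op N p1 p2 (Poly_Mapping.single m c) f = fscale c (mon_op N p1 p2 m f)"
  by (simp add: rep_op_def fun_eq_iff pm_sum_single)

lemma rep_op_zero: "rep_op N p1 p2 0 f = 0"
  by (simp add: rep_op_def fun_eq_iff pm_sum_def)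

lemma rep_op_diff: "rep_op N p1 p2 (u - v) f = rep_op N p1 p2 u f - rep_op N p1 p2 v f"
  using rep_op_add[of N p1 p2 "u - v" v f] by (simp add: fun_eq_iff algebra_simps)

lemma rep_op_sum: "rep_op N p1 p2 (sum g A) f = (\<Sum>a\<in>A. rep_op N p1 p2 (g a) f)"
  by (induction A rule: infinite_finite_induct) (simp_all add: rep_op_zero rep_op_add)

lemma rep_op_tm: "rep_op N p1 p2 (tm a1 b1 c1 a2 b2 c2) f = mon_op N p1 p2 ((a1,b1,c1),(a2,b2,c2)) f"
  by (simp add: tm_def rep_op_single fun_eq_iff)

lemma rep_op_one: "rep_op N p1 p2 tone f = f"
  by (simp add: rep_op_tm mon_op_def mon_coeff_def fun_eq_iff)

lemma lin_mon_op: "fs.lin (mon_op N p1 p2 m)"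
  by (rule fs.linI) (simp_all add: mon_op_def fun_eq_iff algebra_simps)

lemma lin_rep_op: "fs.lin (rep_op N p1 p2 u)"
proof (rule fs.linI)
  fix f g c
  show "rep_op N p1 p2 u (f + g) = rep_op N p1 p2 u f + rep_op N p1 p2 u g"
    by (simp add: rep_op_def fun_eq_iff fs.lin_add[OF lin_mon_op] distrib_left pm_sum_plus)
  show "rep_op N p1 p2 u (fscale c f) = fscale c (rep_op N p1 p2 u f)"
    by (simp add: rep_op_def fun_eq_iff fs.lin_scale[OF lin_mon_op] pm_sum_def sum_distrib_left mult_ac)
qed

lemma mon_op_mult:
  "mon_op N p1 p2 m (mon_op N p1 p2 n f) = fscale (ttwist N m n) (mon_op N p1 p2 (tmon_add m n) f)"
proof
  fix x :: "int \<times> int"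
  obtain i k where x: "x = (i, k)" by (cases x)
  have "mon_op N p1 p2 m (mon_op N p1 p2 n f) x
      = (mon_coeff N p1 (fst m) i * mon_coeff N p1 (fst n) (i + fst (fst m)))
      * (mon_coeff N p2 (snd m) k * mon_coeff N p2 (snd n) (k + fst (snd m)))
      * f (i + (fst (fst m) + fst (fst n)), k + (fst (snd m) + fst (snd n)))"
    by (simp add: x mon_op_def add.assoc)
  thus "mon_op N p1 p2 m (mon_op N p1 p2 n f) x = fscale (ttwist N m n) (mon_op N p1 p2 (tmon_add m n) f) x"
    unfolding mon_coeff_mult by (simp add: x mon_op_def ttwist_def tmon_add_def wmon_add_def)
qed

lemma rep_op_tmult: "rep_op N p1 p2 (tmult N u v) f = rep_op N p1 p2 u (rep_op N p1 p2 v f)"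
proof (induction u rule: poly_mapping_single_add_induct)
  case (single m c)
  show ?case
  proof (induction v rule: poly_mapping_single_add_induct)
    case (single n d)
    show ?case
      unfolding tmult_single rep_op_single fs.lin_scale[OF lin_mon_op] mon_op_mult fs.scale_scale
      by (simp only: mult_ac)
  next
    case (add v w)
    show ?case
      unfolding tmult_add_right rep_op_add add.IH
      by (simp only: rep_op_single fs.lin_add[OF lin_mon_op] fs.scale_right_distrib)
  qed
qed (simp add: tmult_add_left rep_op_add)

definition periodic :: "nat \<Rightarrow> func set" where
  "periodic N = {f. \<forall>i k. f (i mod int N, k mod int N) = f (i, k)}"

lemma periodic_mod: "f \<in> periodic N \<Longrightarrow> f (i mod int N, k mod int N) = f (i, k)"
  by (simp add: periodic_def)

lemma periodicD:
  assumes "f \<in> periodic N" "i mod int N = j mod int N" "k mod int N = l mod int N"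
  shows "f (i, k) = f (j, l)"
  using periodic_mod[OF assms(1), of i k] periodic_mod[OF assms(1), of j l] assms(2,3) by simp

lemma periodic_add: "f \<in> periodic N \<Longrightarrow> g \<in> periodic N \<Longrightarrow> f + g \<in> periodic N"
  and periodic_scale: "f \<in> periodic N \<Longrightarrow> fscale c f \<in> periodic N"
  by (simp_all add: periodic_def)

lemma mon_op_periodic:
  assumes N: "N > 0" and f: "f \<in> periodic N"
  shows "mon_op N p1 p2 m f \<in> periodic N"
  unfolding periodic_def
proof (intro CollectI allI)
  fix i k
  have "f (i mod int N + fst (fst m), k mod int N + fst (snd m)) = f (i + fst (fst m), k + fst (snd m))"
    by (rule periodicD[OF f]) (simp_all add: mod_simps)
  moreover have "mon_coeff N p1 (fst m) (i mod int N) = mon_coeff N p1 (fst m) i"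
    "mon_coeff N p2 (snd m) (k mod int N) = mon_coeff N p2 (snd m) k"
    by (intro mon_coeff_periodic[OF N] mod_mod_trivial)+
  ultimately show "mon_op N p1 p2 m f (i mod int N, k mod int N) = mon_op N p1 p2 m f (i, k)"
    by (simp add: mon_op_def)
qed

lemma rep_op_periodic:
  assumes N: "N > 0" and f: "f \<in> periodic N"
  shows "rep_op N p1 p2 u f \<in> periodic N"
proof (induction u rule: poly_mapping_single_add_induct)
  case (single m c)
  show ?case unfolding rep_op_single by (intro periodic_scale mon_op_periodic[OF N f])
next
  case (add u v)
  show ?case unfolding rep_op_add by (intro periodic_add add.IH)
qed

text \<open>The periodic point mass at \<open>j\<close>, the counterpart of the basis vector v_n
  tensor v_m for \<open>j = (n, m)\<close>.\<close>

definition delta :: "nat \<Rightarrow> int \<times> int \<Rightarrow> func" where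
  "delta N j = (\<lambda>i. if fst i mod int N = fst j mod int N \<and> snd i mod int N = snd j mod int N then 1 else 0)"

lemma delta_periodic: "delta N j \<in> periodic N"
  by (simp add: periodic_def delta_def)

text \<open>Position \<open>i * N + k\<close> of the Kronecker basis corresponds to the point \<open>(i, k)\<close>.\<close>
definition point :: "nat \<Rightarrow> nat \<Rightarrow> int \<times> int" where
  "point N r = (int (r div N), int (r mod N))"

lemma point_mod: "r < N * N \<Longrightarrow> fst (point N r) mod int N = fst (point N r)"
  "r < N * N \<Longrightarrow> snd (point N r) mod int N = snd (point N r)"
  by (auto simp: point_def less_mult_imp_div_less simp flip: zmod_int)

lemma point_inj: "point N r = point N s \<longleftrightarrow> r = s"
  unfolding point_def by (metis Pair_inject div_mult_mod_eq of_nat_eq_iff)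

lemma delta_point: "r < N * N \<Longrightarrow> s < N * N \<Longrightarrow> delta N (point N s) (point N r) = (if r = s then 1 else 0)"
  using point_inj[of N r s] by (auto simp: delta_def point_mod prod_eq_iff)

lemma point_ex:
  assumes N: "N > 0"
  obtains r where "r < N * N" "fst (point N r) = i mod int N" "snd (point N r) = k mod int N"
proof
  let ?r = "nat (i mod int N) * N + nat (k mod int N)"
  have *: "nat (i mod int N) < N" "nat (k mod int N) < N" using N by (auto simp: nat_less_iff)
  have "?r < nat (i mod int N) * N + N" using * by simp
  also have "\<dots> = Suc (nat (i mod int N)) * N" by simp
  also have "\<dots> \<le> N * N" using * by (intro mult_le_mono1) simp
  finally show "?r < N * N" .
  show "fst (point N ?r) = i mod int N" "snd (point N ?r) = k mod int N"
    using * N by (simp_all add: point_def)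
qed

lemma sum_fun_apply: "(sum g A) x = (\<Sum>a\<in>A. g a x)"
  by (induction A rule: infinite_finite_induct) simp_all

lemma delta_expand_sum:
  assumes N: "N > 0" and f: "f \<in> periodic N"
  shows "f = (\<Sum>r<N * N. fscale (f (point N r)) (delta N (point N r)))"
proof
  fix x :: "int \<times> int"
  obtain i k where x: "x = (i, k)" by (cases x)
  obtain s where s: "s < N * N" "fst (point N s) = i mod int N" "snd (point N s) = k mod int N"
    using point_ex[OF N] by blast
  have ps: "point N s = (i mod int N, k mod int N)" using s by (simp add: prod_eq_iff)
  have fx: "g x = g (point N s)" if "g \<in> periodic N" for g
    using periodic_mod[OF that, of i k] by (simp add: x ps)
  have "(\<Sum>r<N * N. fscale (f (point N r)) (delta N (point N r))) x
      = (\<Sum>r<N * N. f (point N r) * (if r = s then 1 else 0))"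
    unfolding sum_fun_apply fscale_apply fx[OF delta_periodic]
    by (intro sum.cong refl) (use s in \<open>simp add: delta_point eq_commute\<close>)
  also have "\<dots> = f x" using s fx[OF f] by (simp add: if_distrib cong: if_cong)
  finally show "f x = (\<Sum>r<N * N. fscale (f (point N r)) (delta N (point N r))) x" ..
qed

section \<open>Matrices of difference operators\<close>

definition op_mat :: "nat \<Rightarrow> (func \<Rightarrow> func) \<Rightarrow> complex mat" where
  "op_mat N T = mat (N * N) (N * N) (\<lambda>(r, c). T (delta N (point N c)) (point N r))"

lemma op_mat_carrier [simp]: "op_mat N T \<in> carrier_mat (N * N) (N * N)"
  by (simp add: op_mat_def)

lemma op_mat_dim [simp]: "dim_row (op_mat N T) = N * N" "dim_col (op_mat N T) = N * N"
  by (simp_all add: op_mat_def)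

lemma op_mat_index: "r < N * N \<Longrightarrow> c < N * N \<Longrightarrow> op_mat N T $$ (r, c) = T (delta N (point N c)) (point N r)"
  by (simp add: op_mat_def)

lemma lin_expand:
  assumes N: "N > 0" and S: "fs.lin S" and f: "f \<in> periodic N"
  shows "S f x = (\<Sum>s<N * N. f (point N s) * S (delta N (point N s)) x)"
proof -
  have "S f x = S (\<Sum>s<N * N. fscale (f (point N s)) (delta N (point N s))) x"
    using delta_expand_sum[OF N f] by simp
  also have "\<dots> = (\<Sum>s<N * N. f (point N s) * S (delta N (point N s)) x)"
    unfolding fs.lin_sum[OF S] fs.lin_scale[OF S] sum_fun_apply fscale_apply ..
  finally show ?thesis .
qed

text \<open>\<open>T\<close> has to preserve periodicity because its value on a point mass is
  expanded in point masses again before \<open>S\<close> is applied.\<close>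

lemma op_mat_mult:
  assumes N: "N > 0" and S: "fs.lin S" and T: "\<And>f. f \<in> periodic N \<Longrightarrow> T f \<in> periodic N"
  shows "op_mat N S * op_mat N T = op_mat N (\<lambda>f. S (T f))"
proof (rule eq_matI)
  fix r c assume "r < dim_row (op_mat N (\<lambda>f. S (T f)))" "c < dim_col (op_mat N (\<lambda>f. S (T f)))"
  hence rc: "r < N * N" "c < N * N" by simp_all
  have "(op_mat N S * op_mat N T) $$ (r, c)
      = (\<Sum>s<N * N. op_mat N S $$ (r, s) * op_mat N T $$ (s, c))"
    using rc by (simp add: scalar_prod_def atLeast0LessThan)
  also have "\<dots> = (\<Sum>s<N * N. T (delta N (point N c)) (point N s) * S (delta N (point N s)) (point N r))"
    using rc by (intro sum.cong) (auto simp: op_mat_index)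
  also have "\<dots> = S (T (delta N (point N c))) (point N r)"
    using lin_expand[OF N S T[OF delta_periodic]] by simp
  finally show "(op_mat N S * op_mat N T) $$ (r, c) = op_mat N (\<lambda>f. S (T f)) $$ (r, c)"
    using rc by (simp add: op_mat_index)
qed simp_all

lemma op_mat_id: "op_mat N (\<lambda>f. f) = 1\<^sub>m (N * N)"
  by (rule eq_matI) (simp_all add: op_mat_index delta_point)

lemma op_mat_cong: "(\<And>f. f \<in> periodic N \<Longrightarrow> S f = T f) \<Longrightarrow> op_mat N S = op_mat N T"
  using delta_periodic by (simp add: op_mat_def)

lemma op_mat_eqD:
  assumes N: "N > 0" and S: "fs.lin S" and T: "fs.lin T"
    and Sp: "\<And>f. f \<in> periodic N \<Longrightarrow> S f \<in> periodic N" and Tp: "\<And>f. f \<in> periodic N \<Longrightarrow> T f \<in> periodic N"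
    and eq: "op_mat N S = op_mat N T" and f: "f \<in> periodic N"
  shows "S f = T f"
proof -
  have "S (delta N (point N s)) (point N r) = T (delta N (point N s)) (point N r)"
    if "r < N * N" "s < N * N" for r s
    using that op_mat_index[of r N s] eq by metis
  hence "S f (point N r) = T f (point N r)" if "r < N * N" for r
    using that by (simp add: lin_expand[OF N S f] lin_expand[OF N T f])
  thus ?thesis
    by (subst delta_expand_sum[OF N Sp[OF f]], subst delta_expand_sum[OF N Tp[OF f]]) simp
qed

text \<open>\<open>j + N - 1\<close> is j - 1 modulo N without truncation at j = 0. The entry
  condition of \<open>Xmat\<close> thus becomes a shift of the row index, as for difference
  operators.\<close>

lemma Suc_mod_eq_iff:
  fixes i j N :: nat
  assumes "i < N" "j < N"
  shows "i = (j + N - 1) mod N \<longleftrightarrow> (i + 1) mod N = j"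
proof (cases j)
  case 0
  then show ?thesis using assms by (auto simp: mod_if)
next
  case (Suc k)
  then show ?thesis using assms by (auto simp: mod_if)
qed

lemma mat_mult_index:
  assumes "A \<in> carrier_mat n n" "B \<in> carrier_mat n n" "i < n" "j < n"
  shows "(A * B) $$ (i, j) = (\<Sum>k<n. A $$ (i, k) * B $$ (k, j))"
  using assms by (simp add: scalar_prod_def atLeast0LessThan)

lemma Xmat_pow:
  "Xmat N p ^\<^sub>m n = mat N N (\<lambda>(i, j). if (i + n) mod N = j then omega_pow N (fst p) ^ n else 0)"
proof (induction n)
  case 0
  then show ?case by (intro eq_matI) (auto simp: Xmat_def)
next
  case (Suc n)
  show ?case
  proof (rule eq_matI, goal_cases)
    case (1 i j)
    hence ij: "i < N" "j < N" by simp_all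
    hence l: "(i + n) mod N < N" by simp
    have "(Xmat N p ^\<^sub>m Suc n) $$ (i, j)
        = (\<Sum>k<N. (if (i + n) mod N = k then omega_pow N (fst p) ^ n else 0) * Xmat N p $$ (k, j))"
      using ij unfolding pow_mat.simps Suc by (subst mat_mult_index) (auto simp: Xmat_def intro!: sum.cong)
    also have "\<dots> = omega_pow N (fst p) ^ n * Xmat N p $$ ((i + n) mod N, j)"
      using l by (simp add: if_distrib[of "\<lambda>x. x * _"] cong: if_cong)
    also have "\<dots> = (if (i + Suc n) mod N = j then omega_pow N (fst p) ^ Suc n else 0)"
      using ij l Suc_mod_eq_iff[OF l ij(2)] by (simp add: Xmat_def mod_Suc_eq)
    finally show ?case using ij by simp
  qed (simp_all add: Suc Xmat_def)
qed

lemma Xinvmat_pow: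
  "Xinvmat N p ^\<^sub>m n = mat N N (\<lambda>(i, j). if i = (j + n) mod N then omega_pow N (- fst p) ^ n else 0)"
proof (induction n)
  case 0
  then show ?case by (intro eq_matI) (auto simp: Xinvmat_def)
next
  case (Suc n)
  show ?case
  proof (rule eq_matI, goal_cases)
    case (1 i j)
    hence ij: "i < N" "j < N" by simp_all
    hence l: "(j + 1) mod N < N" by simp
    have "(Xinvmat N p ^\<^sub>m Suc n) $$ (i, j)
        = (\<Sum>k<N. (if i = (k + n) mod N then omega_pow N (- fst p) ^ n else 0)
            * (if k = (j + 1) mod N then omega_pow N (- fst p) else 0))"
      using ij unfolding pow_mat.simps Suc by (subst mat_mult_index) (auto simp: Xinvmat_def intro!: sum.cong)
    also have "\<dots> = (if i = ((j + 1) mod N + n) mod N then omega_pow N (- fst p) ^ n else 0)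
            * omega_pow N (- fst p)"
      using l by (simp add: if_distrib[of "\<lambda>x. _ * x"] cong: if_cong)
    also have "\<dots> = (if i = (j + Suc n) mod N then omega_pow N (- fst p) ^ Suc n else 0)"
      by (simp add: mod_simps)
    finally show ?case using ij by simp
  qed (simp_all add: Suc Xinvmat_def)
qed

lemma zpow_Xmat:
  assumes "i < N" "j < N"
  shows "zpow_mat (Xmat N p) (Xinvmat N p) a $$ (i, j)
       = (if (int i + a) mod int N = int j then omega_pow N (fst p) powi a else 0)"
proof (cases "a \<ge> 0")
  case True
  then obtain n where "a = int n" using nonneg_int_cases by blast
  then show ?thesis using assms
    by (simp add: zpow_mat_def Xmat_pow flip: of_nat_add zmod_int)
next
  case False
  then obtain n where n: "a = - int n" by (metis int_cases2 of_nat_0_le_iff)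
  have "i = (j + n) mod N \<longleftrightarrow> int i mod int N = (int j + int n) mod int N"
    using assms by (simp flip: of_nat_add zmod_int)
  also have "\<dots> \<longleftrightarrow> (int i - int n) mod int N = int j mod int N"
    by (simp add: mod_eq_dvd_iff algebra_simps)
  finally have "i = (j + n) mod N \<longleftrightarrow> (int i + a) mod int N = int j" using assms n by simp
  then show ?thesis using assms False n
    by (simp add: zpow_mat_def Xinvmat_pow omega_pow_minus power_int_minus power_inverse)
qed

lemma diag_mat_pow:
  "mat N N (\<lambda>(i, j). if i = j then d j else 0) ^\<^sub>m n
   = mat N N (\<lambda>(i, j). if i = j then (d j :: complex) ^ n else 0)"
proof (induction n)
  case 0
  then show ?case by (intro eq_matI) auto
next
  case (Suc n)
  show ?case
  proof (rule eq_matI, goal_cases)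
    case (1 i j)
    hence ij: "i < N" "j < N" by simp_all
    have "(mat N N (\<lambda>(i, j). if i = j then d j else 0) ^\<^sub>m Suc n) $$ (i, j)
        = (\<Sum>k<N. (if i = k then d k ^ n else 0) * (if k = j then d j else 0))"
      using ij by (simp add: Suc scalar_prod_def atLeast0LessThan)
    also have "\<dots> = (if i = j then d j ^ Suc n else 0)"
      using ij by (simp add: if_distrib[of "\<lambda>x. x * _"] cong: if_cong)
    finally show ?case using ij by simp
  qed (simp_all add: Suc)
qed

lemma zpow_diag_mat:
  assumes "\<And>j. d j \<noteq> 0"
  shows "zpow_mat (mat N N (\<lambda>(i, j). if i = j then d j else 0)) (mat N N (\<lambda>(i, j). if i = j then inverse (d j) else 0)) a
       = mat N N (\<lambda>(i, j). if i = j then (d j :: complex) powi a else 0)"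
  by (rule eq_matI) (auto simp: zpow_mat_def diag_mat_pow power_int_def)

lemma zpow_Ymat:
  "zpow_mat (Ymat N p) (Yinvmat N p) b
   = mat N N (\<lambda>(i, j). if i = j then omega_pow N (fst (snd p) + of_nat j) powi b else 0)"
  using zpow_diag_mat[of "\<lambda>j. omega_pow N (fst (snd p) + of_nat j)" N b]
  by (simp only: Ymat_def Yinvmat_def omega_pow_minus omega_pow_nonzero simp_thms)

lemma zpow_Zmat:
  "zpow_mat (Zmat N p) (Zinvmat N p) c
   = mat N N (\<lambda>(i, j). if i = j then omega_pow N (snd (snd p)) powi c else 0)"
proof -
  have "Zmat N p = mat N N (\<lambda>(i, j). if i = j then omega_pow N (snd (snd p)) else 0)"
    "Zinvmat N p = mat N N (\<lambda>(i, j). if i = j then inverse (omega_pow N (snd (snd p))) else 0)"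
    by (rule eq_matI; auto simp: Zmat_def Zinvmat_def omega_pow_minus)+
  thus ?thesis using zpow_diag_mat[of "\<lambda>j. omega_pow N (snd (snd p))" N c] by simp
qed

lemma mult_diag_mat:
  assumes "A \<in> carrier_mat N N"
  shows "A * mat N N (\<lambda>(i, j). if i = j then d j else 0) = mat N N (\<lambda>(i, j). A $$ (i, j) * (d j :: complex))"
proof (rule eq_matI, goal_cases)
  case (1 i j)
  hence ij: "i < N" "j < N" by simp_all
  have "(A * mat N N (\<lambda>(i, j). if i = j then d j else 0)) $$ (i, j)
      = (\<Sum>k<N. A $$ (i, k) * (if k = j then d j else 0))"
    using ij assms by (simp add: scalar_prod_def atLeast0LessThan)
  also have "\<dots> = A $$ (i, j) * d j" using ij by (simp add: if_distrib[of "\<lambda>x. _ * x"] cong: if_cong)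
  finally show ?case using ij by simp
qed (use assms in simp_all)

lemma pi_mon_dim [simp]: "pi_mon N p m \<in> carrier_mat N N" "dim_row (pi_mon N p m) = N" "dim_col (pi_mon N p m) = N"
proof -
  have "zpow_mat (Xmat N p) (Xinvmat N p) a \<in> carrier_mat N N" for a
    by (auto simp: zpow_mat_def Xmat_pow Xinvmat_pow)
  thus "pi_mon N p m \<in> carrier_mat N N" unfolding pi_mon_def zpow_Ymat zpow_Zmat
    by (intro mult_carrier_mat[of _ N N]) auto
  thus "dim_row (pi_mon N p m) = N" "dim_col (pi_mon N p m) = N" by auto
qed

lemma pi_mon_index:
  assumes ij: "i < N" "j < N"
  shows "pi_mon N p m $$ (i, j) = (if (int i + fst m) mod int N = int j then mon_coeff N p m (int i) else 0)"
proof -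
  have N: "N > 0" using ij by simp
  have X: "zpow_mat (Xmat N p) (Xinvmat N p) (fst m) \<in> carrier_mat N N"
    by (auto simp: zpow_mat_def Xmat_pow Xinvmat_pow)
  have "pi_mon N p m $$ (i, j) = zpow_mat (Xmat N p) (Xinvmat N p) (fst m) $$ (i, j)
      * omega_pow N (fst (snd p) + of_nat j) powi fst (snd m) * omega_pow N (snd (snd p)) powi snd (snd m)"
    unfolding pi_mon_def zpow_Ymat zpow_Zmat mult_diag_mat[OF X] by (subst mult_diag_mat) (use ij in simp_all)
  \<comment> \<open>The diagonal matrix of y sees the column index, \<open>mon_coeff\<close> the
    shifted row index; they are congruent modulo N wherever the entry is nonzero.\<close>
  moreover have "omega N powi (int j * fst (snd m)) = omega N powi ((int i + fst m) * fst (snd m))"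
    if "(int i + fst m) mod int N = int j"
    by (rule primitive_root_powi_cong[OF primitive_root_omega[OF N]]) (simp add: mod_simps flip: that)
  moreover have "omega_pow N (fst (snd p) + of_nat j) powi b = omega_pow N (fst (snd p)) powi b * omega N powi (int j * b)" for b
    by (simp add: omega_pow_add omega_pow_of_nat power_int_mult_distrib power_int_mult)
  ultimately show ?thesis
    using zpow_Xmat[OF ij] by (simp add: mon_coeff_def mult_ac)
qed

lemma kron_pi_mon:
  assumes rc: "r < N * N" "c < N * N"
  shows "kron (pi_mon N p1 (fst m)) (pi_mon N p2 (snd m)) $$ (r, c) = mon_op N p1 p2 m (delta N (point N c)) (point N r)"
proof -
  have N: "N > 0" using rc by (cases N) auto
  have d: "r div N < N" "c div N < N" "r mod N < N" "c mod N < N"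
    using rc N by (simp_all add: less_mult_imp_div_less)
  have "kron (pi_mon N p1 (fst m)) (pi_mon N p2 (snd m)) $$ (r, c)
      = pi_mon N p1 (fst m) $$ (r div N, c div N) * pi_mon N p2 (snd m) $$ (r mod N, c mod N)"
    using rc by (simp add: kron_def)
  also have "\<dots> = mon_op N p1 p2 m (delta N (point N c)) (point N r)"
    using d by (auto simp: pi_mon_index mon_op_def delta_def point_def)
  finally show ?thesis .
qed

text \<open>The bridge through which multiplicativity, kernel and image of the given matrix
  representation are studied on functions.\<close>

lemma pi_tensor_eq: "pi_tensor N p1 p2 u = op_mat N (rep_op N p1 p2 u)"
  by (rule eq_matI)
    (simp_all add: pi_tensor_def op_mat_def rep_op_def pm_sum_def kron_pi_mon)

lemma pi_tensor_mult: "N > 0 \<Longrightarrow> pi_tensor N p1 p2 (tmult N u v) = pi_tensor N p1 p2 u * pi_tensor N p1 p2 v"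
  unfolding pi_tensor_eq
  by (subst op_mat_mult) (auto simp: lin_rep_op rep_op_periodic rep_op_tmult intro: op_mat_cong)

lemma pi_tensor_one: "pi_tensor N p1 p2 tone = 1\<^sub>m (N * N)"
  unfolding pi_tensor_eq op_mat_id[symmetric] by (rule op_mat_cong) (rule rep_op_one)

lemma pi_tensor_add: "pi_tensor N p1 p2 (u + v) = pi_tensor N p1 p2 u + pi_tensor N p1 p2 v"
  by (rule eq_matI) (simp_all add: pi_tensor_eq op_mat_index rep_op_add)

lemma pi_tensor_carrier [simp]: "pi_tensor N p1 p2 u \<in> carrier_mat (N * N) (N * N)"
  by (simp add: pi_tensor_eq)

section \<open>The quotient algebra\<close>

lemma mon_coeff_central:
  assumes N: "N > 0" and p: "rep_params N \<chi> p"
    and m: "int N dvd fst m" "int N dvd fst (snd m)"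
  shows "mon_coeff N p m i = ch_a \<chi> powi (fst m div int N) * ch_b \<chi> powi (fst (snd m) div int N)
           * ch_z \<chi> powi (snd (snd m))"
proof -
  have a: "ch_a \<chi> = omega_pow N (fst p) ^ N" and b: "ch_b \<chi> = omega_pow N (fst (snd p)) ^ N"
    and z: "ch_z \<chi> = omega_pow N (snd (snd p))"
    using p by (auto simp: rep_params_def omega_pow_of_nat_mult)
  obtain s t where s: "fst m = int N * s" and t: "fst (snd m) = int N * t" using m by (auto elim!: dvdE)
  have "omega N powi ((i + fst m) * fst (snd m)) = 1"
    using m(2) primitive_root_powi_eq_1[OF primitive_root_omega[OF N]] by simp
  thus ?thesis unfolding mon_coeff_def a b z s t using N by (simp add: power_int_mult)
qed

lemma emb1_eq: "emb1 u = pm_sum (\<lambda>m c. Poly_Mapping.single (m, (0,0,0)) c) u"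
  and emb2_eq: "emb2 u = pm_sum (\<lambda>m c. Poly_Mapping.single ((0,0,0), m) c) u"
  by (simp_all add: emb1_def emb2_def pm_sum_def)

lemma emb_add: "emb1 (u + v) = emb1 u + emb1 v" "emb2 (u + v) = emb2 u + emb2 v"
  unfolding emb1_eq emb2_eq by (rule pm_sum_add; simp only: single_zero single_add)+

lemma emb_single:
  "emb1 (Poly_Mapping.single m c) = Poly_Mapping.single (m, (0,0,0)) c"
  "emb2 (Poly_Mapping.single m c) = Poly_Mapping.single ((0,0,0), m) c"
  unfolding emb1_eq emb2_eq by (rule pm_sum_single; simp only: single_zero)+

lemma chi_hat_eq:
  "chi_hat N \<chi> u = pm_sum (\<lambda>m c. c * ch_a \<chi> powi (fst m div int N)
      * ch_b \<chi> powi (fst (snd m) div int N) * ch_z \<chi> powi (snd (snd m))) u"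
  by (simp add: chi_hat_def pm_sum_def)

lemma chi_hat_add: "chi_hat N \<chi> (u + v) = chi_hat N \<chi> u + chi_hat N \<chi> v"
  unfolding chi_hat_eq by (rule pm_sum_add) (simp_all only: mult_zero_left distrib_right)

lemma chi_hat_single: "chi_hat N \<chi> (Poly_Mapping.single m c) = c * ch_a \<chi> powi (fst m div int N)
      * ch_b \<chi> powi (fst (snd m) div int N) * ch_z \<chi> powi (snd (snd m))"
  unfolding chi_hat_eq by (rule pm_sum_single) simp

lemma mon_coeff_zero: "mon_coeff N p (0, 0, 0) i = 1"
  by (simp add: mon_coeff_def)

lemma rep_op_emb1:
  assumes N: "N > 0" and p: "rep_params N \<chi>1 p1" and u: "u \<in> chi_kernel N \<chi>1" and f: "f \<in> periodic N"
  shows "rep_op N p1 p2 (emb1 u) f = 0"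
proof
  fix x :: "int \<times> int"
  obtain i k where x: "x = (i, k)" by (cases x)
  have "rep_op N p1 p2 (emb1 u) f x = (\<Sum>m\<in>Poly_Mapping.keys u. Poly_Mapping.lookup u m * (mon_coeff N p1 m i * f (i + fst m, k)))"
    unfolding emb1_def rep_op_sum sum_fun_apply rep_op_single x fscale_apply by (simp add: mon_op_def mon_coeff_zero)
  also have "\<dots> = (\<Sum>m\<in>Poly_Mapping.keys u. Poly_Mapping.lookup u m * ch_a \<chi>1 powi (fst m div int N)
        * ch_b \<chi>1 powi (fst (snd m) div int N) * ch_z \<chi>1 powi (snd (snd m)) * f (i, k))"
  proof (rule sum.cong[OF refl])
    fix m assume "m \<in> Poly_Mapping.keys u"
    hence m: "int N dvd fst m" "int N dvd fst (snd m)" using u by (auto simp: chi_kernel_def in_center_def)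
    have "f (i + fst m, k) = f (i, k)"
      by (rule periodicD[OF f]) (use m(1) in \<open>auto simp: mod_eq_dvd_iff\<close>)
    thus "Poly_Mapping.lookup u m * (mon_coeff N p1 m i * f (i + fst m, k))
      = Poly_Mapping.lookup u m * ch_a \<chi>1 powi (fst m div int N)
        * ch_b \<chi>1 powi (fst (snd m) div int N) * ch_z \<chi>1 powi (snd (snd m)) * f (i, k)"
      unfolding mon_coeff_central[OF N p m] by simp
  qed
  also have "\<dots> = chi_hat N \<chi>1 u * f (i, k)" by (simp add: chi_hat_def sum_distrib_right)
  also have "\<dots> = 0" using u by (simp add: chi_kernel_def)
  finally show "rep_op N p1 p2 (emb1 u) f x = 0 x" by simp
qed

lemma rep_op_emb2:
  assumes N: "N > 0" and p: "rep_params N \<chi>2 p2" and u: "u \<in> chi_kernel N \<chi>2" and f: "f \<in> periodic N"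
  shows "rep_op N p1 p2 (emb2 u) f = 0"
proof
  fix x :: "int \<times> int"
  obtain i k where x: "x = (i, k)" by (cases x)
  have "rep_op N p1 p2 (emb2 u) f x = (\<Sum>m\<in>Poly_Mapping.keys u. Poly_Mapping.lookup u m * (mon_coeff N p2 m k * f (i, k + fst m)))"
    unfolding emb2_def rep_op_sum sum_fun_apply rep_op_single x fscale_apply by (simp add: mon_op_def mon_coeff_zero)
  also have "\<dots> = (\<Sum>m\<in>Poly_Mapping.keys u. Poly_Mapping.lookup u m * ch_a \<chi>2 powi (fst m div int N)
        * ch_b \<chi>2 powi (fst (snd m) div int N) * ch_z \<chi>2 powi (snd (snd m)) * f (i, k))"
  proof (rule sum.cong[OF refl])
    fix m assume "m \<in> Poly_Mapping.keys u"
    hence m: "int N dvd fst m" "int N dvd fst (snd m)" using u by (auto simp: chi_kernel_def in_center_def)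
    have "f (i, k + fst m) = f (i, k)"
      by (rule periodicD[OF f]) (use m(1) in \<open>auto simp: mod_eq_dvd_iff\<close>)
    thus "Poly_Mapping.lookup u m * (mon_coeff N p2 m k * f (i, k + fst m))
      = Poly_Mapping.lookup u m * ch_a \<chi>2 powi (fst m div int N)
        * ch_b \<chi>2 powi (fst (snd m) div int N) * ch_z \<chi>2 powi (snd (snd m)) * f (i, k)"
      unfolding mon_coeff_central[OF N p m] by simp
  qed
  also have "\<dots> = chi_hat N \<chi>2 u * f (i, k)" by (simp add: chi_hat_def sum_distrib_right)
  also have "\<dots> = 0" using u by (simp add: chi_kernel_def)
  finally show "rep_op N p1 p2 (emb2 u) f x = 0 x" by simp
qed

abbreviation matring :: "nat \<Rightarrow> complex mat ring" where
  "matring N \<equiv> ring_mat TYPE(complex) (N * N) ()"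

lemma pi_tensor_ring_hom:
  assumes "N > 0"
  shows "ring_hom_ring (Wtensor N) (matring N) (pi_tensor N p1 p2)"
  by (rule ring_hom_ringI)
    (auto simp: ring_Wtensor ring_mat ring_mat_simps pi_tensor_mult[OF assms] pi_tensor_add pi_tensor_one)

lemma op_mat_zero: "op_mat N (\<lambda>f. 0) = 0\<^sub>m (N * N) (N * N)"
  by (rule eq_matI) (simp_all add: op_mat_index)

lemma pi_tensor_eq_0_iff:
  assumes "N > 0"
  shows "pi_tensor N p1 p2 u = 0\<^sub>m (N * N) (N * N) \<longleftrightarrow> (\<forall>f\<in>periodic N. rep_op N p1 p2 u f = 0)"
proof
  assume "pi_tensor N p1 p2 u = 0\<^sub>m (N * N) (N * N)"
  hence *: "op_mat N (rep_op N p1 p2 u) = op_mat N (\<lambda>f. 0)" by (simp add: pi_tensor_eq op_mat_zero)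
  have lin0: "fs.lin (\<lambda>f. 0)" by (rule fs.linI) simp_all
  have per0: "0 \<in> periodic N" by (simp add: periodic_def)
  show "\<forall>f\<in>periodic N. rep_op N p1 p2 u f = 0"
    using op_mat_eqD[OF assms lin_rep_op lin0 rep_op_periodic[OF assms] per0 *] by blast
next
  assume "\<forall>f\<in>periodic N. rep_op N p1 p2 u f = 0"
  thus "pi_tensor N p1 p2 u = 0\<^sub>m (N * N) (N * N)"
    unfolding pi_tensor_eq op_mat_zero[symmetric] by (intro op_mat_cong) simp
qed

lemma ideal_Jideal: "ideal (Jideal N \<chi>1 \<chi>2) (Wtensor N)"
  unfolding Jideal_def by (rule ring.genideal_ideal[OF ring_Wtensor]) simp

text \<open>The kernel of \<open>pi_tensor\<close> is an ideal containing both sets of generators.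
  The converse inclusion is part of \<open>pi_tensor_kernel\<close>.\<close>

lemma pi_tensor_Jideal:
  assumes N: "N > 0" and p: "rep_params N \<chi>1 p1" "rep_params N \<chi>2 p2" and u: "u \<in> Jideal N \<chi>1 \<chi>2"
  shows "pi_tensor N p1 p2 u = 0\<^sub>m (N * N) (N * N)"
proof -
  have "emb1 ` chi_kernel N \<chi>1 \<union> emb2 ` chi_kernel N \<chi>2
      \<subseteq> a_kernel (Wtensor N) (matring N) (pi_tensor N p1 p2)"
    by (auto simp: a_kernel_def' ring_mat_simps pi_tensor_eq_0_iff[OF N]
        rep_op_emb1[OF N p(1)] rep_op_emb2[OF N p(2)])
  hence "Jideal N \<chi>1 \<chi>2 \<subseteq> a_kernel (Wtensor N) (matring N) (pi_tensor N p1 p2)"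
    unfolding Jideal_def
    by (rule ring.genideal_minimal[OF ring_Wtensor ring_hom_ring.kernel_is_ideal[OF pi_tensor_ring_hom[OF N]]])
  thus ?thesis using u by (auto simp: a_kernel_def' ring_mat_simps)
qed

lemma Jideal_add: "u \<in> Jideal N \<chi>1 \<chi>2 \<Longrightarrow> v \<in> Jideal N \<chi>1 \<chi>2 \<Longrightarrow> u + v \<in> Jideal N \<chi>1 \<chi>2"
  using additive_subgroup.a_closed[OF ideal.axioms(1)[OF ideal_Jideal]] by fastforce

lemma Jideal_tmult: "u \<in> Jideal N \<chi>1 \<chi>2 \<Longrightarrow> tmult N v u \<in> Jideal N \<chi>1 \<chi>2"
  using ideal.I_l_closed[OF ideal_Jideal, of u N \<chi>1 \<chi>2 v] by simp

text \<open>A central monomial acts by its character value, so \<open>mon_coeff\<close> does not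
  depend on the point there and can be taken at 0; monomial minus value is in the kernel of the
  character.\<close>

lemma Jideal_central:
  assumes N: "N > 0" and p: "rep_params N \<chi>1 p1" "rep_params N \<chi>2 p2"
    and m: "int N dvd fst m" "int N dvd fst (snd m)"
  shows "Poly_Mapping.single (m, (0,0,0)) 1 + Poly_Mapping.single ((0,0,0), (0,0,0)) (- mon_coeff N p1 m 0) \<in> Jideal N \<chi>1 \<chi>2"
    and "Poly_Mapping.single ((0,0,0), m) 1 + Poly_Mapping.single ((0,0,0), (0,0,0)) (- mon_coeff N p2 m 0) \<in> Jideal N \<chi>1 \<chi>2"
proof -
  have in_kernel: "Poly_Mapping.single m 1 + Poly_Mapping.single (0,0,0) (- mon_coeff N p m 0) \<in> chi_kernel N \<chi>"
    if "rep_params N \<chi> p" for \<chi> p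
  proof -
    have h1: "chi_hat N \<chi> (Poly_Mapping.single m 1) = mon_coeff N p m 0"
      unfolding chi_hat_single mon_coeff_central[OF N that m] by (simp only: mult_1_left)
    have h2: "chi_hat N \<chi> (Poly_Mapping.single (0,0,0) c) = c" for c
      unfolding chi_hat_single by simp
    have "Poly_Mapping.keys (Poly_Mapping.single m 1 + Poly_Mapping.single (0,0,0) (- mon_coeff N p m 0)) \<subseteq> {m, (0,0,0)}"
      by (rule order_trans[OF Poly_Mapping.keys_add]) simp
    note sub = this
    have "in_center N (Poly_Mapping.single m 1 + Poly_Mapping.single (0,0,0) (- mon_coeff N p m 0))"
      unfolding in_center_def
    proof (intro ballI)
      fix x assume "x \<in> Poly_Mapping.keys (Poly_Mapping.single m 1 + Poly_Mapping.single (0,0,0) (- mon_coeff N p m 0))"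
      hence "x \<in> {m, (0,0,0)}" by (rule subsetD[OF sub])
      thus "int N dvd fst x \<and> int N dvd fst (snd x)" using m by (elim insertE) simp_all
    qed
    moreover have "chi_hat N \<chi> (Poly_Mapping.single m 1 + Poly_Mapping.single (0,0,0) (- mon_coeff N p m 0)) = 0"
      unfolding chi_hat_add h1 h2 by (rule right_minus)
    ultimately show ?thesis unfolding chi_kernel_def by blast
  qed
  have e1: "emb1 (Poly_Mapping.single m 1 + Poly_Mapping.single (0,0,0) c)
      = Poly_Mapping.single (m, (0,0,0)) 1 + Poly_Mapping.single ((0,0,0), (0,0,0)) c" for c
    unfolding emb_add emb_single ..
  have e2: "emb2 (Poly_Mapping.single m 1 + Poly_Mapping.single (0,0,0) c)
      = Poly_Mapping.single ((0,0,0), m) 1 + Poly_Mapping.single ((0,0,0), (0,0,0)) c" for c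
    unfolding emb_add emb_single ..
  have sub: "emb1 ` chi_kernel N \<chi>1 \<union> emb2 ` chi_kernel N \<chi>2 \<subseteq> Jideal N \<chi>1 \<chi>2"
    unfolding Jideal_def by (rule ring.genideal_self[OF ring_Wtensor]) simp
  show "Poly_Mapping.single (m, (0,0,0)) 1 + Poly_Mapping.single ((0,0,0), (0,0,0)) (- mon_coeff N p1 m 0) \<in> Jideal N \<chi>1 \<chi>2"
    unfolding e1[symmetric] using sub in_kernel[OF p(1)] by blast
  show "Poly_Mapping.single ((0,0,0), m) 1 + Poly_Mapping.single ((0,0,0), (0,0,0)) (- mon_coeff N p2 m 0) \<in> Jideal N \<chi>1 \<chi>2"
    unfolding e2[symmetric] using sub in_kernel[OF p(2)] by blast
qed

text \<open>Representatives of monomials modulo central ones; the exponent of z is 0 because z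
  itself is central. Pairs of them number N^4, the dimension of the algebra of N^2 x N^2
  matrices.\<close>

definition reduced :: "nat \<Rightarrow> wmon set" where
  "reduced N = {0..<int N} \<times> {0..<int N} \<times> {0}"

text \<open>Division with remainder writes each monomial as reduced times central. Their product
  carries no twist since the right factor has x-exponent divisible by N, and modulo the ideal the
  central factor is a scalar.\<close>

lemma Jideal_reduce:
  assumes N: "N > 0" and p: "rep_params N \<chi>1 p1" "rep_params N \<chi>2 p2"
  shows "\<exists>v. Poly_Mapping.keys v \<subseteq> reduced N \<times> reduced N \<and> u - v \<in> Jideal N \<chi>1 \<chi>2"
proof (induction u rule: poly_mapping_single_add_induct)
  case (single m c)
  define red cen :: "wmon \<Rightarrow> wmon" where
    "red = (\<lambda>(a, b, c). (a mod int N, b mod int N, 0))" and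
    "cen = (\<lambda>(a, b, c). (int N * (a div int N), int N * (b div int N), c))"
  have rc: "wmon_add (red m) (cen m) = m" for m by (auto simp: red_def cen_def wmon_add_def split: prod.splits)
  have tw: "wtwist N (red m) (cen m') = 1" for m m'
    unfolding wtwist_def primitive_root_powi_eq_1[OF primitive_root_omega[OF N]]
    by (auto simp: cen_def split: prod.splits)
  have cd: "int N dvd fst (cen m)" "int N dvd fst (snd (cen m))" for m
    by (auto simp: cen_def split: prod.splits)
  have red: "red m \<in> reduced N" for m using N by (auto simp: red_def reduced_def split: prod.splits)
  have w0: "wmon_add m (0,0,0) = m" "wtwist N m (0,0,0) = 1" for m by (simp_all add: wmon_add_def wtwist_def)
  obtain m1 m2 where m: "m = (m1, m2)" by (cases m)
  let ?k1 = "mon_coeff N p1 (cen m1) 0" and ?k2 = "mon_coeff N p2 (cen m2) 0"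
  \<comment> \<open>The second tensor factor is reduced before the first; the two elements of the
    ideal telescope through the monomial \<open>(m1, red m2)\<close>.\<close>
  have "tmult N (Poly_Mapping.single (m1, red m2) c)
      (Poly_Mapping.single ((0,0,0), cen m2) 1 + Poly_Mapping.single ((0,0,0), (0,0,0)) (- ?k2))
      \<in> Jideal N \<chi>1 \<chi>2"
    by (intro Jideal_tmult Jideal_central(2)[OF N p cd])
  moreover have "tmult N (Poly_Mapping.single (red m1, red m2) (c * ?k2))
      (Poly_Mapping.single (cen m1, (0,0,0)) 1 + Poly_Mapping.single ((0,0,0), (0,0,0)) (- ?k1))
      \<in> Jideal N \<chi>1 \<chi>2"
    by (intro Jideal_tmult Jideal_central(1)[OF N p cd])
  ultimately have "Poly_Mapping.single (m1, m2) c + Poly_Mapping.single (m1, red m2) (- (c * ?k2))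
      + (Poly_Mapping.single (m1, red m2) (c * ?k2) + Poly_Mapping.single (red m1, red m2) (- (c * ?k2 * ?k1)))
      \<in> Jideal N \<chi>1 \<chi>2"
    using Jideal_add by (fastforce simp: tmult_add_right tmult_single tmon_add_def ttwist_def rc tw w0)
  also have "Poly_Mapping.single (m1, m2) c + Poly_Mapping.single (m1, red m2) (- (c * ?k2))
      + (Poly_Mapping.single (m1, red m2) (c * ?k2) + Poly_Mapping.single (red m1, red m2) (- (c * ?k2 * ?k1)))
      = Poly_Mapping.single m c - Poly_Mapping.single (red m1, red m2) (c * ?k2 * ?k1)"
    by (simp add: m single_uminus)
  finally show ?case
    using red by (intro exI[of _ "Poly_Mapping.single (red m1, red m2) (c * ?k2 * ?k1)"]) auto
next
  case (add u v)
  then obtain u' v' where uv: "Poly_Mapping.keys u' \<subseteq> reduced N \<times> reduced N" "u - u' \<in> Jideal N \<chi>1 \<chi>2"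
    "Poly_Mapping.keys v' \<subseteq> reduced N \<times> reduced N" "v - v' \<in> Jideal N \<chi>1 \<chi>2" by blast
  have "(u + v) - (u' + v') \<in> Jideal N \<chi>1 \<chi>2"
    using Jideal_add[OF uv(2,4)] by (simp add: algebra_simps)
  moreover have "Poly_Mapping.keys (u' + v') \<subseteq> reduced N \<times> reduced N"
    using Poly_Mapping.keys_add[of u' v'] uv(1,3) by blast
  ultimately show ?case by blast
qed

text \<open>The indicator forces the x-exponents to agree; what remains varies with j as omega^(j(b
  - b0)) and sums to 0 unless the y-exponents agree as well. Being reduced turns these congruences
  into equalities.\<close>

lemma fourier_coefficient:
  assumes N: "N > 0" and m: "m \<in> reduced N" and m0: "m0 \<in> reduced N"
  shows "(\<Sum>j<N. omega N powi (- (int j * fst (snd m0))) * mon_coeff N p m (int j - fst m0)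
          * (if (int j - fst m0 + fst m) mod int N = int j then 1 else 0))
       = (if m = m0 then of_nat N * mon_coeff N p m (- fst m0) else 0)"
proof -
  obtain a b where mab: "m = (a, b, 0)" "0 \<le> a" "a < int N" "0 \<le> b" "b < int N"
    using m by (auto simp: reduced_def)
  obtain a0 b0 where mab0: "m0 = (a0, b0, 0)" "0 \<le> a0" "a0 < int N" "0 \<le> b0" "b0 < int N"
    using m0 by (auto simp: reduced_def)
  have close: "x = y" if "int N dvd x - y" "0 \<le> x" "x < int N" "0 \<le> y" "y < int N" for x y
    using that by (metis mod_eq_dvd_iff mod_pos_pos_trivial)
  have iff: "(int j - a0 + a) mod int N = int j \<longleftrightarrow> a = a0" if "j < N" for j
  proof
    assume "(int j - a0 + a) mod int N = int j"
    also have "int j = int j mod int N" using that by simp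
    finally have "int N dvd a - a0" by (simp add: mod_eq_dvd_iff algebra_simps)
    thus "a = a0" using close mab mab0 by blast
  qed (use that in simp)
  show ?thesis
  proof (cases "a = a0")
    case False
    then show ?thesis using iff by (simp add: mab mab0)
  next
    case True
    have e: "omega N powi (- (int j * b0)) * omega N powi (int j * b) = omega N powi (int j * (b - b0))" for j
      using omega_nonzero[of N] by (simp add: algebra_simps flip: power_int_add)
    have "(\<Sum>j<N. omega N powi (- (int j * fst (snd m0))) * mon_coeff N p m (int j - fst m0)
          * (if (int j - fst m0 + fst m) mod int N = int j then 1 else 0))
        = (\<Sum>j<N. mon_coeff N p m (- a0) * (omega N powi (- (int j * b0)) * omega N powi (int j * b)))"
      using iff True by (intro sum.cong) (auto simp: mab mab0 mon_coeff_def)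
    also have "\<dots> = mon_coeff N p m (- a0) * (\<Sum>j<N. omega N powi (int j * (b - b0)))"
      unfolding e by (simp add: sum_distrib_left)
    also have "\<dots> = (if m = m0 then of_nat N * mon_coeff N p m (- fst m0) else 0)"
      using close[of b b0] mab mab0 True by (auto simp: sum_primitive_root[OF primitive_root_omega[OF N]])
    finally show ?thesis .
  qed
qed

text \<open>Fourier inversion in both variables recovers each coefficient of \<open>v\<close>, up to
  a nonzero factor, from the values of its operator on point masses.\<close>

lemma rep_op_reduced_faithful:
  assumes N: "N > 0" and v: "Poly_Mapping.keys v \<subseteq> reduced N \<times> reduced N"
    and z: "\<And>f. f \<in> periodic N \<Longrightarrow> rep_op N p1 p2 v f = 0"
  shows "v = 0"
proof (rule poly_mapping_eqI)
  fix m0 :: tmon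
  show "Poly_Mapping.lookup v m0 = Poly_Mapping.lookup 0 m0"
  proof (cases "m0 \<in> reduced N \<times> reduced N")
    case False
    thus ?thesis using v by (auto simp: in_keys_iff)
  next
    case True
    define t1 where "t1 m j = omega N powi (- (int j * fst (snd (fst m0)))) * mon_coeff N p1 m (int j - fst (fst m0))
          * (if (int j - fst (fst m0) + fst m) mod int N = int j then 1 else 0)" for m j
    define t2 where "t2 m j = omega N powi (- (int j * fst (snd (snd m0)))) * mon_coeff N p2 m (int j - fst (snd m0))
          * (if (int j - fst (snd m0) + fst m) mod int N = int j then 1 else 0)" for m j
    have fin: "finite (reduced N \<times> reduced N)" by (simp add: reduced_def)
    have expand: "omega N powi (- (int j * fst (snd (fst m0)))) * omega N powi (- (int l * fst (snd (snd m0))))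
          * rep_op N p1 p2 v (delta N (int j, int l)) (int j - fst (fst m0), int l - fst (snd m0))
        = (\<Sum>m\<in>reduced N \<times> reduced N. Poly_Mapping.lookup v m * (t1 (fst m) j * t2 (snd m) l))"
      if "j < N" "l < N" for j l
      unfolding rep_op_def
      by (subst pm_sum_superset[OF _ fin v]) (use that in \<open>auto simp: sum_distrib_left t1_def t2_def mon_op_def delta_def intro!: sum.cong\<close>)
    have "0 = (\<Sum>j<N. \<Sum>l<N. \<Sum>m\<in>reduced N \<times> reduced N. Poly_Mapping.lookup v m * (t1 (fst m) j * t2 (snd m) l))"
      using z[OF delta_periodic] by (simp flip: expand)
    also have "\<dots> = (\<Sum>j<N. \<Sum>m\<in>reduced N \<times> reduced N. \<Sum>l<N. Poly_Mapping.lookup v m * (t1 (fst m) j * t2 (snd m) l))"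
      by (intro sum.cong refl) (rule sum.swap)
    also have "\<dots> = (\<Sum>m\<in>reduced N \<times> reduced N. \<Sum>j<N. \<Sum>l<N. Poly_Mapping.lookup v m * (t1 (fst m) j * t2 (snd m) l))"
      by (rule sum.swap)
    also have "\<dots> = (\<Sum>m\<in>reduced N \<times> reduced N. Poly_Mapping.lookup v m * ((\<Sum>j<N. t1 (fst m) j) * (\<Sum>l<N. t2 (snd m) l)))"
      by (simp only: sum_product) (simp only: sum_distrib_left)
    also have "\<dots> = (\<Sum>m\<in>reduced N \<times> reduced N. if m = m0 then Poly_Mapping.lookup v m0 *
          (of_nat N * mon_coeff N p1 (fst m0) (- fst (fst m0)) * (of_nat N * mon_coeff N p2 (snd m0) (- fst (snd m0)))) else 0)"
    proof (intro sum.cong refl)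
      fix m assume m: "m \<in> reduced N \<times> reduced N"
      have e1: "(\<Sum>j<N. t1 (fst m) j) = (if fst m = fst m0 then of_nat N * mon_coeff N p1 (fst m) (- fst (fst m0)) else 0)"
        unfolding t1_def by (rule fourier_coefficient[OF N]) (use m True in auto)
      have e2: "(\<Sum>l<N. t2 (snd m) l) = (if snd m = snd m0 then of_nat N * mon_coeff N p2 (snd m) (- fst (snd m0)) else 0)"
        unfolding t2_def by (rule fourier_coefficient[OF N]) (use m True in auto)
      have "m = m0 \<longleftrightarrow> fst m = fst m0 \<and> snd m = snd m0" by (rule prod_eq_iff)
      thus "Poly_Mapping.lookup v m * ((\<Sum>j<N. t1 (fst m) j) * (\<Sum>l<N. t2 (snd m) l))
          = (if m = m0 then Poly_Mapping.lookup v m0 *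
          (of_nat N * mon_coeff N p1 (fst m0) (- fst (fst m0)) * (of_nat N * mon_coeff N p2 (snd m0) (- fst (snd m0)))) else 0)"
        unfolding e1 e2 by (cases "m = m0") auto
    qed
    also have "\<dots> = Poly_Mapping.lookup v m0 *
          (of_nat N * mon_coeff N p1 (fst m0) (- fst (fst m0)) * (of_nat N * mon_coeff N p2 (snd m0) (- fst (snd m0))))"
      using True fin by simp
    finally show ?thesis using N by (simp add: mon_coeff_def omega_nonzero)
  qed
qed

lemma pi_tensor_kernel:
  assumes N: "N > 0" and p: "rep_params N \<chi>1 p1" "rep_params N \<chi>2 p2"
  shows "a_kernel (Wtensor N) (matring N) (pi_tensor N p1 p2) = Jideal N \<chi>1 \<chi>2"
proof (intro equalityI subsetI)
  fix u assume "u \<in> a_kernel (Wtensor N) (matring N) (pi_tensor N p1 p2)"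
  hence u: "pi_tensor N p1 p2 u = 0\<^sub>m (N * N) (N * N)" by (simp add: a_kernel_def' ring_mat_simps)
  obtain v where v: "Poly_Mapping.keys v \<subseteq> reduced N \<times> reduced N" "u - v \<in> Jideal N \<chi>1 \<chi>2"
    using Jideal_reduce[OF N p] by blast
  have "rep_op N p1 p2 v f = 0" if f: "f \<in> periodic N" for f
  proof -
    have "rep_op N p1 p2 (u - v) f = 0" "rep_op N p1 p2 u f = 0"
      using pi_tensor_Jideal[OF N p v(2)] u f unfolding pi_tensor_eq_0_iff[OF N] by auto
    thus ?thesis by (simp only: rep_op_diff) simp
  qed
  hence "v = 0" by (rule rep_op_reduced_faithful[OF N v(1)])
  thus "u \<in> Jideal N \<chi>1 \<chi>2" using v(2) by simp
next
  fix u assume "u \<in> Jideal N \<chi>1 \<chi>2"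
  thus "u \<in> a_kernel (Wtensor N) (matring N) (pi_tensor N p1 p2)"
    using pi_tensor_Jideal[OF N p] by (simp add: a_kernel_def' ring_mat_simps)
qed

text \<open>The monomials x^a y^b with a = j0 - i0 all read the value at j0 from i0. A Fourier sum
  over b of such monomials restricts the result to the residue class of i0; the same is done in the
  second variable.\<close>

lemma rep_op_matrix_unit:
  assumes N: "N > 0"
  shows "\<exists>u. \<forall>f\<in>periodic N. rep_op N p1 p2 u f = fscale (t * f (j0, l0)) (delta N (i0, k0))"
proof -
  let ?a = "j0 - i0" and ?a' = "l0 - k0"
  \<comment> \<open>Dividing by the value of \<open>mon_coeff\<close> at minus the shift cancels the
    parameters of the representation only, because the phase is 1 at that point.\<close>
  define s1 where "s1 b = omega N powi (- (j0 * int b)) / (of_nat N * mon_coeff N p1 (?a, int b, 0) (- ?a))" for b :: nat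
  define s2 where "s2 b = omega N powi (- (l0 * int b)) / (of_nat N * mon_coeff N p2 (?a', int b, 0) (- ?a'))" for b :: nat
  define u :: telem where "u = (\<Sum>b<N. \<Sum>b'<N. Poly_Mapping.single ((?a, int b, 0), (?a', int b', 0)) (t * s1 b * s2 b'))"
  have s: "(\<Sum>b<N. omega N powi (- (x * int b)) / (of_nat N * mon_coeff N p (a, int b, 0) (- a)) * mon_coeff N p (a, int b, 0) y)
      = (if (y + a) mod int N = x mod int N then 1 else 0)" for x y a p
  proof -
    have "omega N powi (- (x * int b)) / (of_nat N * mon_coeff N p (a, int b, 0) (- a)) * mon_coeff N p (a, int b, 0) y
        = omega N powi (int b * (y + a - x)) / of_nat N" for b
    proof -
      have "omega N powi (- (x * int b)) * omega N powi ((y + a) * int b) = omega N powi (int b * (y + a - x))"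
        using omega_nonzero[of N] by (simp add: algebra_simps flip: power_int_add)
      thus ?thesis using N by (simp add: mon_coeff_def omega_nonzero field_simps)
    qed
    thus ?thesis using N
      by (simp add: sum_primitive_root[OF primitive_root_omega[OF N]] mod_eq_dvd_iff flip: sum_divide_distrib)
  qed
  have "rep_op N p1 p2 u f = fscale (t * f (j0, l0)) (delta N (i0, k0))" if f: "f \<in> periodic N" for f
  proof
    fix x :: "int \<times> int"
    obtain i k where x: "x = (i, k)" by (cases x)
    have "rep_op N p1 p2 u f x = (\<Sum>b<N. \<Sum>b'<N. (s1 b * mon_coeff N p1 (?a, int b, 0) i)
        * (s2 b' * mon_coeff N p2 (?a', int b', 0) k) * (t * f (i + ?a, k + ?a')))"
      unfolding u_def rep_op_sum sum_fun_apply rep_op_single fscale_apply by (simp add: x mon_op_def mult_ac)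
    also have "\<dots> = (\<Sum>b<N. s1 b * mon_coeff N p1 (?a, int b, 0) i) * (\<Sum>b'<N. s2 b' * mon_coeff N p2 (?a', int b', 0) k)
        * (t * f (i + ?a, k + ?a'))"
      by (simp only: sum_product) (simp only: sum_distrib_right)
    also have "\<dots> = (if (i + ?a) mod int N = j0 mod int N then 1 else 0) * (if (k + ?a') mod int N = l0 mod int N then 1 else 0)
        * (t * f (i + ?a, k + ?a'))"
      unfolding s1_def s2_def s ..
    also have "\<dots> = t * f (j0, l0) * delta N (i0, k0) x"
    proof -
      have "(i + ?a) mod int N = j0 mod int N \<longleftrightarrow> i mod int N = i0 mod int N"
        "(k + ?a') mod int N = l0 mod int N \<longleftrightarrow> k mod int N = k0 mod int N"
        by (simp_all add: mod_eq_dvd_iff)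
      thus ?thesis using periodicD[OF f, of "i + ?a" j0 "k + ?a'" l0] by (simp add: delta_def x)
    qed
    finally show "rep_op N p1 p2 u f x = fscale (t * f (j0, l0)) (delta N (i0, k0)) x" by simp
  qed
  thus ?thesis by blast
qed

lemma pi_tensor_surj:
  assumes N: "N > 0" and M: "M \<in> carrier_mat (N * N) (N * N)"
  shows "\<exists>u. pi_tensor N p1 p2 u = M"
proof -
  have "\<exists>u. \<forall>f\<in>periodic N. rep_op N p1 p2 u f = fscale (M $$ (r, c) * f (point N c)) (delta N (point N r))" for r c
    using rep_op_matrix_unit[OF N, of p1 p2 "M $$ (r, c)"] by (metis surj_pair)
  then obtain e where e: "\<And>r c f. f \<in> periodic N \<Longrightarrow>
      rep_op N p1 p2 (e r c) f = fscale (M $$ (r, c) * f (point N c)) (delta N (point N r))" by metis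
  define u where "u = (\<Sum>r<N * N. \<Sum>c<N * N. e r c)"
  have "pi_tensor N p1 p2 u = M"
  proof (rule eq_matI)
    fix r c assume "r < dim_row M" "c < dim_col M"
    hence rc: "r < N * N" "c < N * N" using M by auto
    have "pi_tensor N p1 p2 u $$ (r, c) = (\<Sum>r'<N * N. \<Sum>c'<N * N.
        M $$ (r', c') * delta N (point N c) (point N c') * delta N (point N r') (point N r))"
      using rc unfolding pi_tensor_eq u_def
      by (simp only: op_mat_index rep_op_sum sum_fun_apply e[OF delta_periodic] fscale_apply)
    also have "\<dots> = (\<Sum>r'<N * N. \<Sum>c'<N * N. if c' = c then (if r = r' then M $$ (r', c') else 0) else 0)"
      using rc by (intro sum.cong refl) (simp add: delta_point)
    also have "\<dots> = M $$ (r, c)" using rc by simp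
    finally show "pi_tensor N p1 p2 u $$ (r, c) = M $$ (r, c)" .
  qed (use M in \<open>simp_all add: pi_tensor_eq\<close>)
  thus ?thesis ..
qed

lemma cls_eq:
  assumes N: "N > 0" and p: "rep_params N \<chi>1 p1" "rep_params N \<chi>2 p2"
  shows "cls N \<chi>1 \<chi>2 u = {v. pi_tensor N p1 p2 v = pi_tensor N p1 p2 u}"
  using ring_hom_ring.rcos_eq_homeq[OF pi_tensor_ring_hom[OF N], of u p1 p2]
  by (simp add: cls_def pi_tensor_kernel[OF N p])

lemma pi_quot_cls:
  assumes N: "N > 0" and p: "rep_params N \<chi>1 p1" "rep_params N \<chi>2 p2"
  shows "pi_quot N p1 p2 (cls N \<chi>1 \<chi>2 u) = pi_tensor N p1 p2 u"
  unfolding pi_quot_def cls_eq[OF N p] by (rule someI2[of _ u]) simp_all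

lemma carrier_Qalg: "carrier (Qalg N \<chi>1 \<chi>2) = range (cls N \<chi>1 \<chi>2)"
  by (auto simp: Qalg_def FactRing_def A_RCOSETS_def' cls_def)

text \<open>The first isomorphism theorem yields the map taking a class to the unique element of its
  image. It agrees with \<open>pi_quot\<close> because classes are fibres of
  \<open>pi_tensor\<close>, so the chosen representative does not matter.\<close>

lemma pi_quot_iso:
  assumes N: "N > 0" and p: "rep_params N \<chi>1 p1" "rep_params N \<chi>2 p2"
  shows "pi_quot N p1 p2 \<in> ring_iso (Qalg N \<chi>1 \<chi>2) (matring N)"
proof -
  have "pi_tensor N p1 p2 ` carrier (Wtensor N) = carrier (matring N)"
  proof
    show "pi_tensor N p1 p2 ` carrier (Wtensor N) \<subseteq> carrier (matring N)"
      by (auto simp: ring_mat_simps)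
    show "carrier (matring N) \<subseteq> pi_tensor N p1 p2 ` carrier (Wtensor N)"
    proof
      fix M assume "M \<in> carrier (matring N)"
      then obtain u where "pi_tensor N p1 p2 u = M"
        using pi_tensor_surj[OF N, of M p1 p2] by (auto simp: ring_mat_simps)
      thus "M \<in> pi_tensor N p1 p2 ` carrier (Wtensor N)" by auto
    qed
  qed
  from ring_hom_ring.FactRing_iso_set[OF pi_tensor_ring_hom[OF N] this]
  have iso: "(\<lambda>X. the_elem (pi_tensor N p1 p2 ` X)) \<in> ring_iso (Qalg N \<chi>1 \<chi>2) (matring N)"
    unfolding Qalg_def pi_tensor_kernel[OF N p] .
  have Q: "ring (Qalg N \<chi>1 \<chi>2)" unfolding Qalg_def by (rule ideal.quotient_is_ring[OF ideal_Jideal])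
  show ?thesis
  proof (rule ring.ring_iso_restrict[OF Q iso])
    fix c assume "c \<in> carrier (Qalg N \<chi>1 \<chi>2)"
    then obtain u where c: "c = cls N \<chi>1 \<chi>2 u" by (auto simp: carrier_Qalg)
    have "pi_tensor N p1 p2 ` c = {pi_tensor N p1 p2 u}" unfolding c cls_eq[OF N p] by auto
    thus "the_elem (pi_tensor N p1 p2 ` c) = pi_quot N p1 p2 c" by (simp add: c pi_quot_cls[OF N p])
  qed
qed

section \<open>The images of the generators under the braiding\<close>

lemma rep_op_tm_apply:
  "rep_op N p1 p2 (tm a1 b1 c1 a2 b2 c2) f (i, k)
   = mon_coeff N p1 (a1, b1, c1) i * mon_coeff N p2 (a2, b2, c2) k * f (i + a1, k + a2)"
  by (simp add: rep_op_tm mon_op_def)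

lemma mon_coeff_simps:
  "mon_coeff N p (0, 0, 0) i = 1"
  "mon_coeff N p (0, 0, 1) i = omega_pow N (snd (snd p))"
  "mon_coeff N p (0, 0, -1) i = inverse (omega_pow N (snd (snd p)))"
  "mon_coeff N p (1, 0, 0) i = omega_pow N (fst p)"
  "mon_coeff N p (-1, 0, 0) i = inverse (omega_pow N (fst p))"
  "mon_coeff N p (0, 1, 0) i = omega_pow N (fst (snd p)) * omega N powi i"
  "mon_coeff N p (0, -1, 0) i = inverse (omega_pow N (fst (snd p))) * inverse (omega N powi i)"
  by (simp_all add: mon_coeff_def power_int_minus)

lemmas rep_op_simps = rep_op_tmult rep_op_add rep_op_diff rep_op_one plus_fun_apply minus_apply
  rep_op_tm_apply mon_coeff_simps

text \<open>\<open>p1\<close> and \<open>p2\<close> are to be the parameters of the target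
  representations, where the images of the generators act.\<close>

locale rw_rep =
  fixes N :: nat and p1 p2 :: "complex \<times> complex \<times> complex"
  assumes N: "N > 0"
begin

abbreviation "A1 \<equiv> omega_pow N (fst p1)"
abbreviation "B1 \<equiv> omega_pow N (fst (snd p1))"
abbreviation "Z1 \<equiv> omega_pow N (snd (snd p1))"
abbreviation "A2 \<equiv> omega_pow N (fst p2)"
abbreviation "B2 \<equiv> omega_pow N (fst (snd p2))"
abbreviation "Z2 \<equiv> omega_pow N (snd (snd p2))"
abbreviation "w \<equiv> omega N"

abbreviation "X \<equiv> rep_op N p1 p2 (RW_x1 N)"
abbreviation "U \<equiv> rep_op N p1 p2 (RW_y1inv N)"
abbreviation "V \<equiv> rep_op N p1 p2 (RW_y2 N)"
abbreviation "S \<equiv> rep_op N p1 p2 (tm 1 0 0 1 0 0)"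

lemma V_apply: "V f (i, k) = Z1 / Z2 * B1 * w powi i * f (i, k) + (B2 * w powi k - B1 * w powi i / Z2) * A1 * f (i + 1, k)"
  unfolding RW_y2_def Let_def Wtensor_simps Wtensor_minus
  by (simp only: rep_op_simps) (simp add: field_simps)

lemma U_apply: "U f (i, k) = f (i, k) / (B2 * w powi k) + (1 / (B1 * w powi i) - 1 / (Z2 * B2 * w powi k)) * f (i, k - 1) / A2"
  unfolding RW_y1inv_def Let_def Wtensor_simps Wtensor_minus
  by (simp only: rep_op_simps) (simp add: field_simps omega_nonzero)

lemma powi_succ: "w powi (i + 1) = w * w powi i" "w powi (i - 1) = w powi i / w"
  using omega_nonzero[of N] by (simp_all add: power_int_add power_int_diff)

lemma X_apply: "X f (i, k) = A1 * f (i + 1, k) + (B1 * w powi i / (B2 * w powi k)) *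
    ((A1 * A2 * f (i + 1, k + 1) - A1 / Z2 * f (i + 1, k)) - (Z1 * A2 * f (i, k + 1) - Z1 / Z2 * f (i, k)))"
proof -
  have "X f (i, k) = A1 * (f (i + 1, k) - inverse A1 * (B1 * w powi i * (Z1 * (inverse B2 * inverse (w powi k) * (A2 * f (i, k + 1) - inverse Z2 * f (i, k)))
      - A1 * (inverse B2 * inverse (w powi k) * (A2 * f (i + 1, k + 1) - inverse Z2 * f (i + 1, k))))))"
    unfolding RW_x1_def RW_g_def Let_def Wtensor_simps Wtensor_minus
    by (simp only: rep_op_simps) simp
  also have "\<dots> = A1 * f (i + 1, k) + (B1 * w powi i / (B2 * w powi k)) *
    ((A1 * A2 * f (i + 1, k + 1) - A1 / Z2 * f (i + 1, k)) - (Z1 * A2 * f (i, k + 1) - Z1 / Z2 * f (i, k)))"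
    by (simp add: field_simps omega_nonzero)
  finally show ?thesis .
qed

lemma S_apply: "S f (i, k) = A1 * A2 * f (i + 1, k + 1)"
  by (simp only: rep_op_simps)

lemma idx: "i + 1 - 1 = i" "i - 1 + 1 = i" for i :: int by simp_all

text \<open>This and the next five lemmas transfer the relations among x1, x1 x2, y1^-1 and y2 to
  their images. Each is an identity between coefficients of shifted values of f at one point, so no
  periodicity of f is involved.\<close>

lemma US: "U (S f) = fscale w (S (U f))"
  by (rule ext, clarify, simp only: fscale_apply U_apply S_apply powi_succ idx) (simp add: field_simps omega_nonzero)

lemma VS: "V (S f) = fscale (inverse w) (S (V f))"
  by (rule ext, clarify, simp only: fscale_apply V_apply S_apply powi_succ idx) (simp add: field_simps omega_nonzero)

lemma XS: "X (S f) = S (X f)"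
  by (rule ext, clarify, simp only: X_apply S_apply powi_succ idx) (simp add: field_simps omega_nonzero)

lemma UV: "U (V f) = V (U f)"
  by (rule ext, clarify, simp only: U_apply V_apply powi_succ idx) (simp add: field_simps omega_nonzero)

lemma UX: "U (X f) = fscale w (X (U f))"
  by (rule ext, clarify, simp only: fscale_apply U_apply X_apply powi_succ idx) (simp add: field_simps omega_nonzero)

lemma VX: "V (X f) = X (V f)"
  by (rule ext, clarify, simp only: V_apply X_apply powi_succ idx) (simp add: field_simps omega_nonzero)

end

section \<open>N-th powers of monomials and of the images of the generators\<close>

lemma xi_pow: "N > 0 \<Longrightarrow> xi N ^ N = - 1"
  unfolding xi_def by (subst exp_of_nat_mult[symmetric]) simp

lemma xi_nonzero: "xi N \<noteq> 0"
  by (simp add: xi_def)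

lemma omega_powi_xi: "omega N powi k = xi N powi (2 * k)"
  by (simp add: omega_def power_int_mult)

text \<open>Normal ordering of n equal monomials costs omega^(-e n(n-1)/2) with e = a1 b1 + a2 b2.
  Writing it with \<open>xi\<close>, whose square is omega, avoids the halving.\<close>

lemma mon_op_funpow:
  "((\<lambda>f. fscale c (mon_op N p1 p2 ((a1, b1, c1), (a2, b2, c2)) f)) ^^ n) f
   = fscale (c ^ n * xi N powi (- ((a1 * b1 + a2 * b2) * int n * (int n - 1))))
      (mon_op N p1 p2 ((int n * a1, int n * b1, int n * c1), (int n * a2, int n * b2, int n * c2)) f)"
proof (induction n)
  case 0
  show ?case by (simp add: mon_op_def mon_coeff_def fun_eq_iff)
next
  case (Suc n)
  let ?m = "((a1, b1, c1), (a2, b2, c2))"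
  let ?n = "((int n * a1, int n * b1, int n * c1), (int n * a2, int n * b2, int n * c2))"
  let ?e = "a1 * b1 + a2 * b2"
  have "ttwist N ?m ?n = omega N powi (- (?e * int n))"
    unfolding ttwist_def wtwist_def using omega_nonzero[of N]
    by (simp add: algebra_simps flip: power_int_add)
  also have "\<dots> = xi N powi (2 * (- (?e * int n)))" by (rule omega_powi_xi)
  finally have tw: "ttwist N ?m ?n = xi N powi (2 * (- (?e * int n)))" .
  have add: "tmon_add ?m ?n = ((int (Suc n) * a1, int (Suc n) * b1, int (Suc n) * c1), (int (Suc n) * a2, int (Suc n) * b2, int (Suc n) * c2))"
    by (simp add: tmon_add_def wmon_add_def algebra_simps)
  have "xi N powi (- (?e * int n * (int n - 1))) * xi N powi (2 * (- (?e * int n)))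
      = xi N powi (- (?e * int n * (int n - 1)) + 2 * (- (?e * int n)))"
    by (rule power_int_add[symmetric]) (simp add: xi_nonzero)
  also have "- (?e * int n * (int n - 1)) + 2 * (- (?e * int n)) = - (?e * int (Suc n) * (int (Suc n) - 1))"
    by (simp add: algebra_simps)
  finally have pw: "xi N powi (- (?e * int n * (int n - 1))) * ttwist N ?m ?n
      = xi N powi (- (?e * int (Suc n) * (int (Suc n) - 1)))" unfolding tw .
  have "((\<lambda>f. fscale c (mon_op N p1 p2 ?m f)) ^^ Suc n) f
      = fscale (c * (c ^ n * xi N powi (- (?e * int n * (int n - 1))) * ttwist N ?m ?n)) (mon_op N p1 p2 (tmon_add ?m ?n) f)"
    unfolding funpow.simps comp_apply Suc fs.lin_scale[OF lin_mon_op] mon_op_mult fs.scale_scale ..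
  also have "c * (c ^ n * xi N powi (- (?e * int n * (int n - 1))) * ttwist N ?m ?n)
      = c ^ Suc n * xi N powi (- (?e * int (Suc n) * (int (Suc n) - 1)))"
    unfolding pw[symmetric] by simp
  finally show ?case unfolding add .
qed

definition central_value :: "nat \<Rightarrow> complex \<times> complex \<times> complex \<Rightarrow> wmon \<Rightarrow> complex" where
  "central_value N p m = (omega_pow N (fst p) ^ N) powi fst m * (omega_pow N (fst (snd p)) ^ N) powi fst (snd m)
     * (omega_pow N (snd (snd p)) ^ N) powi snd (snd m)"

lemma mon_coeff_multiple:
  assumes N: "N > 0"
  shows "mon_coeff N p (int N * a, int N * b, int N * c) i = central_value N p (a, b, c)"
proof -
  have "omega N powi ((i + int N * a) * (int N * b)) = 1"
    using primitive_root_powi_eq_1[OF primitive_root_omega[OF N]] by simp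
  thus ?thesis by (simp add: mon_coeff_def central_value_def power_int_mult)
qed

lemma mon_op_multiple:
  assumes N: "N > 0" and f: "f \<in> periodic N"
  shows "mon_op N p1 p2 ((int N * a1, int N * b1, int N * c1), (int N * a2, int N * b2, int N * c2)) f
       = fscale (central_value N p1 (a1, b1, c1) * central_value N p2 (a2, b2, c2)) f"
proof
  fix x :: "int \<times> int"
  obtain i k where x: "x = (i, k)" by (cases x)
  have "f (i + int N * a1, k + int N * a2) = f (i, k)" by (rule periodicD[OF f]) simp_all
  thus "mon_op N p1 p2 ((int N * a1, int N * b1, int N * c1), (int N * a2, int N * b2, int N * c2)) f x
       = fscale (central_value N p1 (a1, b1, c1) * central_value N p2 (a2, b2, c2)) f x"
    by (simp add: x mon_op_def mon_coeff_multiple[OF N])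
qed

lemma xi_powi:
  assumes "N > 0"
  shows "xi N powi (- (e * int N * (int N - 1))) = (- 1) powi (- (e * (int N - 1)))"
proof -
  have "xi N powi (- (e * int N * (int N - 1))) = xi N powi (int N * (- (e * (int N - 1))))"
    by (simp add: algebra_simps)
  also have "\<dots> = (xi N ^ N) powi (- (e * (int N - 1)))"
    by (simp only: power_int_mult power_int_of_nat)
  finally show ?thesis unfolding xi_pow[OF assms] .
qed

lemma monomial_pow_commuting:
  assumes N: "N > 0" and f: "f \<in> periodic N" and e: "a1 * b1 + a2 * b2 = 0"
  shows "((\<lambda>f. fscale c (mon_op N p1 p2 ((a1, b1, c1), (a2, b2, c2)) f)) ^^ N) f
       = fscale (c ^ N * (central_value N p1 (a1, b1, c1) * central_value N p2 (a2, b2, c2))) f"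
  unfolding mon_op_funpow xi_powi[OF N] mon_op_multiple[OF N f] e fs.scale_scale by simp

text \<open>Since xi^N = -1, normal ordering contributes (-1)^(N-1), and \<open>c\<close>
  contributes (-1)^N. The product is -1 for either parity of N, so the resulting parameter formulas
  do not depend on it.\<close>

lemma monomial_pow_twisted:
  assumes N: "N > 0" and f: "f \<in> periodic N" and e: "a1 * b1 + a2 * b2 = 1 \<or> a1 * b1 + a2 * b2 = - 1"
    and c: "c ^ N = (- 1) ^ N"
  shows "((\<lambda>f. fscale c (mon_op N p1 p2 ((a1, b1, c1), (a2, b2, c2)) f)) ^^ N) f
       = fscale (- (central_value N p1 (a1, b1, c1) * central_value N p2 (a2, b2, c2))) f"
proof -
  obtain n where n: "N = Suc n" using N by (cases N) auto
  have "inverse ((- 1) ^ n) = ((- 1) ^ n :: complex)" by (simp flip: power_inverse)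
  hence "(- 1 :: complex) powi (- ((a1 * b1 + a2 * b2) * (int N - 1))) = (- 1) ^ n"
    using e by (elim disjE) (simp_all add: n power_int_minus)
  hence "c ^ N * (- 1) powi (- ((a1 * b1 + a2 * b2) * (int N - 1))) = - 1"
    unfolding c by (simp add: n flip: power_mult_distrib)
  thus ?thesis
    unfolding mon_op_funpow xi_powi[OF N] mon_op_multiple[OF N f] fs.scale_scale
    by (simp only: mult_minus1)
qed

lemma mon_op_q_commute:
  "mon_op N p1 p2 ((a1, b1, c1), (a2, b2, c2)) (mon_op N p1 p2 ((r1, s1, t1), (r2, s2, t2)) f)
   = fscale (omega N powi (s1 * a1 - b1 * r1 + (s2 * a2 - b2 * r2)))
      (mon_op N p1 p2 ((r1, s1, t1), (r2, s2, t2)) (mon_op N p1 p2 ((a1, b1, c1), (a2, b2, c2)) f))"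
proof -
  have "tmon_add ((a1, b1, c1), (a2, b2, c2)) ((r1, s1, t1), (r2, s2, t2))
      = tmon_add ((r1, s1, t1), (r2, s2, t2)) ((a1, b1, c1), (a2, b2, c2))"
    by (simp add: tmon_add_def wmon_add_def)
  moreover have "ttwist N ((a1, b1, c1), (a2, b2, c2)) ((r1, s1, t1), (r2, s2, t2))
      = omega N powi (s1 * a1 - b1 * r1 + (s2 * a2 - b2 * r2))
        * ttwist N ((r1, s1, t1), (r2, s2, t2)) ((a1, b1, c1), (a2, b2, c2))"
    unfolding ttwist_def wtwist_def using omega_nonzero[of N]
    by (simp add: algebra_simps flip: power_int_add)
  ultimately show ?thesis unfolding mon_op_mult fs.scale_scale by simp
qed

lemma lin_monomial: "fs.lin (\<lambda>f. fscale c (mon_op N p1 p2 m f))"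
  by (rule fs.linI)
    (simp_all only: fs.lin_add[OF lin_mon_op] fs.lin_scale[OF lin_mon_op] fs.scale_right_distrib fs.scale_scale mult.commute)

lemma lin_plus: "fs.lin S \<Longrightarrow> fs.lin T \<Longrightarrow> fs.lin (\<lambda>f. S f + T f)"
  by (rule fs.linI) (simp_all only: fs.lin_add fs.lin_scale fs.scale_right_distrib add_ac)

lemma monomial_q_commute:
  assumes "s1 * a1 - b1 * r1 + (s2 * a2 - b2 * r2) = s"
  shows "fscale c (mon_op N p1 p2 ((a1, b1, c1), (a2, b2, c2)) (fscale d (mon_op N p1 p2 ((r1, s1, t1), (r2, s2, t2)) f)))
   = fscale (omega N powi s)
      (fscale d (mon_op N p1 p2 ((r1, s1, t1), (r2, s2, t2)) (fscale c (mon_op N p1 p2 ((a1, b1, c1), (a2, b2, c2)) f))))"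
proof -
  have "mon_op N p1 p2 ((a1, b1, c1), (a2, b2, c2)) (mon_op N p1 p2 ((r1, s1, t1), (r2, s2, t2)) f)
      = fscale (omega N powi s) (mon_op N p1 p2 ((r1, s1, t1), (r2, s2, t2)) (mon_op N p1 p2 ((a1, b1, c1), (a2, b2, c2)) f))"
    unfolding assms[symmetric] by (rule mon_op_q_commute)
  thus ?thesis by (simp only: fs.lin_scale[OF lin_mon_op] fs.scale_scale mult_ac)
qed

context rw_rep
begin

abbreviation weyl_mono :: "complex \<Rightarrow> tmon \<Rightarrow> func \<Rightarrow> func" where
  "weyl_mono c m \<equiv> (\<lambda>f. fscale c (mon_op N p1 p2 m f))"

lemma prim: "primitive_root w N" "primitive_root (inverse w) N"
  using primitive_root_omega[OF N] primitive_root_inverse by blast+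

lemma w_pow: "w ^ N = 1" "inverse w ^ N = 1"
  using primitive_root_pow prim by blast+

abbreviation "\<alpha>1 \<equiv> A1 ^ N"
abbreviation "\<beta>1 \<equiv> B1 ^ N"
abbreviation "\<mu>1 \<equiv> Z1 ^ N"
abbreviation "\<alpha>2 \<equiv> A2 ^ N"
abbreviation "\<beta>2 \<equiv> B2 ^ N"
abbreviation "\<mu>2 \<equiv> Z2 ^ N"

text \<open>Both orientations of q-commutation are allowed because w and its inverse are both
  primitive; sums can be split in the order in which they are written.\<close>

lemma pow_sum:
  assumes "fs.lin P" "fs.lin Q" and q: "\<And>f. P (Q f) = fscale (w powi s) (Q (P f))" "s = 1 \<or> s = - 1"
  shows "((\<lambda>f. P f + Q f) ^^ N) f = (P ^^ N) f + (Q ^^ N) f"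
  using q(2)
proof
  assume "s = 1"
  thus ?thesis using fs.q_binomial_primitive_root[OF prim(1) assms(1,2)] q(1) by simp
next
  assume "s = - 1"
  thus ?thesis using fs.q_binomial_primitive_root[OF prim(2) assms(1,2)] q(1) by (simp add: power_int_minus)
qed

lemma powi_one_minus: "w powi (1 - i) = w / w powi i"
  using omega_nonzero[of N] by (simp add: power_int_diff)

text \<open>Here and in the next two lemmas the coefficients come from normal ordering: y1 x1 = w^-1
  x1 y1, y2^-1 x2^-1 = w^-1 x2^-1 y2^-1 and y2^-1 x2 = w x2 y2^-1. The last and the first cancel in
  the monomial of \<open>X\<close> containing both x1 and x2.\<close>

lemma V_monomials: "V = (\<lambda>f. weyl_mono 1 ((0,1,1),(0,0,-1)) f + (weyl_mono 1 ((1,0,0),(0,1,0)) f + weyl_mono (- inverse w) ((1,1,0),(0,0,-1)) f))"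
  by (rule ext, rule ext, clarify, simp only: V_apply plus_fun_apply fscale_apply mon_op_def)
    (simp add: mon_coeff_def power_int_minus powi_succ powi_one_minus field_simps omega_nonzero)

lemma U_monomials: "U = (\<lambda>f. weyl_mono 1 ((0,0,0),(0,-1,0)) f + (weyl_mono 1 ((0,-1,0),(-1,0,0)) f + weyl_mono (- inverse w) ((0,0,0),(-1,-1,-1)) f))"
  by (rule ext, rule ext, clarify, simp only: U_apply plus_fun_apply fscale_apply mon_op_def)
    (simp add: mon_coeff_def power_int_minus powi_succ powi_one_minus field_simps omega_nonzero)

lemma X_monomials: "X = (\<lambda>f. weyl_mono 1 ((1,0,0),(0,0,0)) f +
    ((weyl_mono (- w) ((0,1,1),(1,-1,0)) f + weyl_mono 1 ((0,1,1),(0,-1,-1)) f)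
     + (weyl_mono 1 ((1,1,0),(1,-1,0)) f + weyl_mono (- inverse w) ((1,1,0),(0,-1,-1)) f)))"
  by (rule ext, rule ext, clarify, simp only: X_apply plus_fun_apply fscale_apply mon_op_def)
    (simp add: mon_coeff_def power_int_minus powi_succ powi_one_minus field_simps omega_nonzero)

lemma neg_pow: "(- w) ^ N = (- 1) ^ N" "(- inverse w) ^ N = (- 1) ^ N"
  using w_pow by (simp_all add: power_minus[of w] power_minus[of "inverse w"])

text \<open>The first monomial q-commutes with the other two by the same power of w, and these
  q-commute with each other, so the power formula applies twice. The same grouping serves for
  \<open>U_pow\<close>.\<close>

lemma V_pow:
  assumes f: "f \<in> periodic N"
  shows "(V ^^ N) f = fscale (\<beta>1 * \<mu>1 / \<mu>2 + (\<alpha>1 * \<beta>2 - \<alpha>1 * \<beta>1 / \<mu>2)) f"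
proof -
  let ?T1 = "weyl_mono 1 ((0,1,1),(0,0,-1))" and ?T2 = "weyl_mono 1 ((1,0,0),(0,1,0))"
    and ?T3 = "weyl_mono (- inverse w) ((1,1,0),(0,0,-1))"
  have "(V ^^ N) f = (?T1 ^^ N) f + ((\<lambda>f. ?T2 f + ?T3 f) ^^ N) f"
    unfolding V_monomials
  proof (rule pow_sum[where s = "-1" and P = ?T1 and Q = "\<lambda>f. ?T2 f + ?T3 f"])
    fix f
    show "?T1 (?T2 f + ?T3 f) = fscale (w powi (- 1)) (?T2 (?T1 f) + ?T3 (?T1 f))"
      unfolding fs.lin_add[OF lin_monomial] fs.scale_right_distrib
      by (intro arg_cong2[where f = "(+)"] monomial_q_commute) simp_all
  qed (intro lin_plus lin_monomial | simp)+
  also have "((\<lambda>f. ?T2 f + ?T3 f) ^^ N) f = (?T2 ^^ N) f + (?T3 ^^ N) f"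
    by (rule pow_sum[where s = 1 and P = ?T2 and Q = ?T3, OF lin_monomial lin_monomial monomial_q_commute]) simp_all
  also have "(?T1 ^^ N) f = fscale (1 ^ N * (central_value N p1 (0,1,1) * central_value N p2 (0,0,-1))) f"
    by (rule monomial_pow_commuting[OF N f]) simp
  also have "(?T2 ^^ N) f = fscale (1 ^ N * (central_value N p1 (1,0,0) * central_value N p2 (0,1,0))) f"
    by (rule monomial_pow_commuting[OF N f]) simp
  also have "(?T3 ^^ N) f = fscale (- (central_value N p1 (1,1,0) * central_value N p2 (0,0,-1))) f"
    by (rule monomial_pow_twisted[OF N f _ neg_pow(2)]) simp
  finally show ?thesis
    unfolding fs.scale_left_distrib[symmetric]
    by (rule trans) (rule arg_cong[where f = "\<lambda>c. fscale c f"], simp add: central_value_def field_simps power_int_minus)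
qed

lemma U_pow:
  assumes f: "f \<in> periodic N"
  shows "(U ^^ N) f = fscale (1 / \<beta>2 + (1 / (\<beta>1 * \<alpha>2) - 1 / (\<mu>2 * \<beta>2 * \<alpha>2))) f"
proof -
  let ?T1 = "weyl_mono 1 ((0,0,0),(0,-1,0))" and ?T2 = "weyl_mono 1 ((0,-1,0),(-1,0,0))"
    and ?T3 = "weyl_mono (- inverse w) ((0,0,0),(-1,-1,-1))"
  have "(U ^^ N) f = (?T1 ^^ N) f + ((\<lambda>f. ?T2 f + ?T3 f) ^^ N) f"
    unfolding U_monomials
  proof (rule pow_sum[where s = "-1" and P = ?T1 and Q = "\<lambda>f. ?T2 f + ?T3 f"])
    fix f
    show "?T1 (?T2 f + ?T3 f) = fscale (w powi (- 1)) (?T2 (?T1 f) + ?T3 (?T1 f))"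
      unfolding fs.lin_add[OF lin_monomial] fs.scale_right_distrib
      by (intro arg_cong2[where f = "(+)"] monomial_q_commute) simp_all
  qed (intro lin_plus lin_monomial | simp)+
  also have "((\<lambda>f. ?T2 f + ?T3 f) ^^ N) f = (?T2 ^^ N) f + (?T3 ^^ N) f"
    by (rule pow_sum[where s = 1 and P = ?T2 and Q = ?T3, OF lin_monomial lin_monomial monomial_q_commute]) simp_all
  also have "(?T1 ^^ N) f = fscale (1 ^ N * (central_value N p1 (0,0,0) * central_value N p2 (0,-1,0))) f"
    by (rule monomial_pow_commuting[OF N f]) simp
  also have "(?T2 ^^ N) f = fscale (1 ^ N * (central_value N p1 (0,-1,0) * central_value N p2 (-1,0,0))) f"
    by (rule monomial_pow_commuting[OF N f]) simp
  also have "(?T3 ^^ N) f = fscale (- (central_value N p1 (0,0,0) * central_value N p2 (-1,-1,-1))) f"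
    by (rule monomial_pow_twisted[OF N f _ neg_pow(2)]) simp
  finally show ?thesis
    unfolding fs.scale_left_distrib[symmetric]
    by (rule trans) (rule arg_cong[where f = "\<lambda>c. fscale c f"], simp add: central_value_def field_simps power_int_minus)
qed

lemma X_pow:
  assumes f: "f \<in> periodic N"
  shows "(X ^^ N) f = fscale (\<alpha>1 + \<beta>1 / \<beta>2 * (\<mu>1 / \<mu>2 - \<mu>1 * \<alpha>2 + (\<alpha>1 * \<alpha>2 - \<alpha>1 / \<mu>2))) f"
proof -
  let ?T1 = "weyl_mono 1 ((1,0,0),(0,0,0))" and ?T2 = "weyl_mono (- w) ((0,1,1),(1,-1,0))"
    and ?T3 = "weyl_mono 1 ((0,1,1),(0,-1,-1))" and ?T4 = "weyl_mono 1 ((1,1,0),(1,-1,0))"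
    and ?T5 = "weyl_mono (- inverse w) ((1,1,0),(0,-1,-1))"
  have "(X ^^ N) f = (?T1 ^^ N) f + ((\<lambda>f. (?T2 f + ?T3 f) + (?T4 f + ?T5 f)) ^^ N) f"
    unfolding X_monomials
  proof (rule pow_sum[where s = 1 and P = ?T1 and Q = "\<lambda>f. (?T2 f + ?T3 f) + (?T4 f + ?T5 f)"])
    fix f
    show "?T1 ((?T2 f + ?T3 f) + (?T4 f + ?T5 f))
        = fscale (w powi 1) ((?T2 (?T1 f) + ?T3 (?T1 f)) + (?T4 (?T1 f) + ?T5 (?T1 f)))"
      unfolding fs.lin_add[OF lin_monomial] fs.scale_right_distrib
      by (intro arg_cong2[where f = "(+)"] monomial_q_commute) simp_all
  qed (intro lin_plus lin_monomial | simp)+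
  also have "((\<lambda>f. (?T2 f + ?T3 f) + (?T4 f + ?T5 f)) ^^ N) f
      = ((\<lambda>f. ?T2 f + ?T3 f) ^^ N) f + ((\<lambda>f. ?T4 f + ?T5 f) ^^ N) f"
  proof (rule pow_sum[where s = "-1" and P = "\<lambda>f. ?T2 f + ?T3 f" and Q = "\<lambda>f. ?T4 f + ?T5 f"])
    fix f
    \<comment> \<open>This does not hold term by term: the cross terms carry different powers of w.
      The sums are -y1 z1 P and y1 x1 P with the common second factor P = y2^-1 (x2 - z2^-1), so
      they q-commute because y1 and y1 x1 do.\<close>
    show "?T2 (?T4 f + ?T5 f) + ?T3 (?T4 f + ?T5 f) = fscale (w powi - 1) (?T4 (?T2 f + ?T3 f) + ?T5 (?T2 f + ?T3 f))"
      by (rule ext, clarify, simp only: plus_fun_apply fscale_apply mon_op_def)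
        (simp add: mon_coeff_def power_int_minus powi_succ powi_one_minus field_simps omega_nonzero)
  qed (intro lin_plus lin_monomial | simp)+
  also have "((\<lambda>f. ?T2 f + ?T3 f) ^^ N) f = (?T2 ^^ N) f + (?T3 ^^ N) f"
    by (rule pow_sum[where s = "-1" and P = ?T2 and Q = ?T3, OF lin_monomial lin_monomial monomial_q_commute]) simp_all
  also have "((\<lambda>f. ?T4 f + ?T5 f) ^^ N) f = (?T4 ^^ N) f + (?T5 ^^ N) f"
    by (rule pow_sum[where s = "-1" and P = ?T4 and Q = ?T5, OF lin_monomial lin_monomial monomial_q_commute]) simp_all
  also have "(?T1 ^^ N) f = fscale (1 ^ N * (central_value N p1 (1,0,0) * central_value N p2 (0,0,0))) f"
    by (rule monomial_pow_commuting[OF N f]) simp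
  also have "(?T2 ^^ N) f = fscale (- (central_value N p1 (0,1,1) * central_value N p2 (1,-1,0))) f"
    by (rule monomial_pow_twisted[OF N f _ neg_pow(1)]) simp
  also have "(?T3 ^^ N) f = fscale (1 ^ N * (central_value N p1 (0,1,1) * central_value N p2 (0,-1,-1))) f"
    by (rule monomial_pow_commuting[OF N f]) simp
  also have "(?T4 ^^ N) f = fscale (1 ^ N * (central_value N p1 (1,1,0) * central_value N p2 (1,-1,0))) f"
    by (rule monomial_pow_commuting[OF N f]) simp
  also have "(?T5 ^^ N) f = fscale (- (central_value N p1 (1,1,0) * central_value N p2 (0,-1,-1))) f"
    by (rule monomial_pow_twisted[OF N f _ neg_pow(2)]) simp
  finally show ?thesis
    unfolding fs.scale_left_distrib[symmetric]
    by (rule trans) (rule arg_cong[where f = "\<lambda>c. fscale c f"], simp add: central_value_def field_simps power_int_minus)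
qed

lemma S_pow:
  assumes f: "f \<in> periodic N"
  shows "(S ^^ N) f = fscale (\<alpha>1 * \<alpha>2) f"
proof -
  have S: "S = weyl_mono 1 ((1,0,0),(1,0,0))" by (simp add: fun_eq_iff rep_op_tm)
  show ?thesis unfolding S
    by (subst monomial_pow_commuting[OF N f]) (simp_all add: central_value_def)
qed

end

section \<open>The intertwiner\<close>

text \<open>Here \<open>c1\<close>, \<open>d1\<close>, \<open>c2\<close>, \<open>d2\<close> are the
  primed parameters. Substituted into the scalars of \<open>V_pow\<close>, \<open>U_pow\<close> and
  \<open>X_pow\<close> on the target, they give back the original b2, 1/b1 and a1.\<close>

lemma braiding_identities:
  fixes a1 b1 m1 a2 b2 m2 :: "'a::field"
  assumes nz: "a1 \<noteq> 0" "b1 \<noteq> 0" "m1 \<noteq> 0" "a2 \<noteq> 0" "b2 \<noteq> 0" "m2 \<noteq> 0"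
    and A: "A = 1 - m1 * b1 / b2 * (1 - a1 / m1) * (1 - 1 / (m2 * a2))" "A \<noteq> 0"
    and D: "D = 1 - m2 * a2 * (1 - b2 / (m1 * b1))" "D \<noteq> 0"
    and E: "E = b1 * (1 - m1 / a1 * (1 - b2 / (m1 * b1)))" "E \<noteq> 0"
    and c1: "c1 = a1 / A" and c2: "c2 = a2 * A" and d1: "d1 = m2 * b2 / m1 / D" and d2: "d2 = E"
  shows "d1 * m1 / m2 + (c1 * d2 - c1 * d1 / m2) = b2"
    and "1 / d2 + (1 / (d1 * c2) - 1 / (m2 * d2 * c2)) = 1 / b1"
    and "c1 + d1 / d2 * (m1 / m2 - m1 * c2 + (c1 * c2 - c1 / m2)) = a1"
proof -
  \<comment> \<open>The numerators of \<open>A\<close>, \<open>D\<close>, \<open>E\<close> over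
    monomial denominators. In terms of them the three claims reduce to the polynomial identities
    \<open>p1\<close>, \<open>p2\<close>, \<open>p3\<close>.\<close>
  define nA where "nA = b2 * m2 * a2 - b1 * (m1 - a1) * (m2 * a2 - 1)"
  define nD where "nD = m1 * b1 - m2 * a2 * (m1 * b1 - b2)"
  define nE where "nE = a1 * b1 - (m1 * b1 - b2)"
  have A': "A = nA / (b2 * m2 * a2)" and D': "D = nD / (m1 * b1)" and E': "E = nE / a1"
    unfolding A D E nA_def nD_def nE_def using nz by (simp_all add: field_simps)
  have nz': "nA \<noteq> 0" "nD \<noteq> 0" "nE \<noteq> 0" using A(2) D(2) E(2) A' D' E' by auto
  have p1: "m1 * b1 * nA + nE * m2 * a2 * nD - a1 * b2 * m2 * a2 * b1 = nA * nD"
    unfolding nA_def nD_def nE_def by (simp add: algebra_simps)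
  have p2: "a1 * b1 * nA + nE * nD - a1 * b1 * b2 = nE * nA"
    unfolding nA_def nD_def nE_def by (simp add: algebra_simps)
  have p3: "b2 * m2 * a2 * nE * nD + b1 * (m1 * nA * b2 - m1 * nA * nA + a1 * a2 * nA * b2 * m2 - a1 * b2 * b2 * m2 * a2) = nA * nE * nD"
    unfolding nA_def nD_def nE_def by (simp add: algebra_simps)
  note subst = c1 c2 d1 d2 A' D' E'
  have "d1 * m1 / m2 + (c1 * d2 - c1 * d1 / m2)
      = b2 * (m1 * b1 * nA + nE * m2 * a2 * nD - a1 * b2 * m2 * a2 * b1) / (nA * nD)"
    unfolding subst using nz nz' by (simp add: field_simps)
  thus "d1 * m1 / m2 + (c1 * d2 - c1 * d1 / m2) = b2" unfolding p1 using nz' by simp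
  have "1 / d2 + (1 / (d1 * c2) - 1 / (m2 * d2 * c2))
      = (a1 * b1 * nA + nE * nD - a1 * b1 * b2) / (b1 * nE * nA)"
    unfolding subst using nz nz' by (simp add: field_simps)
  thus "1 / d2 + (1 / (d1 * c2) - 1 / (m2 * d2 * c2)) = 1 / b1" unfolding p2 using nz' by simp
  have "c1 + d1 / d2 * (m1 / m2 - m1 * c2 + (c1 * c2 - c1 / m2))
      = a1 * (b2 * m2 * a2 * nE * nD + b1 * (m1 * nA * b2 - m1 * nA * nA + a1 * a2 * nA * b2 * m2 - a1 * b2 * b2 * m2 * a2)) / (nA * nE * nD)"
    unfolding subst using nz nz' by (simp add: field_simps)
  thus "c1 + d1 / d2 * (m1 / m2 - m1 * c2 + (c1 * c2 - c1 / m2)) = a1" unfolding p3 using nz' by simp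
qed

text \<open>For T either of the two operators, T minus its k-th eigenvalue removes the k-th term of
  a relation and rescales the others. Any other index differs from k in at least one of the two
  eigenvalues, so its coefficient vanishes by induction.\<close>

lemma (in operator_space) joint_eigenvectors_independent:
  assumes fin: "finite I" and U: "lin U" and V: "lin V"
    and eig: "\<And>i. i \<in> I \<Longrightarrow> U (F i) = u i *s F i" "\<And>i. i \<in> I \<Longrightarrow> V (F i) = v i *s F i"
    and nz: "\<And>i. i \<in> I \<Longrightarrow> F i \<noteq> 0"
    and inj: "\<And>i j. i \<in> I \<Longrightarrow> j \<in> I \<Longrightarrow> u i = u j \<Longrightarrow> v i = v j \<Longrightarrow> i = j"
    and sum: "(\<Sum>i\<in>I. c i *s F i) = 0" and i: "i \<in> I"
  shows "c i = 0"
  using fin eig nz inj sum i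
proof (induction I arbitrary: c i rule: finite_induct)
  case empty
  then show ?case by simp
next
  case (insert k I)
  have elim: "c j * (t j - t k) = 0"
    if T: "lin T" and eigT: "\<And>i. i \<in> insert k I \<Longrightarrow> T (F i) = t i *s F i" and j: "j \<in> I" for T t j
  proof (rule insert.IH[of "\<lambda>j. c j * (t j - t k)" j])
    have "0 = T (\<Sum>i\<in>insert k I. c i *s F i) - t k *s (\<Sum>i\<in>insert k I. c i *s F i)"
      using insert.prems(5) lin_zero[OF T] by simp
    also have "\<dots> = (\<Sum>i\<in>insert k I. (c i * (t i - t k)) *s F i)"
      unfolding lin_sum[OF T] lin_scale[OF T] scale_sum_right sum_subtractf[symmetric]
      by (intro sum.cong refl) (simp add: eigT right_diff_distrib scale_left_diff_distrib mult.commute)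
    also have "\<dots> = (\<Sum>i\<in>I. (c i * (t i - t k)) *s F i)" using insert.hyps by simp
    finally show "(\<Sum>i\<in>I. (c i * (t i - t k)) *s F i) = 0" by simp
  qed (use insert.prems(1-4) j in blast)+
  have z: "c j = 0" if j: "j \<in> I" for j
  proof -
    have "j \<noteq> k" using j insert.hyps by blast
    hence "u j \<noteq> u k \<or> v j \<noteq> v k" using insert.prems(4)[of j k] j by blast
    thus ?thesis using elim[OF U insert.prems(1) j] elim[OF V insert.prems(2) j] by auto
  qed
  have "(\<Sum>i\<in>I. c i *s F i) = 0" using z by simp
  hence "c k *s F k = 0" using insert.prems(5) insert.hyps by simp
  hence "c k = 0" using insert.prems(3)[of k] by simp
  thus ?case using z insert.prems(6) by blast
qed

lemma funpow_scale:
  assumes "fs.lin T"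
  shows "((\<lambda>f. fscale c (T f)) ^^ n) f = fscale (c ^ n) ((T ^^ n) f)"
  by (induction n) (simp_all only: funpow.simps comp_apply id_apply power_0 fs.scale_one fs.lin_scale[OF assms] fs.scale_scale power_Suc)

lemma lin_fscale: "fs.lin T \<Longrightarrow> fs.lin (\<lambda>f. fscale c (T f))"
  by (rule fs.linI) (simp_all only: fs.lin_add fs.lin_scale fs.scale_right_distrib fs.scale_scale mult.commute)

lemma delta_nonzero: "delta N j \<noteq> 0"
proof
  assume "delta N j = 0"
  hence "delta N j j = 0" by simp
  thus False by (simp add: delta_def)
qed

lemma periodic_sum: "(\<And>a. a \<in> A \<Longrightarrow> g a \<in> periodic N) \<Longrightarrow> sum g A \<in> periodic N"
  by (induction A rule: infinite_finite_induct) (auto simp: periodic_def)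

lemma invertible_if_kernel_trivial:
  assumes M: "M \<in> carrier_mat n n"
    and ker: "\<And>v. v \<in> carrier_vec n \<Longrightarrow> M *\<^sub>v v = 0\<^sub>v n \<Longrightarrow> v = 0\<^sub>v n"
  obtains M' where "M' \<in> carrier_mat n n" "M * M' = 1\<^sub>m n" "M' * (M :: complex mat) = 1\<^sub>m n"
proof -
  have "det M \<noteq> 0" using det_0_iff_vec_prod_zero_field[OF M] ker by blast
  hence "M \<in> Units (ring_mat TYPE(complex) n ())" by (rule det_non_zero_imp_unit[OF M])
  thus thesis using that unfolding Units_def ring_mat_simps by blast
qed

lemma delta_shift: "delta N (j, l) (i + s, k + t) = delta N (j - s, l - t) (i, k)"
proof -
  have "(x + s) mod int N = y mod int N \<longleftrightarrow> x mod int N = (y - s) mod int N" for x y s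
    by (simp add: mod_eq_dvd_iff algebra_simps)
  thus ?thesis by (simp add: delta_def)
qed

lemma delta_eigen:
  assumes N: "N > 0"
  shows "omega N powi i * delta N (j, l) (i, k) = omega N powi j * delta N (j, l) (i, k)"
    and "omega N powi k * delta N (j, l) (i, k) = omega N powi l * delta N (j, l) (i, k)"
  using primitive_root_powi_cong[OF primitive_root_omega[OF N], of i j]
    primitive_root_powi_cong[OF primitive_root_omega[OF N], of k l]
  by (auto simp: delta_def)

text \<open>\<open>a1\<close>, \<open>b1\<close>, \<open>a2\<close>, \<open>b2\<close> are N-th
  roots of the source characters. Rescaling the operators by them makes all N-th powers the identity
  without affecting the commutation relations; \<open>U\<close> is multiplied by \<open>b1\<close>
  because it replaces y1^-1. The rescaling is undone at the end.\<close>

lemma (in rw_rep) intertwiner_family: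
  fixes a1 b1 a2 b2 :: complex
  assumes nz: "a1 \<noteq> 0" "b1 \<noteq> 0" "a2 \<noteq> 0" "b2 \<noteq> 0"
    and X: "\<alpha>1 + \<beta>1 / \<beta>2 * (\<mu>1 / \<mu>2 - \<mu>1 * \<alpha>2 + (\<alpha>1 * \<alpha>2 - \<alpha>1 / \<mu>2)) = a1 ^ N"
    and U: "1 / \<beta>2 + (1 / (\<beta>1 * \<alpha>2) - 1 / (\<mu>2 * \<beta>2 * \<alpha>2)) = 1 / b1 ^ N"
    and V: "\<beta>1 * \<mu>1 / \<mu>2 + (\<alpha>1 * \<beta>2 - \<alpha>1 * \<beta>1 / \<mu>2) = b2 ^ N"
    and S: "\<alpha>1 * \<alpha>2 = a1 ^ N * a2 ^ N"
  obtains F where "\<And>j l. F j l \<in> periodic N" "\<And>j l. F j l \<noteq> 0"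
    "\<And>j l. F (j mod int N) (l mod int N) = F j l"
    "\<And>j l. X (F j l) = fscale a1 (F (j - 1) l)" "\<And>j l. S (F j l) = fscale (a1 * a2) (F (j - 1) (l - 1))"
    "\<And>j l. U (F j l) = fscale (w powi (- j) / b1) (F j l)" "\<And>j l. V (F j l) = fscale (b2 * w powi l) (F j l)"
proof -
  let ?X = "\<lambda>f. fscale (1 / a1) (X f)" and ?S = "\<lambda>f. fscale (1 / (a1 * a2)) (S f)"
    and ?U = "\<lambda>f. fscale b1 (U f)" and ?V = "\<lambda>f. fscale (1 / b2) (V f)"
  have cl: "f \<in> periodic N \<Longrightarrow> fscale c (rep_op N p1 p2 u f) \<in> periodic N" for c u f
    by (intro periodic_scale rep_op_periodic[OF N])
  note sc = fs.lin_scale[OF lin_rep_op] fs.scale_scale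
  obtain F where F: "\<And>j l :: int. F j l \<in> periodic N" "\<And>j l. F j l \<noteq> 0"
    "\<And>j l. F (j mod int N) (l mod int N) = F j l"
    "\<And>j l. ?X (F j l) = F (j - 1) l" "\<And>j l. ?S (F j l) = F (j - 1) (l - 1)"
    "\<And>j l. ?U (F j l) = fscale (w powi (- j)) (F j l)" "\<And>j l. ?V (F j l) = fscale (w powi l) (F j l)"
  proof (rule fs.stone_von_neumann[where q = w and N = N and W = "periodic N" and X = ?X and S = ?S and U = ?U and V = ?V
        and ?v0.0 = "delta N (0, 0)"])
    fix f assume f: "f \<in> periodic N"
    show "(?X ^^ N) f = f" unfolding funpow_scale[OF lin_rep_op] X_pow[OF f] X using nz
      by (simp only: fs.scale_scale) (simp add: power_one_over fs.scale_one)
    show "(?S ^^ N) f = f" unfolding funpow_scale[OF lin_rep_op] S_pow[OF f] S using nz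
      by (simp only: fs.scale_scale) (simp add: power_one_over power_mult_distrib fs.scale_one)
    show "(?U ^^ N) f = f" unfolding funpow_scale[OF lin_rep_op] U_pow[OF f] U using nz
      by (simp only: fs.scale_scale) (simp add: power_one_over fs.scale_one)
    show "(?V ^^ N) f = f" unfolding funpow_scale[OF lin_rep_op] V_pow[OF f] V using nz
      by (simp only: fs.scale_scale) (simp add: power_one_over fs.scale_one)
    show "?U (?X f) = fscale w (?X (?U f))" unfolding sc UX by (simp only: mult_ac)
    show "?V (?X f) = ?X (?V f)" unfolding sc VX by (simp only: mult_ac)
    show "?U (?S f) = fscale w (?S (?U f))" unfolding sc US by (simp only: mult_ac)
    show "?V (?S f) = fscale (inverse w) (?S (?V f))" unfolding sc VS by (simp only: mult_ac)
    show "?X (?S f) = ?S (?X f)" unfolding sc XS by (simp only: mult_ac)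
    show "?U (?V f) = ?V (?U f)" unfolding sc UV by (simp only: mult_ac)
  qed (use prim delta_periodic delta_nonzero in \<open>blast intro: lin_fscale lin_rep_op cl periodic_add periodic_scale\<close>)+
  have solve: "g = fscale d h" if "fscale c g = h" "c * d = 1" for c d g h
    unfolding that(1)[symmetric] fs.scale_scale using that(2) by (simp add: mult.commute fs.scale_one)
  show thesis
  proof (rule that[of F])
    fix j l
    show "X (F j l) = fscale a1 (F (j - 1) l)" by (rule solve[OF F(4)]) (use nz in simp)
    show "S (F j l) = fscale (a1 * a2) (F (j - 1) (l - 1))" by (rule solve[OF F(5)]) (use nz in simp)
    have "U (F j l) = fscale (1 / b1) (fscale (w powi (- j)) (F j l))" by (rule solve[OF F(6)]) (use nz in simp)
    thus "U (F j l) = fscale (w powi (- j) / b1) (F j l)" unfolding fs.scale_scale by simp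
    have "V (F j l) = fscale b2 (fscale (w powi l) (F j l))" by (rule solve[OF F(7)]) (use nz in simp)
    thus "V (F j l) = fscale (b2 * w powi l) (F j l)" unfolding fs.scale_scale .
  qed (rule F)+
qed

lemma op_mat_cong_delta: "(\<And>j l. S (delta N (j, l)) = T (delta N (j, l))) \<Longrightarrow> op_mat N S = op_mat N T"
  by (simp add: op_mat_def point_def)

lemma rep_op_delta_x:
  "rep_op N p1 p2 (tm 1 0 0 0 0 0) (delta N (j, l)) = fscale (omega_pow N (fst p1)) (delta N (j - 1, l))"
  "rep_op N p1 p2 (tm 0 0 0 1 0 0) (delta N (j, l)) = fscale (omega_pow N (fst p2)) (delta N (j, l - 1))"
  by (rule ext, clarify, simp only: rep_op_tm_apply mon_coeff_simps fscale_apply delta_shift, simp)+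

lemma rep_op_delta_y:
  assumes N: "N > 0"
  shows "rep_op N p1 p2 (tm 0 (-1) 0 0 0 0) (delta N (j, l)) = fscale (omega N powi (- j) / omega_pow N (fst (snd p1))) (delta N (j, l))"
    and "rep_op N p1 p2 (tm 0 0 0 0 1 0) (delta N (j, l)) = fscale (omega_pow N (fst (snd p2)) * omega N powi l) (delta N (j, l))"
proof -
  have "inverse (omega N powi i) * delta N (j, l) (i, k) = inverse (omega N powi j) * delta N (j, l) (i, k)" for i k
    using delta_eigen(1)[OF N, of i j l k] by auto
  thus "rep_op N p1 p2 (tm 0 (-1) 0 0 0 0) (delta N (j, l)) = fscale (omega N powi (- j) / omega_pow N (fst (snd p1))) (delta N (j, l))"
    by (intro ext, clarify, simp only: rep_op_tm_apply mon_coeff_simps fscale_apply)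
      (simp add: power_int_minus divide_inverse mult_ac)
  show "rep_op N p1 p2 (tm 0 0 0 0 1 0) (delta N (j, l)) = fscale (omega_pow N (fst (snd p2)) * omega N powi l) (delta N (j, l))"
    using delta_eigen(2)[OF N, of _ j l]
    by (intro ext, clarify, simp only: rep_op_tm_apply mon_coeff_simps fscale_apply) (simp add: mult_ac)
qed

lemma rep_op_z:
  "rep_op N p1 p2 (tm 0 0 1 0 0 0) f = fscale (omega_pow N (snd (snd p1))) f"
  "rep_op N p1 p2 (tm 0 0 0 0 0 1) f = fscale (omega_pow N (snd (snd p2))) f"
  by (rule ext, clarify, simp only: rep_op_tm_apply mon_coeff_simps fscale_apply, simp)+

lemma primitive_root_powi_inj:
  assumes q: "primitive_root q N" and "q powi i = q powi j"
  shows "i mod int N = j mod int N"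
proof -
  have "q powi (i - j) = 1"
    using assms(2) primitive_root_nonzero[OF q] by (simp add: power_int_diff)
  thus ?thesis using primitive_root_powi_eq_1[OF q] by (simp add: mod_eq_dvd_iff)
qed

text \<open>\<open>R\<close> is the matrix of the operator sending \<open>delta N (j, l)\<close> to
  \<open>F j l\<close>. The last conclusion is the condition for x2 multiplied on the left by x1 g,
  since (x1 g)(g^-1 x2) = x1 x2.\<close>

lemma (in rw_rep) intertwiner:
  assumes z: "omega_pow N (snd (snd q1)) = Z1" "omega_pow N (snd (snd q2)) = Z2"
    and X: "\<alpha>1 + \<beta>1 / \<beta>2 * (\<mu>1 / \<mu>2 - \<mu>1 * \<alpha>2 + (\<alpha>1 * \<alpha>2 - \<alpha>1 / \<mu>2)) = omega_pow N (fst q1) ^ N"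
    and U: "1 / \<beta>2 + (1 / (\<beta>1 * \<alpha>2) - 1 / (\<mu>2 * \<beta>2 * \<alpha>2)) = 1 / omega_pow N (fst (snd q1)) ^ N"
    and V: "\<beta>1 * \<mu>1 / \<mu>2 + (\<alpha>1 * \<beta>2 - \<alpha>1 * \<beta>1 / \<mu>2) = omega_pow N (fst (snd q2)) ^ N"
    and S: "\<alpha>1 * \<alpha>2 = omega_pow N (fst q1) ^ N * omega_pow N (fst q2) ^ N"
  obtains R R' where "R \<in> carrier_mat (N * N) (N * N)" "R' \<in> carrier_mat (N * N) (N * N)"
    "R * R' = 1\<^sub>m (N * N)" "R' * R = 1\<^sub>m (N * N)"
    "R * pi_tensor N q1 q2 (tm 1 0 0 0 0 0) = pi_tensor N p1 p2 (RW_x1 N) * R"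
    "R * pi_tensor N q1 q2 (tm 0 (-1) 0 0 0 0) = pi_tensor N p1 p2 (RW_y1inv N) * R"
    "R * pi_tensor N q1 q2 (tm 0 0 0 0 1 0) = pi_tensor N p1 p2 (RW_y2 N) * R"
    "R * pi_tensor N q1 q2 (tm 0 0 1 0 0 0) = pi_tensor N p1 p2 (tm 0 0 1 0 0 0) * R"
    "R * pi_tensor N q1 q2 (tm 0 0 0 0 0 1) = pi_tensor N p1 p2 (tm 0 0 0 0 0 1) * R"
    "pi_tensor N p1 p2 (RW_x1 N) * (R * pi_tensor N q1 q2 (tm 0 0 0 1 0 0)) = pi_tensor N p1 p2 (tm 1 0 0 1 0 0) * R"
proof -
  obtain F where F: "\<And>j l. F j l \<in> periodic N" "\<And>j l. F j l \<noteq> 0"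
    "\<And>j l. F (j mod int N) (l mod int N) = F j l"
    "\<And>j l. X (F j l) = fscale (omega_pow N (fst q1)) (F (j - 1) l)"
    "\<And>j l. S (F j l) = fscale (omega_pow N (fst q1) * omega_pow N (fst q2)) (F (j - 1) (l - 1))"
    "\<And>j l. U (F j l) = fscale (w powi (- j) / omega_pow N (fst (snd q1))) (F j l)"
    "\<And>j l. V (F j l) = fscale (omega_pow N (fst (snd q2)) * w powi l) (F j l)"
    using intertwiner_family[OF _ _ _ _ X U V S] by (metis omega_pow_nonzero)
  define G where "G s = F (fst (point N s)) (snd (point N s))" for s
  define T where "T f = (\<Sum>s<N * N. fscale (f (point N s)) (G s))" for f
  have linT: "fs.lin T"
  proof (rule fs.linI)
    fix f g c
    show "T (f + g) = T f + T g"
      unfolding T_def plus_fun_apply fs.scale_left_distrib sum.distrib ..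
    show "T (fscale c f) = fscale c (T f)"
      unfolding T_def fscale_apply fs.scale_sum_right fs.scale_scale ..
  qed
  have perT: "T f \<in> periodic N" for f
    unfolding T_def G_def by (intro periodic_sum periodic_scale F(1))
  have Td: "T (delta N (j, l)) = F j l" for j l
  proof -
    obtain s where s: "s < N * N" "fst (point N s) = j mod int N" "snd (point N s) = l mod int N"
      using point_ex[OF N] by blast
    have "delta N (j, l) = delta N (point N s)" using s by (simp add: delta_def)
    hence "T (delta N (j, l)) = (\<Sum>r<N * N. if r = s then G r else 0)"
      unfolding T_def by (intro sum.cong refl) (use s in \<open>auto simp: delta_point fs.scale_one fs.scale_zero_left simp del: fscale_apply\<close>)
    also have "\<dots> = F j l" using s F(3)[of j l] by (simp add: G_def)
    finally show ?thesis .
  qed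
  have m1: "op_mat N T * op_mat N (rep_op N q1 q2 u) = op_mat N (\<lambda>f. T (rep_op N q1 q2 u f))" for u
    by (rule op_mat_mult[OF N linT]) (rule rep_op_periodic[OF N])
  have m2: "op_mat N (rep_op N p1 p2 u) * op_mat N P = op_mat N (\<lambda>f. rep_op N p1 p2 u (P f))"
    if "\<And>f. P f \<in> periodic N" for u P
    by (rule op_mat_mult[OF N lin_rep_op]) (rule that)
  have inter: "op_mat N T * pi_tensor N q1 q2 u = pi_tensor N p1 p2 v * op_mat N T"
    if "\<And>j l. T (rep_op N q1 q2 u (delta N (j, l))) = rep_op N p1 p2 v (F j l)" for u v
    unfolding pi_tensor_eq m1 m2[OF perT]
    by (rule op_mat_cong_delta) (simp only: that Td)
  have xx: "pi_tensor N p1 p2 (RW_x1 N) * (op_mat N T * pi_tensor N q1 q2 (tm 0 0 0 1 0 0)) = pi_tensor N p1 p2 (tm 1 0 0 1 0 0) * op_mat N T"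
    unfolding pi_tensor_eq m1 m2[OF perT]
    by (rule op_mat_cong_delta)
      (simp only: Td rep_op_delta_x fs.lin_scale[OF linT] fs.lin_scale[OF lin_rep_op] F(4,5) fs.scale_scale mult.commute)
  \<comment> \<open>A kernel vector is a linear relation among joint eigenvectors whose pairs of
    eigenvalues are distinct for distinct basis positions.\<close>
  have ker: "v = 0\<^sub>v (N * N)" if v: "v \<in> carrier_vec (N * N)" "op_mat N T *\<^sub>v v = 0\<^sub>v (N * N)" for v
  proof -
    define H where "H = (\<Sum>s<N * N. fscale (v $ s) (G s))"
    have perH: "H \<in> periodic N" unfolding H_def G_def by (intro periodic_sum periodic_scale F(1))
    have "H (point N r) = 0" if r: "r < N * N" for r
    proof -
      have "H (point N r) = (\<Sum>s<N * N. op_mat N T $$ (r, s) * v $ s)"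
        unfolding H_def sum_fun_apply fscale_apply
        by (intro sum.cong refl) (use r Td in \<open>simp add: op_mat_index G_def point_def\<close>)
      also have "\<dots> = (op_mat N T *\<^sub>v v) $ r"
        using r v(1) by (simp add: scalar_prod_def atLeast0LessThan)
      finally show ?thesis unfolding v(2) using r by simp
    qed
    hence "H = 0" by (subst delta_expand_sum[OF N perH]) (simp add: fs.scale_zero_left del: fscale_apply)
    hence sum0: "(\<Sum>s<N * N. fscale (v $ s) (G s)) = 0" by (simp add: H_def)
    have "v $ s = 0" if s: "s \<in> {..<N * N}" for s
    proof (rule fs.joint_eigenvectors_independent[OF _ _ _ _ _ _ _ sum0 s])
      show "U (G s) = fscale (w powi (- fst (point N s)) / omega_pow N (fst (snd q1))) (G s)" for s
        unfolding G_def by (rule F(6))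
      show "V (G s) = fscale (omega_pow N (fst (snd q2)) * w powi (snd (point N s))) (G s)" for s
        unfolding G_def by (rule F(7))
      show "G s \<noteq> 0" for s unfolding G_def by (rule F(2))
      fix i j assume ij: "i \<in> {..<N * N}" "j \<in> {..<N * N}"
        and e1: "w powi (- fst (point N i)) / omega_pow N (fst (snd q1)) = w powi (- fst (point N j)) / omega_pow N (fst (snd q1))"
        and e2: "omega_pow N (fst (snd q2)) * w powi (snd (point N i)) = omega_pow N (fst (snd q2)) * w powi (snd (point N j))"
      have "w powi (fst (point N i)) = w powi (fst (point N j))"
        using e1 by (simp add: power_int_minus)
      hence "fst (point N i) mod int N = fst (point N j) mod int N" by (rule primitive_root_powi_inj[OF prim(1)])
      moreover have "w powi (snd (point N i)) = w powi (snd (point N j))"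
        using e2 by simp
      hence "snd (point N i) mod int N = snd (point N j) mod int N" by (rule primitive_root_powi_inj[OF prim(1)])
      ultimately have "point N i = point N j" using ij by (simp add: point_mod prod_eq_iff)
      thus "i = j" by (simp add: point_inj)
    qed (rule finite_lessThan lin_rep_op)+
    thus ?thesis using v by (intro eq_vecI) auto
  qed
  obtain R' where R': "R' \<in> carrier_mat (N * N) (N * N)" "op_mat N T * R' = 1\<^sub>m (N * N)" "R' * op_mat N T = 1\<^sub>m (N * N)"
    using invertible_if_kernel_trivial[OF op_mat_carrier ker] by blast
  show thesis
  proof (rule that[OF op_mat_carrier R'])
    show "op_mat N T * pi_tensor N q1 q2 (tm 1 0 0 0 0 0) = pi_tensor N p1 p2 (RW_x1 N) * op_mat N T"
      by (rule inter) (simp only: Td rep_op_delta_x fs.lin_scale[OF linT] F(4))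
    show "op_mat N T * pi_tensor N q1 q2 (tm 0 (-1) 0 0 0 0) = pi_tensor N p1 p2 (RW_y1inv N) * op_mat N T"
      by (rule inter) (simp only: Td rep_op_delta_y[OF N] fs.lin_scale[OF linT] F(6))
    show "op_mat N T * pi_tensor N q1 q2 (tm 0 0 0 0 1 0) = pi_tensor N p1 p2 (RW_y2 N) * op_mat N T"
      by (rule inter) (simp only: Td rep_op_delta_y[OF N] fs.lin_scale[OF linT] F(7))
    show "op_mat N T * pi_tensor N q1 q2 (tm 0 0 1 0 0 0) = pi_tensor N p1 p2 (tm 0 0 1 0 0 0) * op_mat N T"
      by (rule inter) (simp only: Td rep_op_z z fs.lin_scale[OF linT])
    show "op_mat N T * pi_tensor N q1 q2 (tm 0 0 0 0 0 1) = pi_tensor N p1 p2 (tm 0 0 0 0 0 1) * op_mat N T"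
      by (rule inter) (simp only: Td rep_op_z z fs.lin_scale[OF linT])
    show "pi_tensor N p1 p2 (RW_x1 N) * (op_mat N T * pi_tensor N q1 q2 (tm 0 0 0 1 0 0)) = pi_tensor N p1 p2 (tm 1 0 0 1 0 0) * op_mat N T"
      by (rule xx)
  qed
qed

section \<open>Conjugation of matrix algebras and uniqueness of the conjugating matrix\<close>

lemma commutant_scalar:
  assumes C: "C \<in> carrier_mat n n" and comm: "\<And>M. M \<in> carrier_mat n n \<Longrightarrow> C * M = M * (C :: complex mat)"
  obtains s where "C = s \<cdot>\<^sub>m 1\<^sub>m n"
proof
  have e: "C $$ (a, i) * (if b = j then 1 else 0) = (if a = i then 1 else 0) * C $$ (j, b)"
    if "i < n" "j < n" "a < n" "b < n" for i j a b
  proof -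
    define E :: "complex mat" where "E = mat n n (\<lambda>(a, b). if a = i \<and> b = j then 1 else 0)"
    have E: "E \<in> carrier_mat n n" by (simp add: E_def)
    have "(C * E) $$ (a, b) = (\<Sum>k<n. if k = i then C $$ (a, k) * (if b = j then 1 else 0) else 0)"
      unfolding mat_mult_index[OF C E that(3,4)] by (intro sum.cong refl) (use that in \<open>simp add: E_def\<close>)
    moreover have "(E * C) $$ (a, b) = (\<Sum>k<n. if k = j then (if a = i then 1 else 0) * C $$ (k, b) else 0)"
      unfolding mat_mult_index[OF E C that(3,4)] by (intro sum.cong refl) (use that in \<open>simp add: E_def\<close>)
    ultimately show ?thesis using comm[OF E] that by simp
  qed
  show "C = C $$ (0, 0) \<cdot>\<^sub>m 1\<^sub>m n"
  proof (rule eq_matI)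
    fix a b assume "a < dim_row (C $$ (0, 0) \<cdot>\<^sub>m 1\<^sub>m n)" "b < dim_col (C $$ (0, 0) \<cdot>\<^sub>m 1\<^sub>m n)"
    hence ab: "a < n" "b < n" by simp_all
    hence "0 < n" by simp
    from e[OF ab(2) this ab(1) this] have "C $$ (a, b) = (if a = b then C $$ (0, 0) else 0)"
      by (simp split: if_splits)
    thus "C $$ (a, b) = (C $$ (0, 0) \<cdot>\<^sub>m 1\<^sub>m n) $$ (a, b)" using ab by simp
  qed (use C in simp_all)
qed

text \<open>\<open>R1 * S\<close> commutes with every matrix and is therefore scalar. The scalar is
  nonzero because the invertible \<open>S\<close> cannot be the zero matrix when n > 0.\<close>

lemma conjugation_unique:
  assumes R: "R \<in> carrier_mat n n" "R1 \<in> carrier_mat n n" "R * R1 = 1\<^sub>m n" "R1 * R = 1\<^sub>m n"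
    and S: "S \<in> carrier_mat n n" "S1 \<in> carrier_mat n n" "S * S1 = 1\<^sub>m n" "S1 * S = 1\<^sub>m n"
    and eq: "\<And>M. M \<in> carrier_mat n n \<Longrightarrow> S * M * S1 = R * M * R1" and n: "n > 0"
  shows "\<exists>s. s \<noteq> 0 \<and> S = s \<cdot>\<^sub>m (R :: complex mat)"
proof -
  have "(R1 * S) * M = M * (R1 * S)" if M: "M \<in> carrier_mat n n" for M
  proof -
    have "(R1 * S) * M = R1 * (S * M)" using R S M by (simp add: assoc_mult_mat[of _ n n _ n _ n])
    also have "S * M = S * M * (S1 * S)" using R S M by simp
    also have "\<dots> = (S * M * S1) * S" using R S M by (simp add: assoc_mult_mat[of _ n n _ n _ n])
    also have "\<dots> = (R * M * R1) * S" unfolding eq[OF M] ..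
    also have "R1 * ((R * M * R1) * S) = (R1 * R) * (M * (R1 * S))"
      using R(1,2) S(1) M by (simp add: assoc_mult_mat[of _ n n _ n _ n])
    also have "\<dots> = M * (R1 * S)" using R S M by simp
    finally show ?thesis .
  qed
  then obtain s where s: "R1 * S = s \<cdot>\<^sub>m 1\<^sub>m n" by (rule commutant_scalar[of "R1 * S" n, rotated]) (use R S in auto)
  have "S = (R * R1) * S" using R S by simp
  also have "\<dots> = R * (R1 * S)" using R(1,2) S(1) by (simp add: assoc_mult_mat[of _ n n _ n _ n])
  also have "\<dots> = s \<cdot>\<^sub>m R" unfolding s using R(1) by (subst mult_smult_distrib[of R n n "1\<^sub>m n" n]) auto
  finally have SR: "S = s \<cdot>\<^sub>m R" .
  have "s \<noteq> 0"
  proof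
    assume "s = 0"
    hence "S = 0\<^sub>m n n" using SR R(1) by (intro eq_matI) auto
    hence "1\<^sub>m n = (0\<^sub>m n n :: complex mat)" using S(2,3) by simp
    hence "(1\<^sub>m n :: complex mat) $$ (0, 0) = 0\<^sub>m n n $$ (0, 0)" by simp
    thus False using n by simp
  qed
  thus ?thesis using SR by blast
qed

lemma conjugation_iso:
  assumes R: "R \<in> carrier_mat n n" "R1 \<in> carrier_mat n n" "R * R1 = 1\<^sub>m n" "R1 * (R :: complex mat) = 1\<^sub>m n"
  shows "(\<lambda>M. R * M * R1) \<in> ring_iso (ring_mat TYPE(complex) n ()) (ring_mat TYPE(complex) n ())"
proof (rule ring_iso_memI, unfold ring_mat_simps)
  fix A :: "complex mat" assume A: "A \<in> carrier_mat n n"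
  show "R * A * R1 \<in> carrier_mat n n" using R A by auto
  fix B :: "complex mat" assume B: "B \<in> carrier_mat n n"
  have "R * A * R1 * (R * B * R1) = R * A * (R1 * R) * (B * R1)"
    using R(1,2) A B by (simp add: assoc_mult_mat[of _ n n _ n _ n])
  also have "\<dots> = R * (A * B) * R1" unfolding R(4) using R(1,2) A B by (simp add: assoc_mult_mat[of _ n n _ n _ n])
  finally show "R * (A * B) * R1 = R * A * R1 * (R * B * R1)" ..
  show "R * (A + B) * R1 = R * A * R1 + R * B * R1"
    using R(1,2) A B by (simp add: mult_add_distrib_mat[of _ n n _ n] add_mult_distrib_mat[of _ n n _ _ n])
next
  show "R * 1\<^sub>m n * R1 = 1\<^sub>m n" using R by simp
  have cancel: "P * (P1 * M * P) * P1 = M"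
    if "P \<in> carrier_mat n n" "P1 \<in> carrier_mat n n" "P * P1 = 1\<^sub>m n" "M \<in> carrier_mat n n" for P P1 M :: "complex mat"
  proof -
    have "P * (P1 * M * P) * P1 = (P * P1) * M * (P * P1)"
      using that(1,2,4) by (simp add: assoc_mult_mat[of _ n n _ n _ n])
    thus ?thesis using that(3,4) by simp
  qed
  show "bij_betw (\<lambda>M. R * M * R1) (carrier_mat n n) (carrier_mat n n)"
    by (rule bij_betw_byWitness[where f' = "\<lambda>M. R1 * M * R"]) (use R cancel[of R R1] cancel[of R1 R] in auto)
qed

lemma intertwine_conj:
  assumes "R \<in> carrier_mat n n" "R1 \<in> carrier_mat n n" "R * R1 = 1\<^sub>m n"
    and "P \<in> carrier_mat n n" "Q \<in> carrier_mat n n" and eq: "R * P = Q * (R :: complex mat)"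
  shows "R * P * R1 = Q"
proof -
  have "R * P * R1 = Q * (R * R1)" unfolding eq using assms by (simp add: assoc_mult_mat[of _ n n _ n _ n] del: assms(3))
  thus ?thesis using assms by simp
qed

lemma rep_params_pow:
  assumes "rep_params N \<chi> p"
  shows "omega_pow N (fst p) ^ N = ch_a \<chi>" "omega_pow N (fst (snd p)) ^ N = ch_b \<chi>"
    "omega_pow N (snd (snd p)) = ch_z \<chi>"
  using assms by (simp_all add: rep_params_def omega_pow_of_nat_mult)

lemma cls_mult: "cls N \<chi>1 \<chi>2 (tmult N u v) = cls N \<chi>1 \<chi>2 u \<otimes>\<^bsub>Qalg N \<chi>1 \<chi>2\<^esub> cls N \<chi>1 \<chi>2 v"
  using ideal.rcoset_mult_add[OF ideal_Jideal, of u N v \<chi>1 \<chi>2] by (simp add: Qalg_def cls_def FactRing_def)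

lemma cls_one: "cls N \<chi>1 \<chi>2 tone = \<one>\<^bsub>Qalg N \<chi>1 \<chi>2\<^esub>"
  by (simp add: Qalg_def cls_def FactRing_def)

theorem theorem3p11:
  fixes N :: nat and \<chi>1 \<chi>2 :: echar
    and p1 p2 p1' p2' :: "complex \<times> complex \<times> complex"
  assumes N: "N \<ge> 2"
    and ch1: "is_echar \<chi>1" and ch2: "is_echar \<chi>2"
    and adm: "admissible N \<chi>1 \<chi>2"
    and B: "Bmap N \<chi>1 \<chi>2 = (\<chi>2', \<chi>1')"
    and V1: "rep_params N \<chi>1 p1" and V2: "rep_params N \<chi>2 p2"
    and V1': "rep_params N \<chi>1' p1'" and V2': "rep_params N \<chi>2' p2'"
  shows "\<exists>\<Phi>. \<Phi> \<in> ring_iso (Qalg N \<chi>1 \<chi>2) (Qalg N \<chi>1' \<chi>2') \<and>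
             induced_by_RW N \<chi>1 \<chi>2 \<chi>1' \<chi>2' \<Phi> \<and>
             (\<exists>R Rinv. R \<in> carrier_mat (N * N) (N * N) \<and> Rinv \<in> carrier_mat (N * N) (N * N) \<and>
                 R * Rinv = 1\<^sub>m (N * N) \<and> Rinv * R = 1\<^sub>m (N * N) \<and>
                 (\<forall>c \<in> carrier (Qalg N \<chi>1 \<chi>2).
                     R * pi_quot N p1 p2 c * Rinv = pi_quot N p1' p2' (\<Phi> c)) \<and>
                 (\<forall>R' Rinv'. R' \<in> carrier_mat (N * N) (N * N) \<and> Rinv' \<in> carrier_mat (N * N) (N * N) \<and>
                     R' * Rinv' = 1\<^sub>m (N * N) \<and> Rinv' * R' = 1\<^sub>m (N * N) \<and>
                     (\<forall>c \<in> carrier (Qalg N \<chi>1 \<chi>2).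
                         R' * pi_quot N p1 p2 c * Rinv' = pi_quot N p1' p2' (\<Phi> c))
                     \<longrightarrow> (\<exists>s. s \<noteq> 0 \<and> R' = s \<cdot>\<^sub>m R)))"
proof -
  have N0: "N > 0" using N by simp
  \<comment> \<open>The locale is instantiated at the target parameters; the source parameters enter
    through \<open>T.intertwiner\<close>.\<close>
  interpret T: rw_rep N p1' p2' by unfold_locales (rule N0)
  have \<chi>': "\<chi>1' = chi1' N \<chi>1 \<chi>2" "\<chi>2' = chi2' N \<chi>1 \<chi>2" using B by (simp_all add: Bmap_def)
  have z': "ch_z \<chi>1' = ch_z \<chi>1" "ch_z \<chi>2' = ch_z \<chi>2"
    by (simp_all add: \<chi>' chi1'_def chi2'_def ch_z_def)
  have ab': "ch_a \<chi>1' = a1' N \<chi>1 \<chi>2" "ch_b \<chi>1' = b1' N \<chi>1 \<chi>2" "ch_a \<chi>2' = a2' N \<chi>1 \<chi>2" "ch_b \<chi>2' = b2' N \<chi>1 \<chi>2"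
    by (simp_all add: \<chi>' chi1'_def chi2'_def ch_a_def ch_b_def)
  have m: "ch_z \<chi> ^ N = ch_m N \<chi>" for \<chi> by (simp add: ch_m_def)
  have nz: "ch_a \<chi>1 \<noteq> 0" "ch_b \<chi>1 \<noteq> 0" "ch_m N \<chi>1 \<noteq> 0" "ch_a \<chi>2 \<noteq> 0" "ch_b \<chi>2 \<noteq> 0" "ch_m N \<chi>2 \<noteq> 0"
    using ch1 ch2 by (simp_all add: is_echar_def ch_a_def ch_b_def ch_z_def ch_m_def)
  have adm': "bigA N \<chi>1 \<chi>2 \<noteq> 0" "denB1 N \<chi>1 \<chi>2 \<noteq> 0" "b2' N \<chi>1 \<chi>2 \<noteq> 0" using adm by (simp_all add: admissible_def)
  note ident = braiding_identities[OF nz bigA_def adm'(1) denB1_def adm'(2) b2'_def adm'(3) a1'_def a2'_def b1'_def refl]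
  note par = rep_params_pow[OF V1] rep_params_pow[OF V2] rep_params_pow[OF V1'] rep_params_pow[OF V2']
  have aa: "a1' N \<chi>1 \<chi>2 * a2' N \<chi>1 \<chi>2 = ch_a \<chi>1 * ch_a \<chi>2"
    using adm' by (simp add: a1'_def a2'_def)
  \<comment> \<open>The three identities of \<open>ident\<close> supply the conditions on
    \<open>X\<close>, \<open>U\<close>, \<open>V\<close>; the condition on \<open>S\<close> is
    \<open>aa\<close>, the invariance of the product a1 a2 under B.\<close>
  obtain R Rinv where R: "R \<in> carrier_mat (N * N) (N * N)" "Rinv \<in> carrier_mat (N * N) (N * N)"
      "R * Rinv = 1\<^sub>m (N * N)" "Rinv * R = 1\<^sub>m (N * N)"
    and inter: "R * pi_tensor N p1 p2 (tm 1 0 0 0 0 0) = pi_tensor N p1' p2' (RW_x1 N) * R"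
      "R * pi_tensor N p1 p2 (tm 0 (-1) 0 0 0 0) = pi_tensor N p1' p2' (RW_y1inv N) * R"
      "R * pi_tensor N p1 p2 (tm 0 0 0 0 1 0) = pi_tensor N p1' p2' (RW_y2 N) * R"
      "R * pi_tensor N p1 p2 (tm 0 0 1 0 0 0) = pi_tensor N p1' p2' (tm 0 0 1 0 0 0) * R"
      "R * pi_tensor N p1 p2 (tm 0 0 0 0 0 1) = pi_tensor N p1' p2' (tm 0 0 0 0 0 1) * R"
    and interx2: "pi_tensor N p1' p2' (RW_x1 N) * (R * pi_tensor N p1 p2 (tm 0 0 0 1 0 0)) = pi_tensor N p1' p2' (tm 1 0 0 1 0 0) * R"
    by (rule T.intertwiner[of p1 p2, unfolded par z' ab' m, OF refl refl ident(3,2,1) aa]) blast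
  let ?Q = "Qalg N \<chi>1 \<chi>2" and ?Q' = "Qalg N \<chi>1' \<chi>2'"
  let ?c = "cls N \<chi>1 \<chi>2" and ?c' = "cls N \<chi>1' \<chi>2'"
  let ?\<psi> = "pi_quot N p1 p2" and ?\<psi>' = "pi_quot N p1' p2'"
  have iso: "?\<psi> \<in> ring_iso ?Q (matring N)" and iso': "?\<psi>' \<in> ring_iso ?Q' (matring N)"
    by (rule pi_quot_iso[OF N0 V1 V2], rule pi_quot_iso[OF N0 V1' V2'])
  have ringQ: "ring ?Q" and ringQ': "ring ?Q'"
    unfolding Qalg_def by (rule ideal.quotient_is_ring[OF ideal_Jideal])+
  define \<Phi> where "\<Phi> = inv_into (carrier ?Q') ?\<psi>' \<circ> ((\<lambda>M. R * M * Rinv) \<circ> ?\<psi>)"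
  have \<Phi>: "\<Phi> \<in> ring_iso ?Q ?Q'"
    unfolding \<Phi>_def
    by (rule ring_iso_set_trans[OF ring_iso_set_trans[OF iso conjugation_iso[OF R]] ring_iso_set_sym[OF ringQ' iso']])
  have bij: "bij_betw ?\<psi> (carrier ?Q) (carrier_mat (N * N) (N * N))" "bij_betw ?\<psi>' (carrier ?Q') (carrier_mat (N * N) (N * N))"
    using ring_iso_memE(5)[OF iso] ring_iso_memE(5)[OF iso'] by (simp_all add: ring_mat_simps)
  have \<psi>\<Phi>: "R * ?\<psi> c * Rinv = ?\<psi>' (\<Phi> c)" if c: "c \<in> carrier ?Q" for c
  proof -
    have "?\<psi> c \<in> carrier_mat (N * N) (N * N)" using bij(1) c by (rule bij_betwE[THEN bspec])
    hence "R * ?\<psi> c * Rinv \<in> carrier_mat (N * N) (N * N)" using R by auto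
    hence "R * ?\<psi> c * Rinv \<in> ?\<psi>' ` carrier ?Q'" using bij(2) by (simp add: bij_betw_def)
    from f_inv_into_f[OF this] show ?thesis by (simp add: \<Phi>_def)
  qed
  have ccar: "?c u \<in> carrier ?Q" "?c' u \<in> carrier ?Q'" for u by (simp_all add: carrier_Qalg)
  have \<Phi>car: "\<Phi> x \<in> carrier ?Q'" if "x \<in> carrier ?Q" for x using ring_iso_memE(1)[OF \<Phi> that] .
  have inj': "x = y" if "x \<in> carrier ?Q'" "y \<in> carrier ?Q'" "?\<psi>' x = ?\<psi>' y" for x y
    using bij(2) that by (auto simp: bij_betw_def dest: inj_onD)
  have \<psi>c: "?\<psi> (?c u) = pi_tensor N p1 p2 u" "?\<psi>' (?c' u) = pi_tensor N p1' p2' u" for u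
    by (rule pi_quot_cls[OF N0 V1 V2], rule pi_quot_cls[OF N0 V1' V2'])
  have \<Phi>c: "\<Phi> (?c u) = ?c' v" if "R * pi_tensor N p1 p2 u = pi_tensor N p1' p2' v * R" for u v
  proof (rule inj'[OF \<Phi>car[OF ccar(1)] ccar(2)])
    show "?\<psi>' (\<Phi> (?c u)) = ?\<psi>' (?c' v)"
      unfolding \<psi>\<Phi>[OF ccar(1), symmetric] \<psi>c
      by (rule intertwine_conj[OF R(1-3) pi_tensor_carrier pi_tensor_carrier that])
  qed
  have g: "RW_x1 N = tmult N (tm 1 0 0 0 0 0) (RW_g N)" by (simp add: RW_x1_def)
  have inv: "tmult N (tm 1 0 0 0 0 0) (tm (-1) 0 0 0 0 0) = tone" "tmult N (tm (-1) 0 0 0 0 0) (tm 1 0 0 0 0 0) = tone"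
    "tmult N (tm (-1) 0 0 0 0 0) (tm 1 0 0 1 0 0) = tm 0 0 0 1 0 0"
    by (simp_all add: tm_def tmult_single tmon_add_def wmon_add_def ttwist_def wtwist_def)
  have g': "?c' (RW_g N) = ?c' (tm (-1) 0 0 0 0 0) \<otimes>\<^bsub>?Q'\<^esub> ?c' (RW_x1 N)"
    unfolding cls_mult[symmetric] g tmult_assoc[symmetric] inv(2) tmult_one_left ..
  interpret Q': ring ?Q' by (rule ringQ')
  \<comment> \<open>The class of x1 g is the image of x1, so the image of x1^-1 is its inverse.
    Multiplying by the unit x1^-1 shows below that g is a unit too.\<close>
  have u1: "?c' (RW_x1 N) \<in> Units ?Q'"
  proof -
    have "?c' (RW_x1 N) \<otimes>\<^bsub>?Q'\<^esub> \<Phi> (?c (tm (-1) 0 0 0 0 0)) = \<one>\<^bsub>?Q'\<^esub>"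
      "\<Phi> (?c (tm (-1) 0 0 0 0 0)) \<otimes>\<^bsub>?Q'\<^esub> ?c' (RW_x1 N) = \<one>\<^bsub>?Q'\<^esub>"
      unfolding \<Phi>c[OF inter(1), symmetric] ring_iso_memE(2)[OF \<Phi> ccar(1) ccar(1), symmetric]
        cls_mult[symmetric] inv cls_one ring_iso_memE(4)[OF \<Phi>] by (rule refl)+
    thus ?thesis unfolding Units_def using ccar(2) \<Phi>car[OF ccar(1)] by blast
  qed
  have u2: "?c' (tm (-1) 0 0 0 0 0) \<in> Units ?Q'"
  proof -
    have "?c' (tm 1 0 0 0 0 0) \<otimes>\<^bsub>?Q'\<^esub> ?c' (tm (-1) 0 0 0 0 0) = \<one>\<^bsub>?Q'\<^esub>"
      "?c' (tm (-1) 0 0 0 0 0) \<otimes>\<^bsub>?Q'\<^esub> ?c' (tm 1 0 0 0 0 0) = \<one>\<^bsub>?Q'\<^esub>"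
      unfolding cls_mult[symmetric] inv cls_one by (rule refl)+
    thus ?thesis unfolding Units_def using ccar(2) by blast
  qed
  have unit: "?c' (RW_g N) \<in> Units ?Q'" unfolding g' by (rule Q'.Units_m_closed[OF u2 u1])
  \<comment> \<open>The image of x2 is known only through this product. Cancelling x1 leaves g times
    the image equal to x2, and the unit g can then be moved to the other side.\<close>
  have x12: "?c' (RW_x1 N) \<otimes>\<^bsub>?Q'\<^esub> \<Phi> (?c (tm 0 0 0 1 0 0)) = ?c' (tm 1 0 0 1 0 0)"
  proof (rule inj'[OF Q'.m_closed[OF ccar(2) \<Phi>car[OF ccar(1)]] ccar(2)])
    have "?\<psi>' (?c' (RW_x1 N) \<otimes>\<^bsub>?Q'\<^esub> \<Phi> (?c (tm 0 0 0 1 0 0)))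
        = pi_tensor N p1' p2' (RW_x1 N) * (R * pi_tensor N p1 p2 (tm 0 0 0 1 0 0) * Rinv)"
      unfolding ring_iso_memE(2)[OF iso' ccar(2) \<Phi>car[OF ccar(1)]] \<psi>c \<psi>\<Phi>[OF ccar(1), symmetric] ring_mat_simps ..
    also have "\<dots> = pi_tensor N p1' p2' (RW_x1 N) * (R * pi_tensor N p1 p2 (tm 0 0 0 1 0 0)) * Rinv"
      using R(1,2) by (intro assoc_mult_mat[of _ "N * N" "N * N" _ "N * N" _ "N * N", symmetric]) auto
    also have "\<dots> = pi_tensor N p1' p2' (tm 1 0 0 1 0 0) * (R * Rinv)"
      unfolding interx2 using R(1,2) by (intro assoc_mult_mat[of _ "N * N" "N * N" _ "N * N" _ "N * N"]) auto
    also have "\<dots> = ?\<psi>' (?c' (tm 1 0 0 1 0 0))"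
      unfolding R(3) \<psi>c by (rule right_mult_one_mat) (rule pi_tensor_carrier)
    finally show "?\<psi>' (?c' (RW_x1 N) \<otimes>\<^bsub>?Q'\<^esub> \<Phi> (?c (tm 0 0 0 1 0 0))) = ?\<psi>' (?c' (tm 1 0 0 1 0 0))" .
  qed
  have gx2: "?c' (RW_g N) \<otimes>\<^bsub>?Q'\<^esub> \<Phi> (?c (tm 0 0 0 1 0 0)) = ?c' (tm 0 0 0 1 0 0)"
    unfolding g' Q'.m_assoc[OF ccar(2) ccar(2) \<Phi>car[OF ccar(1)]] x12
    unfolding cls_mult[symmetric] inv(3) ..
  have x2: "\<Phi> (?c (tm 0 0 0 1 0 0)) = inv\<^bsub>?Q'\<^esub> (?c' (RW_g N)) \<otimes>\<^bsub>?Q'\<^esub> ?c' (tm 0 0 0 1 0 0)"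
    unfolding gx2[symmetric] Q'.m_assoc[OF Q'.Units_inv_closed[OF unit] ccar(2) \<Phi>car[OF ccar(1)], symmetric]
      Q'.Units_l_inv[OF unit] Q'.l_one[OF \<Phi>car[OF ccar(1)]] ..
  have ind: "induced_by_RW N \<chi>1 \<chi>2 \<chi>1' \<chi>2' \<Phi>"
    unfolding induced_by_RW_def Let_def using unit x2 \<Phi>c[OF inter(1)] \<Phi>c[OF inter(2)] \<Phi>c[OF inter(3)] \<Phi>c[OF inter(4)] \<Phi>c[OF inter(5)]
    by blast
  have uniq: "\<exists>s. s \<noteq> 0 \<and> R' = s \<cdot>\<^sub>m R"
    if R': "R' \<in> carrier_mat (N * N) (N * N)" "Rinv' \<in> carrier_mat (N * N) (N * N)"
      "R' * Rinv' = 1\<^sub>m (N * N)" "Rinv' * R' = 1\<^sub>m (N * N)"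
      and eq: "\<forall>c \<in> carrier ?Q. R' * ?\<psi> c * Rinv' = ?\<psi>' (\<Phi> c)" for R' Rinv'
  proof (rule conjugation_unique[OF R R'])
    fix M :: "complex mat" assume "M \<in> carrier_mat (N * N) (N * N)"
    \<comment> \<open>Every matrix is the value of \<open>pi_quot\<close> on some class, so
      agreement on the quotient algebra is agreement of the two conjugations on all
      matrices.\<close>
    then obtain c where c: "c \<in> carrier ?Q" "M = ?\<psi> c" using bij(1) by (auto simp: bij_betw_def)
    show "R' * M * Rinv' = R * M * Rinv"
      unfolding c(2) \<psi>\<Phi>[OF c(1)] by (rule bspec[OF eq c(1)])
  qed (use N0 in simp)
  show ?thesis
  proof (rule exI[of _ \<Phi>], intro conjI)
    show "\<Phi> \<in> ring_iso ?Q ?Q'" by (rule \<Phi>)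
    show "induced_by_RW N \<chi>1 \<chi>2 \<chi>1' \<chi>2' \<Phi>" by (rule ind)
  qed (rule exI[of _ R], rule exI[of _ Rinv], intro conjI ballI allI impI R,
      rule \<psi>\<Phi>, assumption, (elim conjE, rule uniq; assumption))
qed

end
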